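(* For every graph $G$ (finite, loopless, undirected, possibly with multiple edges) with maximum degree four, $\chi'_s(G)\le 21$; that is, $G$ has a strong edge-coloring using at most $21$ colors.
   Context: Graphs are finite, loopless, undirected, and may have multiple edges. A strong edge-coloring of a graph $G$ is an assignment of colors to the edges of $G$ such that if two distinct edges $e_1,e_2$ receive the same color, then they are not incident with one another and they are not both incident with a common edge (equivalently, every color class induces a matching in $G$). The strong chromatic index $\chi'_s(G)$ is the minimum number of colors in a strong edge-coloring of $G$. *)

theory Defs imports Main
begin

text \<open>An undirected multigraph has a set of edges of its own, and \<open>ends\<close> maps an edge to its set
  of end vertices. Parallel edges are distinct edges with the same set of ends; a loop would have
  a singleton set of ends.\<close>

record ('v, 'e) multigraph =
  verts :: "'v set"
  edges :: "'e set"
  ends :: "'e \<Rightarrow> 'v set"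

locale finite_loopless_multigraph =
  fixes G :: "('v, 'e) multigraph"
  assumes finite_verts: "finite (verts G)"
    and finite_edges: "finite (edges G)"
    and ends_subset_verts: "e \<in> edges G \<Longrightarrow> ends G e \<subseteq> verts G"
    and card_ends: "e \<in> edges G \<Longrightarrow> card (ends G e) = 2"

definition degree :: "('v, 'e) multigraph \<Rightarrow> 'v \<Rightarrow> nat" where
  "degree G v = card {e \<in> edges G. v \<in> ends G e}"

text \<open>Inserting \<open>0\<close> gives the graph without vertices maximum degree \<open>0\<close>.\<close>

definition max_degree :: "('v, 'e) multigraph \<Rightarrow> nat" where
  "max_degree G = Max (insert 0 (degree G ` verts G))"

definition incident_edges :: "('v, 'e) multigraph \<Rightarrow> 'e \<Rightarrow> 'e \<Rightarrow> bool" where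
  "incident_edges G e f \<longleftrightarrow>
     e \<in> edges G \<and> f \<in> edges G \<and> e \<noteq> f \<and> ends G e \<inter> ends G f \<noteq> {}"

definition strong_edge_coloring :: "('v, 'e) multigraph \<Rightarrow> ('e \<Rightarrow> 'c) \<Rightarrow> bool" where
  "strong_edge_coloring G c \<longleftrightarrow>
     (\<forall>e1\<in>edges G. \<forall>e2\<in>edges G. e1 \<noteq> e2 \<longrightarrow> c e1 = c e2 \<longrightarrow>
        \<not> incident_edges G e1 e2 \<and>
        \<not> (\<exists>e\<in>edges G. incident_edges G e1 e \<and> incident_edges G e2 e))"

definition strong_chromatic_index :: "('v, 'e) multigraph \<Rightarrow> nat" where
  "strong_chromatic_index G =
     (LEAST k. \<exists>c :: 'e \<Rightarrow> nat. strong_edge_coloring G c \<and> card (c ` edges G) = k)"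

text \<open>The minimum is attained, since colouring all edges differently is always possible.\<close>

lemma (in finite_loopless_multigraph) strong_chromatic_index_attained:
  "\<exists>c :: 'e \<Rightarrow> nat. strong_edge_coloring G c \<and> card (c ` edges G) = strong_chromatic_index G"
proof -
  obtain c :: "'e \<Rightarrow> nat" where "inj_on c (edges G)"
    using finite_imp_inj_to_nat_seg[OF finite_edges] by blast
  then have "strong_edge_coloring G c"
    unfolding strong_edge_coloring_def by (meson inj_onD)
  then have "\<exists>k. \<exists>c :: 'e \<Rightarrow> nat. strong_edge_coloring G c \<and> card (c ` edges G) = k"
    by blast
  then show ?thesis
    unfolding strong_chromatic_index_def by (rule LeastI_ex)
qed

end

theory Submission imports Defs
begin

text \<open>Two edges conflict if they share an end or are joined by an edge; in a graph of maximum degree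
  four an edge has at most 24 conflicts. Colour greedily by decreasing distance from a root: an edge
  away from the root conflicts with the four edges at a vertex nearer to the root, which come later,
  so it sees at most 20 colours. Only the edges at the root are critical. They are harmless if the
  root has degree at most three or lies on a double edge or a triangle, because then enough conflicts
  coincide.

  Suppose the graph is simple, 4-regular and triangle-free, and take a cycle of length four as the
  root. Leave uncoloured all edges meeting the cycle and possibly one or two more. Each cycle edge
  conflicts with all of them, and it has fewer than 24 conflicts. Certain pairs of nonconflicting
  uncoloured edges either can share a colour or have disjoint, hence jointly large, lists of available
  colours; so Hall's theorem completes the colouring.

  If there is no such cycle, choose a vertex \<open>v\<close> and two edges beyond each of three neighbours of
  \<open>v\<close>, giving one of the two edges colour 0 and the other one colour 1. The edges at \<open>v\<close> then
  see two colours on these six edges, so they can be coloured last. The other edges are coloured in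
  the direction of \<open>v\<close> while avoiding the ends of the six precoloured edges. This works for the
  component of \<open>v\<close> that remains after these ends are removed. If this component is as large as
  possible, the other components meet so few edges that those can receive distinct colours at the
  beginning.\<close>

section \<open>Greedy colouring and Hall's theorem\<close>

text \<open>The four-cycle part is an account of a deficit. A cycle edge conflicts with every other
  edge of the uncoloured set \<open>U\<close>, so at most 24 - (card U - 1) of its conflicts are
  coloured and its list keeps at least card U - 4 colours. Hall's theorem would want card U. Each
  conflict missing from 24 and each pair of uncoloured edges sharing a colour lowers the deficit by
  one; one cycle edge has to reach zero, the others may stay one short. The case distinctions on
  adjacencies serve to reach this total, and a further edge is left uncoloured where it makes a
  better partner than the edges at the cycle. Without four-cycles an edge at \<open>v\<close> sees
  at most 24 - 6 + 2 = 20 colours. The obstacle is that the removed ends can cut off vertices from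
  \<open>v\<close>, where no direction towards \<open>v\<close> remains. With colours 0 and 1
  reserved, 19 are left for the edges there. Maximality of the component gives each vertex at most
  two neighbours in the other components, and this is just enough to bound those edges by
  19.\<close>

definition proper_on :: "('e \<Rightarrow> 'e \<Rightarrow> bool) \<Rightarrow> 'e set \<Rightarrow> ('e \<Rightarrow> nat) \<Rightarrow> bool" where
  "proper_on K D \<phi> \<longleftrightarrow> (\<forall>e\<in>D. \<forall>f\<in>D. K e f \<longrightarrow> \<phi> e \<noteq> \<phi> f)"

definition colourable :: "('e \<Rightarrow> 'e \<Rightarrow> bool) \<Rightarrow> 'e set \<Rightarrow> bool" where
  "colourable K D \<longleftrightarrow> (\<exists>\<phi>. proper_on K D \<phi> \<and> \<phi> ` D \<subseteq> {..<21})"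

text \<open>\<open>F\<close> is coloured by decreasing \<open>r\<close>, so conflicts of smaller
  rank come later and do not count. On \<open>D\<close> colours are counted instead of edges,
  because precoloured edges may share a colour.\<close>

lemma greedy_extend:
  fixes K :: "'e \<Rightarrow> 'e \<Rightarrow> bool" and r :: "'e \<Rightarrow> nat"
  assumes "finite F" "finite D" and sym: "\<And>e f. K e f \<Longrightarrow> K f e" and irr: "\<And>e. \<not> K e e"
    and "proper_on K D \<phi>" "\<phi> ` D \<subseteq> {..<21}" "D \<inter> F = {}"
    and "\<And>f. f \<in> F \<Longrightarrow>
      card (\<phi> ` {g \<in> D. K f g}) + card {g \<in> F. K f g \<and> r f \<le> r g} \<le> 20"
  shows "\<exists>\<psi>. proper_on K (D \<union> F) \<psi> \<and> \<psi> ` (D \<union> F) \<subseteq> {..<21} \<and> (\<forall>e\<in>D. \<psi> e = \<phi> e)"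
  using assms(1,7,8)
proof (induction "card F" arbitrary: F)
  case 0
  then show ?case using assms(5,6) by auto
next
  case (Suc n)
  then have "F \<noteq> {}" by auto
  \<comment> \<open>An edge of least rank is coloured last, when all its conflicts in
    \<open>F\<close> are coloured already.\<close>
  then obtain f where f: "f \<in> F" "\<And>g. g \<in> F \<Longrightarrow> r f \<le> r g"
    using Suc.prems(1) by (metis arg_min_if_finite(1) arg_min_least)
  let ?F = "F - {f}"
  have "\<exists>\<psi>. proper_on K (D \<union> ?F) \<psi> \<and> \<psi> ` (D \<union> ?F) \<subseteq> {..<21} \<and> (\<forall>e\<in>D. \<psi> e = \<phi> e)"
  proof (rule Suc.hyps(1))
    show "n = card ?F" using Suc.hyps(2) f(1) Suc.prems(1) by simp
    show "finite ?F" "D \<inter> ?F = {}" using Suc.prems by auto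
    show "card (\<phi> ` {g \<in> D. K h g}) + card {g \<in> ?F. K h g \<and> r h \<le> r g} \<le> 20" if "h \<in> ?F" for h
    proof -
      have "card {g \<in> ?F. K h g \<and> r h \<le> r g} \<le> card {g \<in> F. K h g \<and> r h \<le> r g}"
        by (rule card_mono) (use Suc.prems(1) in auto)
      then show ?thesis using Suc.prems(3)[of h] that by auto
    qed
  qed
  then obtain \<psi> where \<psi>: "proper_on K (D \<union> ?F) \<psi>" "\<psi> ` (D \<union> ?F) \<subseteq> {..<21}" "\<forall>e\<in>D. \<psi> e = \<phi> e"
    by blast
  let ?used = "\<psi> ` {g \<in> D. K f g} \<union> \<psi> ` {g \<in> ?F. K f g}"
  have "\<psi> ` {g \<in> D. K f g} = \<phi> ` {g \<in> D. K f g}" using \<psi>(3) by auto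
  moreover have "card (\<psi> ` {g \<in> ?F. K f g}) \<le> card {g \<in> F. K f g \<and> r f \<le> r g}"
    by (rule order.trans[OF card_image_le card_mono]) (use Suc.prems(1) f in auto)
  ultimately have "card ?used \<le> 20"
    using Suc.prems(3)[OF f(1)] card_Un_le[of "\<psi> ` {g \<in> D. K f g}" "\<psi> ` {g \<in> ?F. K f g}"] by simp
  moreover have "finite ?used" using assms(2) Suc.prems(1) by auto
  ultimately have "\<not> {..<21} \<subseteq> ?used"
    using card_mono[of ?used "{..<21::nat}"] by auto
  then obtain c where c: "c < 21" "c \<notin> ?used" by auto
  have fD: "f \<notin> D" using f Suc.prems by auto
  have eq: "D \<union> F = insert f (D \<union> ?F)" using f by auto
  show ?case
  proof (intro exI[of _ "\<psi>(f := c)"] conjI)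
    show "proper_on K (D \<union> F) (\<psi>(f := c))"
      using \<psi>(1) c(2) sym irr unfolding proper_on_def eq by auto
    show "(\<psi>(f := c)) ` (D \<union> F) \<subseteq> {..<21}" using \<psi>(2) c(1) by auto
    show "\<forall>e\<in>D. (\<psi>(f := c)) e = \<phi> e" using \<psi>(3) fD by auto
  qed
qed

text \<open>In any order, the conflicts of an edge forbid fewer colours than its list
  contains.\<close>

lemma list_greedy:
  assumes "finite W" and sym: "\<And>e f. K e f \<Longrightarrow> K f e" and irr: "\<And>e. \<not> K e e"
    and "\<And>e. e \<in> W \<Longrightarrow> finite (L e)"
    and "\<And>e. e \<in> W \<Longrightarrow> card {f \<in> W. K e f} < card (L e)"
  shows "\<exists>\<phi>. (\<forall>e\<in>W. \<phi> e \<in> L e) \<and> proper_on K W \<phi>"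
  using assms(1,4,5)
proof (induction W rule: finite_induct)
  case empty
  then show ?case by (auto simp: proper_on_def)
next
  case (insert x W)
  have "\<exists>\<phi>. (\<forall>e\<in>W. \<phi> e \<in> L e) \<and> proper_on K W \<phi>"
  proof (rule insert.IH)
    show "card {f \<in> W. K e f} < card (L e)" if "e \<in> W" for e
    proof -
      have "card {f \<in> W. K e f} \<le> card {f \<in> insert x W. K e f}"
        by (rule card_mono) (use insert.hyps in auto)
      then show ?thesis using insert.prems(2)[of e] that by simp
    qed
  qed (use insert.prems in auto)
  then obtain \<phi> where \<phi>: "\<forall>e\<in>W. \<phi> e \<in> L e" "proper_on K W \<phi>" by blast
  have "{f \<in> insert x W. K x f} = {f \<in> W. K x f}" using irr by auto
  then have "card (\<phi> ` {f \<in> W. K x f}) < card (L x)"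
    using insert.prems(2)[of x] card_image_le[of "{f \<in> W. K x f}" \<phi>] insert.hyps by simp
  then have "\<not> L x \<subseteq> \<phi> ` {f \<in> W. K x f}"
    using card_mono[of "\<phi> ` {f \<in> W. K x f}" "L x"] insert.hyps by auto
  then obtain c where c: "c \<in> L x" "c \<notin> \<phi> ` {f \<in> W. K x f}" by auto
  have "proper_on K (insert x W) (\<phi>(x := c))"
    using \<phi>(2) c(2) sym irr insert.hyps(2) unfolding proper_on_def by auto
  moreover have "\<forall>e\<in>insert x W. (\<phi>(x := c)) e \<in> L e" using \<phi>(1) c(1) by auto
  ultimately show ?case by blast
qed

text \<open>Hall's theorem, by the argument of Halmos and Vaughan: a proper nonempty subset without
  surplus is matched separately from its complement; if there is none, any single choice works.\<close>

lemma hall: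
  fixes L :: "'i \<Rightarrow> 'c set"
  assumes "finite I" "\<And>i. i \<in> I \<Longrightarrow> finite (L i)"
    and "\<And>J. J \<subseteq> I \<Longrightarrow> card J \<le> card (\<Union>(L ` J))"
  shows "\<exists>f. (\<forall>i\<in>I. f i \<in> L i) \<and> inj_on f I"
  using assms
proof (induction "card I" arbitrary: I L rule: less_induct)
  case less
  note fin = less.prems(1,2) and hallc = less.prems(3)
  have finU: "finite (\<Union>(L ` J))" if "J \<subseteq> I" for J
    using that fin by (auto intro: finite_subset)
  show ?case
  proof (cases "\<exists>J. J \<subseteq> I \<and> J \<noteq> {} \<and> J \<noteq> I \<and> card (\<Union>(L ` J)) = card J")
    case True
    then obtain J where J: "J \<subseteq> I" "J \<noteq> {}" "J \<noteq> I" "card (\<Union>(L ` J)) = card J" by blast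
    let ?M = "\<Union>(L ` J)"
    have "card J < card I" using J fin by (simp add: psubset_card_mono)
    then have "\<exists>f. (\<forall>i\<in>J. f i \<in> L i) \<and> inj_on f J"
      by (rule less.hyps) (use J fin hallc in \<open>auto intro: finite_subset\<close>)
    then obtain f where f: "\<forall>i\<in>J. f i \<in> L i" "inj_on f J" by blast
    have "card (I - J) < card I" 
      by (rule psubset_card_mono[OF fin(1)]) (use J in auto)
    then have "\<exists>g. (\<forall>i\<in>I - J. g i \<in> L i - ?M) \<and> inj_on g (I - J)"
    proof (rule less.hyps)
      show "card X \<le> card (\<Union>i\<in>X. L i - ?M)" if "X \<subseteq> I - J" for X
      proof -
        have "card X + card J = card (X \<union> J)"
          using that J fin by (subst card_Un_disjoint) (auto intro: finite_subset)
        also have "\<dots> \<le> card (\<Union>(L ` (X \<union> J)))" using that J by (intro hallc) auto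
        also have "\<Union>(L ` (X \<union> J)) = (\<Union>i\<in>X. L i - ?M) \<union> ?M" by auto
        also have "card \<dots> \<le> card (\<Union>i\<in>X. L i - ?M) + card ?M" by (rule card_Un_le)
        finally show ?thesis using J by simp
      qed
    qed (use fin in auto)
    then obtain g where g: "\<forall>i\<in>I - J. g i \<in> L i - ?M" "inj_on g (I - J)" by blast
    let ?h = "\<lambda>i. if i \<in> J then f i else g i"
    have "\<forall>i\<in>I. ?h i \<in> L i" using f g by auto
    moreover have "inj_on ?h I"
    proof (rule inj_onI)
      fix x y assume xy: "x \<in> I" "y \<in> I" "?h x = ?h y"
      have "f i \<in> ?M" if "i \<in> J" for i using f that by auto
      moreover have "g i \<notin> ?M" if "i \<in> I" "i \<notin> J" for i using g that by auto
      ultimately have "x \<in> J \<longleftrightarrow> y \<in> J" using xy by (metis (full_types))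
      then show "x = y" using xy f(2) g(2) by (auto simp: inj_on_def split: if_splits)
    qed
    ultimately show ?thesis by (intro exI[of _ ?h] conjI)
  next
    case False
    show ?thesis
    proof (cases "I = {}")
      case True
      then show ?thesis by auto
    next
      case False2: False
      then obtain i where i: "i \<in> I" by blast
      have "card {i} \<le> card (\<Union>(L ` {i}))" using i by (intro hallc) auto
      then have "L i \<noteq> {}" by auto
      then obtain c where c: "c \<in> L i" by blast
      have "card (I - {i}) < card I" using i fin by (meson card_Diff1_less)
      then have "\<exists>g. (\<forall>j\<in>I - {i}. g j \<in> L j - {c}) \<and> inj_on g (I - {i})"
      proof (rule less.hyps)
        show "card X \<le> card (\<Union>j\<in>X. L j - {c})" if X: "X \<subseteq> I - {i}" for X
        proof (cases "X = {}")
          case False3: False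
          have "card X \<le> card (\<Union>(L ` X))" using X by (intro hallc) auto
          moreover have "card (\<Union>(L ` X)) \<noteq> card X" using False X i False3 by blast
          moreover have "(\<Union>j\<in>X. L j - {c}) = \<Union>(L ` X) - {c}" by auto
          ultimately show ?thesis using card_Diff_singleton_if[of "\<Union>(L ` X)" c] by auto
        qed simp
      qed (use fin in auto)
      then obtain g where g: "\<forall>j\<in>I - {i}. g j \<in> L j - {c}" "inj_on g (I - {i})" by blast
      have "inj_on (g(i := c)) I"
        using g by (auto simp: inj_on_def)
      moreover have "\<forall>j\<in>I. (g(i := c)) j \<in> L j" using g c by auto
      ultimately show ?thesis by blast
    qed
  qed
qed

text \<open>\<open>L e\<close> is the list of colours available for \<open>e\<close>. If the two edges of a pair can share a
  colour, let them. Otherwise every pair has disjoint lists, so a set violating Hall's condition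
  contains no edge of \<open>C\<close>; colour a largest such set greedily and use Hall's theorem for the rest.\<close>

lemma pairs_hall:
  fixes L :: "'e \<Rightarrow> nat set" and ps :: "('e \<times> 'e) list"
  assumes "finite U" "C \<subseteq> U" and sym: "\<And>e f. K e f \<Longrightarrow> K f e" and irr: "\<And>e. \<not> K e e"
    and "\<And>e. finite (L e)"
    and "\<And>e. e \<in> U - C \<Longrightarrow> card {f \<in> U - C. K e f} < card (L e)"
    and "\<And>a b. (a, b) \<in> set ps \<Longrightarrow> a \<in> U - C \<and> b \<in> U - C \<and> \<not> K a b \<and> card U \<le> card (L a) + card (L b)"
    and "distinct (map fst ps @ map snd ps)"
    and "\<And>c. c \<in> C \<Longrightarrow> card U \<le> card (L c) + length ps + 1"
    and "C \<noteq> {} \<Longrightarrow> \<exists>c\<in>C. card U \<le> card (L c) + length ps"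
  shows "\<exists>\<phi>. (\<forall>e\<in>U. \<phi> e \<in> L e) \<and> proper_on K U \<phi>"
  using assms(1,2,5-)
proof (induction "length ps" arbitrary: U L ps rule: less_induct)
  case less
  note finU = less.prems(1) and CU = less.prems(2) and finL = less.prems(3)
    and gr = less.prems(4) and pp = less.prems(5) and dist = less.prems(6)
    and c1 = less.prems(7) and c2 = less.prems(8)
  show ?case
  proof (cases "\<exists>a b. (a, b) \<in> set ps \<and> L a \<inter> L b \<noteq> {}")
    case True
    then obtain a b \<alpha> where ab: "(a, b) \<in> set ps" and \<alpha>: "\<alpha> \<in> L a" "\<alpha> \<in> L b" by blast
    obtain xs ys where ps: "ps = xs @ (a, b) # ys" using split_list[OF ab] by blast
    have aneb: "a \<noteq> b" using dist ps by auto
    have abU: "a \<in> U - C" "b \<in> U - C" "\<not> K a b" using pp[OF ab] by auto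
    \<comment> \<open>Both edges get \<alpha>, which is deleted from the lists of their conflicts.
      \<open>card U\<close> drops by two, each list by at most one and \<open>length ps\<close> by
      one, so the inequalities for \<open>C\<close> and for the remaining pairs survive.\<close>
    let ?U = "U - {a, b}" and ?L = "\<lambda>e. if K e a \<or> K e b then L e - {\<alpha>} else L e"
    let ?ps = "xs @ ys"
    have cU: "card U = card ?U + 2"
    proof -
      have "U = insert a (insert b ?U)" using abU by auto
      then show ?thesis using aneb finU
        by (metis (no_types, lifting) DiffE add_2_eq_Suc' card_insert_disjoint finite_Diff
            finite_insert insertCI insertE)
    qed
    have Lge: "card (L e) \<le> card (?L e) + 1" for e
      using finL[of e] by (auto simp: card_Diff_singleton_if)
    have "\<exists>\<phi>. (\<forall>e\<in>?U. \<phi> e \<in> ?L e) \<and> proper_on K ?U \<phi>"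
    proof (rule less.hyps[of ?ps])
      show "length ?ps < length ps" using ps by simp
      show "finite ?U" "C \<subseteq> ?U" "\<And>e. finite (?L e)" using finU CU abU finL by auto
      show "card {f \<in> ?U - C. K e f} < card (?L e)" if e: "e \<in> ?U - C" for e
      proof (cases "K e a \<or> K e b")
        case True
        \<comment> \<open>A list that may lose \<alpha> belongs to an edge conflicting with
          \<open>a\<close> or \<open>b\<close>; deleting that neighbour lowers its conflict count
          too.\<close>
        then have "{f \<in> ?U - C. K e f} \<subset> {f \<in> U - C. K e f}" using abU by auto
        then have "card {f \<in> ?U - C. K e f} < card {f \<in> U - C. K e f}"
          using finU by (intro psubset_card_mono) auto
        then show ?thesis using gr[of e] e Lge[of e] by auto
      next
        case False
        then have "{f \<in> ?U - C. K e f} = {f \<in> U - C. K e f}" by auto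
        then show ?thesis using gr[of e] e False by auto
      qed
      show "distinct (map fst ?ps @ map snd ?ps)" using dist ps by auto
      show "x \<in> ?U - C \<and> y \<in> ?U - C \<and> \<not> K x y \<and> card ?U \<le> card (?L x) + card (?L y)"
        if xy: "(x, y) \<in> set ?ps" for x y
      proof -
        have "(x, y) \<in> set ps" using xy ps by auto
        then have "x \<in> U - C \<and> y \<in> U - C \<and> \<not> K x y \<and> card U \<le> card (L x) + card (L y)" by (rule pp)
        moreover have "x \<noteq> a \<and> x \<noteq> b \<and> y \<noteq> a \<and> y \<noteq> b" using dist ps xy by (force simp: image_iff)
        ultimately show ?thesis using Lge[of x] Lge[of y] cU by auto
      qed
      show "card ?U \<le> card (?L c) + length ?ps + 1" if "c \<in> C" for c
        using c1[OF that] Lge[of c] cU ps by simp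
      show "\<exists>c\<in>C. card ?U \<le> card (?L c) + length ?ps" if "C \<noteq> {}"
      proof -
        obtain c where "c \<in> C" "card U \<le> card (L c) + length ps" using c2[OF \<open>C \<noteq> {}\<close>] by blast
        then show ?thesis using Lge[of c] cU ps by (intro bexI[of _ c]) auto
      qed
    qed
    then obtain \<phi> where \<phi>: "\<forall>e\<in>?U. \<phi> e \<in> ?L e" "proper_on K ?U \<phi>" by blast
    let ?\<phi> = "\<phi>(a := \<alpha>, b := \<alpha>)"
    have ne: "\<phi> e \<noteq> \<alpha>" if "e \<in> ?U" "K e a \<or> K e b" for e
      using bspec[OF \<phi>(1) that(1)] that(2) by auto
    have mem: "\<phi> e \<in> L e" if "e \<in> ?U" for e using \<phi>(1)[rule_format, OF that] by (auto split: if_splits)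
    have "\<forall>e\<in>U. ?\<phi> e \<in> L e" using mem \<alpha> by auto
    moreover have "proper_on K U ?\<phi>"
      unfolding proper_on_def
    proof (intro ballI impI)
      fix e f assume ef: "e \<in> U" "f \<in> U" "K e f"
      consider "e \<in> {a, b}" "f \<in> {a, b}" | "e \<in> {a, b}" "f \<in> ?U" | "e \<in> ?U" "f \<in> {a, b}"
        | "e \<in> ?U" "f \<in> ?U" using ef by blast
      then show "?\<phi> e \<noteq> ?\<phi> f"
      proof cases
        case 1 then show ?thesis using ef abU(3) sym irr by auto
      next
        case 2 then show ?thesis using ef ne[of f] sym by auto
      next
        case 3 then show ?thesis using ef ne[of e] by auto
      next
        case 4 then show ?thesis using ef \<phi>(2) by (auto simp: proper_on_def)
      qed
    qed
    ultimately show ?thesis by blast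
  next
    case False
    define viol where "viol X \<longleftrightarrow> X \<subseteq> U \<and> card (\<Union>(L ` X)) < card X" for X
    have finLU: "finite (\<Union>(L ` X))" if "X \<subseteq> U" for X using that finU finL by (auto intro: finite_subset)
    have violC: "X \<inter> C = {}" if X: "viol X" for X
    proof (rule ccontr)
      assume XC: "X \<inter> C \<noteq> {}"
      have XU: "X \<subseteq> U" and lt: "card (\<Union>(L ` X)) < card X" using X by (auto simp: viol_def)
      have XleU: "card X \<le> card U" using XU finU by (simp add: card_mono)
      have nopair: "a \<notin> X \<or> b \<notin> X" if "(a, b) \<in> set ps" for a b
      proof (rule ccontr)
        assume "\<not> ?thesis"
        then have "L a \<union> L b \<subseteq> \<Union>(L ` X)" by auto
        then have "card (L a \<union> L b) \<le> card (\<Union>(L ` X))" by (rule card_mono[OF finLU[OF XU]])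
        moreover have "card (L a \<union> L b) = card (L a) + card (L b)"
          using False that finL by (intro card_Un_disjoint) auto
        ultimately show False using pp[OF that] lt XleU by simp
      qed
      \<comment> \<open>One member of each pair lies outside \<open>X\<close>. These members are
        distinct and not in \<open>C\<close>, so \<open>X\<close> omits at least
        \<open>length ps\<close> edges of \<open>U\<close>.\<close>
      let ?s = "\<lambda>p. if fst p \<in> X then snd p else fst p"
      have "inj_on ?s (set ps)"
      proof (rule inj_onI)
        fix p q assume pq: "p \<in> set ps" "q \<in> set ps" "?s p = ?s q"
        have "distinct (map fst ps)" "distinct (map snd ps)" "set (map fst ps) \<inter> set (map snd ps) = {}"
          using dist by auto
        then show "p = q" using pq
          by (auto simp: distinct_map inj_on_def split: if_splits)
      qed
      moreover have "distinct ps" using dist by (simp add: distinct_map)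
      ultimately have cs: "card (?s ` set ps) = length ps"
        by (metis card_image distinct_card)
      have sub: "?s ` set ps \<subseteq> U - C - X" 
      proof
        fix y assume "y \<in> ?s ` set ps"
        then obtain a b where "(a, b) \<in> set ps" "y = ?s (a, b)" by auto
        then show "y \<in> U - C - X" using pp[of a b] nopair[of a b] by (auto split: if_splits)
      qed
      have dX: "card X = card U - card (U - X)"
        using XU finU by (metis card_Diff_subset card_mono diff_diff_cancel finite_subset)
      have leU: "card (U - X) \<le> card U" using finU by (simp add: card_mono)
      have one: "length ps \<le> card (U - X)"
        unfolding cs[symmetric] by (rule card_mono) (use sub finU in auto)
      have Lle: "card (L c) \<le> card (\<Union>(L ` X))" if "c \<in> X" for c
        by (rule card_mono[OF finLU[OF XU]]) (use that in auto)
      \<comment> \<open>If \<open>c0\<close> lies in \<open>X\<close>, its list alone is too large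
        for a violation. If not, \<open>c0\<close> is one more edge omitted by \<open>X\<close>,
        which makes up for the extra one in the bound for the other edges of
        \<open>C\<close>.\<close>
      obtain c0 where c0: "c0 \<in> C" "card U \<le> card (L c0) + length ps" using c2 XC by blast
      show False
      proof (cases "c0 \<in> X")
        case True
        then show False using Lle[of c0] c0 lt one dX leU by linarith
      next
        case False
        have "card (insert c0 (?s ` set ps)) \<le> card (U - X)"
          by (rule card_mono) (use sub finU c0 CU False in auto)
        moreover have "c0 \<notin> ?s ` set ps" using sub c0 by blast
        ultimately have "length ps + 1 \<le> card (U - X)" using cs by simp
        moreover obtain c where "c \<in> X" "c \<in> C" using XC by blast
        ultimately show False using Lle[of c] c1[of c] lt dX leU by linarith
      qed
    qed
    let ?S = "{X. X \<subseteq> U \<and> (X = {} \<or> viol X)}"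
    have "finite ?S" using finU by (auto intro: finite_subset[of _ "Pow U"])
    moreover have "{} \<in> ?S" by auto
    ultimately obtain W where W: "W \<in> ?S" "\<And>X. X \<in> ?S \<Longrightarrow> card X \<le> card W"
      using obtains_MAX[of ?S card] by (metis (no_types, lifting) Max_ge empty_iff finite_imageI image_eqI)
    have WU: "W \<subseteq> U" and Wle: "card (\<Union>(L ` W)) \<le> card W" using W(1) by (auto simp: viol_def)
    have WC: "W \<subseteq> U - C" using W(1) violC by blast
    have "\<exists>\<phi>. (\<forall>e\<in>W. \<phi> e \<in> L e) \<and> proper_on K W \<phi>"
    proof (rule list_greedy[where L = L])
      show "finite W" using WU finU finite_subset by blast
      show "card {f \<in> W. K e f} < card (L e)" if "e \<in> W" for e
      proof -
        have "card {f \<in> W. K e f} \<le> card {f \<in> U - C. K e f}"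
          by (rule card_mono) (use WC finU in auto)
        then show ?thesis using gr[of e] WC that by fastforce
      qed
    qed (use sym irr finL in auto)
    then obtain \<phi> where \<phi>: "\<forall>e\<in>W. \<phi> e \<in> L e" "proper_on K W \<phi>" by blast
    let ?M = "\<Union>(L ` W)"
    \<comment> \<open>A set \<open>X\<close> violating Hall's condition after removal of
      \<open>?M\<close> would make \<open>W \<union> X\<close> a larger violator than
      \<open>W\<close>.\<close>
    have "\<exists>g. (\<forall>e\<in>U - W. g e \<in> L e - ?M) \<and> inj_on g (U - W)"
    proof (rule hall)
      show "card X \<le> card (\<Union>e\<in>X. L e - ?M)" if X: "X \<subseteq> U - W" for X
      proof (rule ccontr)
        assume neg: "\<not> ?thesis"
        have "\<Union>(L ` (W \<union> X)) = ?M \<union> (\<Union>e\<in>X. L e - ?M)" by auto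
        then have "card (\<Union>(L ` (W \<union> X))) \<le> card ?M + card (\<Union>e\<in>X. L e - ?M)"
          by (metis card_Un_le)
        also have "\<dots> < card W + card X" using neg Wle by simp
        also have "\<dots> = card (W \<union> X)"
          using X WU finU by (subst card_Un_disjoint) (auto intro: finite_subset)
        finally have "viol (W \<union> X)" using X WU by (auto simp: viol_def)
        then have "card (W \<union> X) \<le> card W" using W(2)[of "W \<union> X"] X WU by auto
        moreover have "card (W \<union> X) = card W + card X"
          using X WU finU by (subst card_Un_disjoint) (auto intro: finite_subset)
        ultimately have "card X = 0" by simp
        then show False using neg by simp
      qed
    qed (use finU finL in auto)
    then obtain g where g: "\<forall>e\<in>U - W. g e \<in> L e - ?M" "inj_on g (U - W)" by blast
    let ?h = "\<lambda>e. if e \<in> W then \<phi> e else g e"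
    have in_M: "\<phi> e \<in> ?M" if "e \<in> W" for e using \<phi>(1) that by auto
    have "\<forall>e\<in>U. ?h e \<in> L e" using \<phi>(1) g(1) by auto
    moreover have "proper_on K U ?h"
      unfolding proper_on_def
    proof (intro ballI impI)
      fix e f assume ef: "e \<in> U" "f \<in> U" "K e f"
      then have "e \<noteq> f" using irr by auto
      have gM: "g x \<notin> ?M" if "x \<in> U - W" for x using bspec[OF g(1) that] by blast
      show "?h e \<noteq> ?h f"
      proof (cases "e \<in> W"; cases "f \<in> W")
        assume "e \<in> W" "f \<in> W"
        then show ?thesis using \<phi>(2) ef by (auto simp: proper_on_def)
      next
        assume "e \<in> W" "f \<notin> W"
        then show ?thesis using in_M[of e] gM[of f] ef by auto
      next
        assume "e \<notin> W" "f \<in> W"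
        then show ?thesis using in_M[of f] gM[of e] ef by auto
      next
        assume "e \<notin> W" "f \<notin> W"
        then show ?thesis using g(2) ef \<open>e \<noteq> f\<close> by (auto simp: inj_on_def)
      qed
    qed
    ultimately show ?thesis by (intro exI[of _ ?h] conjI)
  qed
qed

section \<open>Multigraphs with a small vertex, parallel edges or a triangle\<close>

text \<open>\<open>d\<close> is the distance from \<open>T\<close> along \<open>A\<close>. The
  relation is arbitrary because distances are needed both in the whole graph and inside the
  component left by a deletion.\<close>

lemma descent_rank:
  fixes A :: "'v \<Rightarrow> 'v \<Rightarrow> bool"
  assumes "\<And>x. x \<in> W \<Longrightarrow> \<exists>t\<in>T. A\<^sup>*\<^sup>* t x"
  shows "\<exists>d :: 'v \<Rightarrow> nat. (\<forall>x\<in>W - T. \<exists>y. A y x \<and> d y < d x) \<and> (\<forall>x. x \<in> W \<longrightarrow> (d x = 0 \<longleftrightarrow> x \<in> T))"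
proof -
  define d where "d x = (LEAST n. \<exists>t\<in>T. (A ^^ n) t x)" for x
  have ex: "\<exists>n. \<exists>t\<in>T. (A ^^ n) t x" if "x \<in> W" for x
    using assms[OF that] by (auto simp: rtranclp_power)
  have dI: "\<exists>t\<in>T. (A ^^ d x) t x" if "x \<in> W" for x
    unfolding d_def by (rule LeastI_ex) (rule ex[OF that])
  have d0: "d x = 0 \<longleftrightarrow> x \<in> T" if "x \<in> W" for x
  proof
    assume "d x = 0"
    then show "x \<in> T" using dI[OF that] by auto
  next
    assume "x \<in> T"
    then have "\<exists>t\<in>T. (A ^^ 0) t x" by auto
    then have "d x \<le> 0" unfolding d_def by (rule Least_le)
    then show "d x = 0" by simp
  qed
  have "\<exists>y. A y x \<and> d y < d x" if x: "x \<in> W - T" for x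
  proof -
    obtain n where n: "d x = Suc n" using d0[of x] x not0_implies_Suc by blast
    obtain t where "t \<in> T" "(A ^^ Suc n) t x" using dI[of x] x n by auto
    then obtain y where y: "(A ^^ n) t y" "A y x" by auto
    have "d y \<le> n" unfolding d_def by (rule Least_le) (use y \<open>t \<in> T\<close> in blast)
    then show ?thesis using y n by auto
  qed
  then show ?thesis using d0 by blast
qed

lemma card_UN_le4:
  assumes "finite I" "card I \<le> n" "\<And>h. h \<in> I \<Longrightarrow> card (T h) \<le> 4" "X \<subseteq> (\<Union>h\<in>I. T h)"
    "\<And>h. h \<in> I \<Longrightarrow> finite (T h)"
  shows "card X \<le> 4 * n"
proof -
  have "card X \<le> card (\<Union>h\<in>I. T h)" by (rule card_mono) (use assms in auto)
  also have "\<dots> \<le> (\<Sum>h\<in>I. card (T h))" by (rule card_UN_le) (use assms in auto)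
  also have "\<dots> \<le> card I * 4" using sum_bounded_above[of I "\<lambda>h. card (T h)" 4] assms(3) by simp
  also have "\<dots> \<le> 4 * n" using assms(2) by simp
  finally show ?thesis .
qed

section \<open>Conflicts in a multigraph\<close>

context finite_loopless_multigraph
begin

definition star :: "'v \<Rightarrow> 'e set" where
  "star v = {e \<in> edges G. v \<in> ends G e}"

definition link :: "'v \<Rightarrow> 'v \<Rightarrow> bool" where
  "link x y \<longleftrightarrow> (\<exists>h\<in>edges G. ends G h = {x, y})"

definition conflict :: "'e \<Rightarrow> 'e \<Rightarrow> bool" where
  "conflict e f \<longleftrightarrow> e \<in> edges G \<and> f \<in> edges G \<and> e \<noteq> f \<and>
     (\<exists>x\<in>ends G e. \<exists>y\<in>ends G f. x = y \<or> link x y)"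

definition incs :: "'e \<Rightarrow> 'e set" where
  "incs f = {h \<in> edges G. h \<noteq> f \<and> ends G h \<inter> ends G f \<noteq> {}}"

text \<open>An edge \<open>h\<close> incident with \<open>f\<close> and leading to \<open>w\<close>
  outside \<open>f\<close> accounts for the conflicts in the star of \<open>w\<close>; one parallel
  to \<open>f\<close> accounts for itself alone. At most six such edges with at most four conflicts
  each give the bound 24.\<close>

definition beyond :: "'e \<Rightarrow> 'e \<Rightarrow> 'e set" where
  "beyond f h = {g \<in> edges G. g = h \<or> ends G g \<inter> (ends G h - ends G f) \<noteq> {}}"

lemma link_sym: "link x y \<Longrightarrow> link y x"
  by (auto simp: link_def insert_commute)

lemma conflict_sym: "conflict e f \<Longrightarrow> conflict f e"
  unfolding conflict_def using link_sym by (metis)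

lemma conflict_irrefl: "\<not> conflict e e"
  by (auto simp: conflict_def)

lemma ends_pair: "e \<in> edges G \<Longrightarrow> \<exists>x y. x \<noteq> y \<and> ends G e = {x, y}"
  using card_ends by (meson card_2_iff)

lemma finite_star: "finite (star v)"
  using finite_edges by (auto simp: star_def)

lemma finite_incs: "finite (incs f)" "finite (beyond f h)"
  using finite_edges by (auto simp: incs_def beyond_def)

lemma conflict_subset: "{g \<in> edges G. conflict f g} \<subseteq> (\<Union>h\<in>incs f. beyond f h)"
proof
  fix g assume "g \<in> {g \<in> edges G. conflict f g}"
  then have g: "g \<in> edges G" "f \<in> edges G" "g \<noteq> f"
    "\<exists>x\<in>ends G f. \<exists>y\<in>ends G g. x = y \<or> link x y" by (auto simp: conflict_def)
  show "g \<in> (\<Union>h\<in>incs f. beyond f h)"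
  proof (cases "ends G g \<inter> ends G f = {}")
    case False
    then show ?thesis using g by (auto simp: incs_def beyond_def)
  next
    case True
    then obtain x y h where h: "x \<in> ends G f" "y \<in> ends G g" "h \<in> edges G" "ends G h = {x, y}"
      using g(4) by (auto simp: link_def)
    then have "h \<in> incs f" "g \<in> beyond f h" using True g by (auto simp: incs_def beyond_def)
    then show ?thesis by blast
  qed
qed

end

locale quartic_multigraph = finite_loopless_multigraph G for G :: "('v, 'e) multigraph" +
  assumes degree_le: "v \<in> verts G \<Longrightarrow> degree G v \<le> 4"
    and connected: "x \<in> verts G \<Longrightarrow> y \<in> verts G \<Longrightarrow> link\<^sup>*\<^sup>* x y"
begin

lemma card_star: "card (star v) \<le> 4"
proof (cases "v \<in> verts G")
  case True
  then show ?thesis using degree_le[of v] by (simp add: degree_def star_def)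
next
  case False
  then have "star v = {}" using ends_subset_verts by (auto simp: star_def)
  then show ?thesis by simp
qed

lemma card_star_minus: "e \<in> star v \<Longrightarrow> card (star v - {e}) \<le> 3"
  using card_star[of v] finite_star by (simp add: card_Diff_singleton)

lemma card_incs_le:
  assumes "f \<in> edges G" "ends G f = {x, y}"
  shows "card (incs f) \<le> card (star x - {f}) + card (star y - {f})"
proof -
  have "incs f \<subseteq> (star x - {f}) \<union> (star y - {f})" using assms by (auto simp: incs_def star_def)
  then have "card (incs f) \<le> card ((star x - {f}) \<union> (star y - {f}))"
    by (rule card_mono[rotated]) (simp add: finite_star)
  then show ?thesis using card_Un_le[of "star x - {f}" "star y - {f}"] by linarith
qed

lemma card_incs: "f \<in> edges G \<Longrightarrow> card (incs f) \<le> 6"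
proof -
  assume f: "f \<in> edges G"
  obtain x y where xy: "ends G f = {x, y}" using ends_pair[OF f] by blast
  have "f \<in> star x" "f \<in> star y" using f xy by (auto simp: star_def)
  then show ?thesis using card_incs_le[OF f xy] card_star_minus[of f x] card_star_minus[of f y] by simp
qed

lemma beyond_other:
  assumes "h \<in> edges G" "ends G h = {x, w}" "x \<in> ends G f" "w \<notin> ends G f"
  shows "beyond f h = star w"
  using assms by (auto simp: beyond_def star_def)

lemma card_beyond:
  assumes "h \<in> incs f" shows "card (beyond f h) \<le> 4"
proof -
  have h: "h \<in> edges G" "ends G h \<inter> ends G f \<noteq> {}" using assms by (auto simp: incs_def)
  obtain a b where "ends G h = {a, b}" using ends_pair[OF h(1)] by blast
  then obtain x w where xw: "ends G h = {x, w}" "x \<in> ends G f" using h(2) by auto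
  show ?thesis
  proof (cases "w \<in> ends G f")
    case True
    then have "beyond f h \<subseteq> {h}" using xw by (auto simp: beyond_def)
    then have "card (beyond f h) \<le> card {h}" by (intro card_mono) auto
    then show ?thesis by simp
  next
    case False
    then show ?thesis using beyond_other[OF h(1) xw False] card_star by simp
  qed
qed

lemma conflicts_le20:
  assumes "I \<subseteq> incs f" "card I \<le> 5" "X \<subseteq> (\<Union>h\<in>I. beyond f h)"
  shows "card X \<le> 20"
proof -
  have "card X \<le> 4 * 5"
    by (rule card_UN_le4[of I 5 "beyond f" X])
      (use assms card_beyond finite_incs finite_subset[of I "incs f"] in auto)
  then show ?thesis by simp
qed

text \<open>Without the share that only \<open>h0\<close> contributes, five incident edges with four
  conflicts each remain.\<close>

lemma conflicts_drop:
  assumes f: "f \<in> edges G" and h: "h0 \<in> incs f"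
    and X: "X \<subseteq> {g \<in> edges G. conflict f g} - (beyond f h0 - (\<Union>h\<in>incs f - {h0}. beyond f h))"
  shows "card X \<le> 20"
proof (rule conflicts_le20[of "incs f - {h0}"])
  show "card (incs f - {h0}) \<le> 5" using card_incs[OF f] h finite_incs by simp
  show "X \<subseteq> (\<Union>h\<in>incs f - {h0}. beyond f h)" using X conflict_subset[of f] by blast
qed auto

text \<open>An edge off \<open>v\<close> has a nearest end \<open>x\<close>, and \<open>x\<close>
  has a neighbour \<open>y\<close> nearer still; the edge from \<open>x\<close> to \<open>y\<close>
  contributes the star of \<open>y\<close>, which is coloured later. Edges at \<open>v\<close> have
  no such \<open>y\<close>. They are relieved by \<open>Q\<close>, whose edges have few conflicts
  and can therefore wait until the end.\<close>

lemma greedy_towards: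
  fixes v :: 'v
  assumes v: "v \<in> verts G" and Q: "Q \<subseteq> edges G"
    and Q20: "\<And>f. f \<in> Q \<Longrightarrow> card {g \<in> edges G. conflict f g} \<le> 20"
    and v20: "\<And>f. f \<in> star v \<Longrightarrow> card ({g \<in> edges G. conflict f g} - Q) \<le> 20"
  shows "colourable conflict (edges G)"
proof -
  have "\<exists>d :: 'v \<Rightarrow> nat. (\<forall>x\<in>verts G - {v}. \<exists>y. link y x \<and> d y < d x) \<and>
    (\<forall>x. x \<in> verts G \<longrightarrow> (d x = 0 \<longleftrightarrow> x \<in> {v}))"
    by (rule descent_rank) (use connected v in auto)
  then obtain d :: "'v \<Rightarrow> nat" where dd: "\<forall>x\<in>verts G - {v}. \<exists>y. link y x \<and> d y < d x" by blast
  have d: "\<exists>y. link y x \<and> d y < d x" if "x \<in> verts G" "x \<noteq> v" for x using dd that by blast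
  \<comment> \<open>The \<open>Suc\<close> separates all other edges, including those at
    \<open>v\<close> where the minimum may be 0, from \<open>Q\<close>.\<close>
  define r where "r f = (if f \<in> Q then 0 else Suc (Min (d ` ends G f)))" for f
  have fin: "finite (ends G f)" if "f \<in> edges G" for f using card_ends[OF that] card.infinite by fastforce
  have "\<exists>\<psi>. proper_on conflict ({} \<union> edges G) \<psi> \<and> \<psi> ` ({} \<union> edges G) \<subseteq> {..<21} \<and> (\<forall>e\<in>{}. \<psi> e = (\<lambda>_. 0) e)"
  proof (rule greedy_extend[where r = r])
    show "proper_on conflict {} (\<lambda>_. 0)" by (simp add: proper_on_def)
    show "card ((\<lambda>_. 0) ` {g \<in> {}. conflict f g}) + card {g \<in> edges G. conflict f g \<and> r f \<le> r g} \<le> 20"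
      if f: "f \<in> edges G" for f
    proof -
      let ?X = "{g \<in> edges G. conflict f g \<and> r f \<le> r g}"
      have le: "card ?X \<le> card Y" if "?X \<subseteq> Y" "finite Y" for Y using that by (simp add: card_mono)
      have finN: "finite {g \<in> edges G. conflict f g}" using finite_edges by simp
      consider "f \<in> Q" | "f \<notin> Q" "f \<in> star v" | "f \<notin> Q" "f \<notin> star v" by blast
      then have "card ?X \<le> 20"
      proof cases
        case 1
        have "card ?X \<le> card {g \<in> edges G. conflict f g}" by (rule le) (use finN in auto)
        then show ?thesis using Q20[OF 1] by simp
      next
        case 2
        have "?X \<subseteq> {g \<in> edges G. conflict f g} - Q" using 2 by (auto simp: r_def)
        then have "card ?X \<le> card ({g \<in> edges G. conflict f g} - Q)" by (rule le) (use finN in auto)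
        then show ?thesis using v20[OF 2(2)] by simp
      next
        case 3
        obtain x where x: "x \<in> ends G f" "d x = Min (d ` ends G f)"
          using fin[OF f] card_ends[OF f] Min_in[of "d ` ends G f"] by fastforce
        have "x \<in> verts G" "x \<noteq> v" using x 3 f ends_subset_verts by (auto simp: star_def)
        then obtain y where y: "link y x" "d y < d x" using d by blast
        then obtain h0 where h0: "h0 \<in> edges G" "ends G h0 = {x, y}" by (auto simp: link_def insert_commute)
        have ynf: "y \<notin> ends G f" using y(2) x(2) fin[OF f] by (metis Min_le finite_imageI imageI linorder_not_le)
        then have "h0 \<in> incs f" using h0 x by (auto simp: incs_def)
        have bey: "beyond f h0 = star y" by (rule beyond_other) (use h0 x ynf in auto)
        have "r g < r f" if "g \<in> star y" for g
        proof -
          have "g \<in> edges G" "y \<in> ends G g" using that by (auto simp: star_def)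
          then have "Min (d ` ends G g) \<le> d y" using fin by (intro Min_le) auto
          then show ?thesis using 3 y(2) x(2) by (auto simp: r_def)
        qed
        then have "?X \<subseteq> {g \<in> edges G. conflict f g} - star y" by fastforce
        then show ?thesis using bey by (intro conflicts_drop[OF f \<open>h0 \<in> incs f\<close>]) auto
      qed
      then show ?thesis by simp
    qed
  qed (use finite_edges conflict_sym conflict_irrefl in auto)
  then show ?thesis by (auto simp: colourable_def)
qed

text \<open>An edge at \<open>v\<close> has at most 2 + 3 incident edges, hence at most 20
  conflicts.\<close>

lemma colourable_low_degree:
  assumes v: "v \<in> verts G" "degree G v \<le> 3"
  shows "colourable conflict (edges G)"
proof (rule greedy_towards[OF v(1), of "{}"])
  fix f assume f: "f \<in> star v"
  then obtain y where y: "ends G f = {v, y}" and fe: "f \<in> edges G"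
    using ends_pair[of f] by (force simp: star_def)
  have "f \<in> star y" using fe y by (auto simp: star_def)
  have "card (star v) \<le> 3" using v(2) by (simp add: degree_def star_def)
  then have "card (star v - {f}) \<le> 2" using f finite_star by (simp add: card_Diff_singleton)
  then have "card (incs f) \<le> 5"
    using card_incs_le[OF fe y] card_star_minus[OF \<open>f \<in> star y\<close>] by simp
  then show "card ({g \<in> edges G. conflict f g} - {}) \<le> 20"
    using conflicts_le20[of "incs f" f] conflict_subset[of f] by simp
qed auto

lemma same_beyond:
  assumes f: "f \<in> edges G" and h: "h \<in> incs f" "h' \<in> incs f" "h \<noteq> h'" "beyond f h = beyond f h'"
  shows "card {g \<in> edges G. conflict f g} \<le> 20"
proof (rule conflicts_drop[OF f h(2)])
  show "{g \<in> edges G. conflict f g} \<subseteq> {g \<in> edges G. conflict f g} -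
    (beyond f h' - (\<Union>h\<in>incs f - {h'}. beyond f h))" using h by blast
qed

text \<open>The root is an end \<open>u\<close> of the double edge. An edge at \<open>u\<close>
  parallel to it meets another copy at both ends and so has only five incident edges; for any other
  edge at \<open>u\<close> the two copies lead to the same vertex.\<close>

lemma colourable_parallel:
  assumes e: "e \<in> edges G" "e' \<in> edges G" "e \<noteq> e'" "ends G e = ends G e'"
  shows "colourable conflict (edges G)"
proof -
  obtain u w where uw: "ends G e = {u, w}" "u \<noteq> w" using ends_pair[OF e(1)] by blast
  then have "u \<in> verts G" using ends_subset_verts[OF e(1)] by auto
  then show ?thesis
  proof (rule greedy_towards[of u "{}"])
    fix f assume fu: "f \<in> star u"
    have fe: "f \<in> edges G" using fu by (simp add: star_def)
    show "card ({g \<in> edges G. conflict f g} - {}) \<le> 20"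
    proof (cases "w \<in> ends G f")
      case True
      then have fuw: "ends G f = {u, w}" "f \<in> star w" using fu fe uw ends_pair[OF fe] by (auto simp: star_def)
      obtain e2 where e2: "e2 \<in> edges G" "e2 \<noteq> f" "ends G e2 = {u, w}" using e uw by metis
      have "incs f \<subseteq> (star u - {f}) \<union> (star w - {f} - {e2})"
        using fuw e2 by (auto simp: incs_def star_def)
      then have "card (incs f) \<le> card ((star u - {f}) \<union> (star w - {f} - {e2}))"
        by (intro card_mono) (auto simp: finite_star)
      also have "\<dots> \<le> card (star u - {f}) + card (star w - {f} - {e2})" by (rule card_Un_le)
      also have "card (star w - {f} - {e2}) = card (star w - {f}) - 1"
        using e2 finite_star by (simp add: star_def)
      finally have "card (incs f) \<le> 5"
        using card_star_minus[OF fu] card_star_minus[OF fuw(2)] by simp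
      then show ?thesis using conflicts_le20[of "incs f" f] conflict_subset[of f] by simp
    next
      case False
      then have "e \<in> incs f" "e' \<in> incs f" using e uw fu by (auto simp: incs_def star_def)
      moreover have "beyond f e = star w" "beyond f e' = star w"
        by (rule beyond_other[of _ u]; use e uw fu False in \<open>auto simp: star_def\<close>)+
      ultimately show ?thesis using same_beyond[OF fe, of e e'] e(3) by simp
    qed
  qed auto
qed

text \<open>For each triangle edge the other two lead to the same vertex, so it has at most 20
  conflicts. Hence the triangle can be coloured last and relieve the other edges at
  \<open>u\<close>.\<close>

lemma colourable_triangle:
  assumes e: "e \<in> edges G" "ends G e = {u, w}" "e1 \<in> edges G" "ends G e1 = {u, x}"
    "e2 \<in> edges G" "ends G e2 = {w, x}" and d: "u \<noteq> w" "u \<noteq> x" "w \<noteq> x"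
  shows "colourable conflict (edges G)"
proof -
  have ne: "e \<noteq> e1" "e \<noteq> e2" "e1 \<noteq> e2" using e d by (auto simp: doubleton_eq_iff)
  let ?Q = "{e, e1, e2}"
  have "u \<in> verts G" using ends_subset_verts[of e] e by auto
  then show ?thesis
  proof (rule greedy_towards[of u ?Q])
    have tri: "card {g \<in> edges G. conflict f g} \<le> 20"
      if "f \<in> edges G" "h \<in> edges G" "h' \<in> edges G" "ends G f = {a, b}" "ends G h = {a, c}" "ends G h' = {b, c}"
        "a \<noteq> b" "a \<noteq> c" "b \<noteq> c" for f h h' a b c
    proof (rule same_beyond[of f h h'])
      show "h \<in> incs f" "h' \<in> incs f" using that by (auto simp: incs_def)
      show "h \<noteq> h'" using that by (auto simp: doubleton_eq_iff)
      show "beyond f h = beyond f h'"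
        using beyond_other[of h a c f] beyond_other[of h' b c f] that by simp
    qed (use that in auto)
    show "card {g \<in> edges G. conflict f g} \<le> 20" if "f \<in> ?Q" for f
      using that tri[of e e1 e2 u w x] tri[of e1 e e2 u x w] tri[of e2 e e1 w x u] e d
      by (auto simp: insert_commute)
    fix f assume fu: "f \<in> star u"
    have fe: "f \<in> edges G" using fu by (simp add: star_def)
    show "card ({g \<in> edges G. conflict f g} - ?Q) \<le> 20"
    proof (cases "f \<in> ?Q")
      case True
      have "card ({g \<in> edges G. conflict f g} - ?Q) \<le> card {g \<in> edges G. conflict f g}"
        by (rule card_mono) (use finite_edges in auto)
      moreover have "card {g \<in> edges G. conflict f g} \<le> 20"
        using True tri[of e e1 e2 u w x] tri[of e1 e e2 u x w] tri[of e2 e e1 w x u] e d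
        by (auto simp: insert_commute)
      ultimately show ?thesis by simp
    next
      case False
      show ?thesis
      proof (cases "w \<in> ends G f \<or> x \<in> ends G f")
        case True
        moreover have "u \<in> ends G f" using fu by (simp add: star_def)
        moreover obtain a b where "ends G f = {a, b}" using ends_pair[OF fe] by blast
        ultimately have "ends G f = ends G e \<or> ends G f = ends G e1"
          using e d by (auto simp: doubleton_eq_iff)
        \<comment> \<open>A triangle edge parallel to \<open>f\<close> contributes only itself, and
          it is coloured later.\<close>
        then have "\<exists>h\<in>?Q. h \<in> edges G \<and> ends G h = ends G f" using e(1,3) by auto
        then obtain h where h: "h \<in> ?Q" "h \<in> edges G" "ends G h = ends G f" by blast
        have "ends G f \<noteq> {}" using ends_pair[OF fe] by blast
        moreover have "h \<noteq> f" using h(1) False by blast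
        ultimately have h': "h \<in> incs f" "beyond f h \<subseteq> {h}"
          using h(2) by (auto simp: incs_def beyond_def h(3))
        show ?thesis by (rule conflicts_drop[OF fe h'(1)]) (use h h' in auto)
      next
        case F: False
        have i: "e \<in> incs f" "e1 \<in> incs f" using e fu False by (auto simp: incs_def star_def)
        have b: "beyond f e = star w" "beyond f e1 = star x"
          using beyond_other[of e u w f] beyond_other[of e1 u x f] e fu F by (auto simp: star_def)
        let ?I = "incs f - {e, e1}" and ?N = "{g \<in> edges G. conflict f g}"
        \<comment> \<open>\<open>e\<close> and \<open>e1\<close> lead to \<open>w\<close> and
          \<open>x\<close>, where two edges each belong to the triangle and do not count. This
          leaves 2 + 2 conflicts there and 16 from the other four incident edges.\<close>
        have "?N - ?Q \<subseteq> (\<Union>h\<in>?I. beyond f h) \<union> ((star w - {e, e2}) \<union> (star x - {e1, e2}))"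
          using conflict_subset[of f] b by blast
        then have "card (?N - ?Q) \<le> card ((\<Union>h\<in>?I. beyond f h) \<union> ((star w - {e, e2}) \<union> (star x - {e1, e2})))"
          by (intro card_mono) (auto simp: finite_star finite_incs)
        also have "\<dots> \<le> card (\<Union>h\<in>?I. beyond f h) + (card (star w - {e, e2}) + card (star x - {e1, e2}))"
          by (meson add_left_mono card_Un_le order_trans)
        finally have c: "card (?N - ?Q) \<le> \<dots>" .
        have "card (star w - {e, e2}) \<le> 2" "card (star x - {e1, e2}) \<le> 2"
          using card_star[of w] card_star[of x] e ne
          by (subst card_Diff_subset; auto simp: star_def)+
        moreover have "card ?I \<le> 4" using card_incs[OF fe] i ne finite_incs
          by (subst card_Diff_subset) auto
        then have "card (\<Union>h\<in>?I. beyond f h) \<le> 4 * 4"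
          using card_UN_le4[of ?I 4 "beyond f" "\<Union>h\<in>?I. beyond f h"]
          by (auto simp: finite_incs card_beyond)
        ultimately show ?thesis using c by simp
      qed
    qed
  qed (use e in auto)
qed

end

section \<open>Simple triangle-free 4-regular graphs\<close>

lemma card_filter_sum: "finite A \<Longrightarrow> card {x \<in> A. P x} = (\<Sum>x\<in>A. if P x then 1 else 0)"
  by (simp add: sum.If_cases Int_def)

locale quartic_graph =
  fixes V :: "'v set" and adj :: "'v \<Rightarrow> 'v \<Rightarrow> bool"
  assumes finite_V: "finite V"
    and adj_sym: "adj x y \<Longrightarrow> adj y x"
    and adj_V: "adj x y \<Longrightarrow> x \<in> V"
    and triangle_free: "adj x y \<Longrightarrow> adj y z \<Longrightarrow> \<not> adj x z"
    and card_nb: "x \<in> V \<Longrightarrow> card {y. adj x y} = 4"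
    and connected: "x \<in> V \<Longrightarrow> y \<in> V \<Longrightarrow> adj\<^sup>*\<^sup>* x y"
begin

definition nb :: "'v \<Rightarrow> 'v set" where "nb x = {y. adj x y}"

definition E :: "'v set set" where "E = {{x, y} |x y. adj x y}"

definition star :: "'v \<Rightarrow> 'v set set" where "star v = {e \<in> E. v \<in> e}"

definition conf :: "'v set \<Rightarrow> 'v set \<Rightarrow> bool" where
  "conf e f \<longleftrightarrow> e \<in> E \<and> f \<in> E \<and> e \<noteq> f \<and> (\<exists>x\<in>e. \<exists>y\<in>f. x = y \<or> adj x y)"

definition N :: "'v set \<Rightarrow> 'v set set" where "N e = {f. conf e f}"

lemma adj_irrefl: "\<not> adj x x"
  using triangle_free by blast

lemma adj_commute: "adj x y \<longleftrightarrow> adj y x"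
  using adj_sym by blast

lemma adj_V2: "adj x y \<Longrightarrow> y \<in> V"
  using adj_sym adj_V by blast

lemma finite_nb: "finite (nb x)"
  using finite_V adj_V2 by (auto simp: nb_def intro: finite_subset)

lemma edge_in_E: "{x, y} \<in> E \<longleftrightarrow> adj x y"
  using adj_sym by (auto simp: E_def doubleton_eq_iff)

lemma E_cases:
  assumes "e \<in> E" obtains x y where "e = {x, y}" "adj x y" "x \<noteq> y"
  using assms adj_irrefl unfolding E_def by blast

lemma card_nb4: "x \<in> V \<Longrightarrow> card (nb x) = 4"
  using card_nb by (simp add: nb_def)

lemma nb_iff: "y \<in> nb x \<longleftrightarrow> adj x y"
  by (simp add: nb_def)

lemma edge_other: "e \<in> E \<Longrightarrow> y \<in> e \<Longrightarrow> \<exists>z. e = {y, z} \<and> adj y z"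
proof -
  assume e: "e \<in> E" "y \<in> e"
  obtain p q where pq: "e = {p, q}" "adj p q" using E_cases[OF e(1)] by blast
  then have "y = p \<or> y = q" using e(2) by simp
  then show ?thesis using pq adj_sym by (metis insert_commute)
qed

lemma finite_E: "finite E"
proof (rule finite_subset)
  show "E \<subseteq> Pow V" using adj_V adj_V2 by (auto simp: E_def)
qed (use finite_V in simp)

lemma finite_sub_E [simp]: "finite {e \<in> E. P e}" "finite (star v)" "finite (N e)"
  using finite_E by (auto simp: star_def N_def conf_def intro: finite_subset)

lemma star_subset_E: "star v \<subseteq> E" by (auto simp: star_def)

lemma star_image: "star v = (\<lambda>y. {v, y}) ` nb v"
  using adj_sym by (auto simp: star_def E_def nb_def)

lemma card_star: "v \<in> V \<Longrightarrow> card (star v) = 4"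
  unfolding star_image using card_nb[of v]
  by (subst card_image) (auto simp: inj_on_def doubleton_eq_iff nb_def)

lemma conf_sym: "conf e f \<Longrightarrow> conf f e"
  unfolding conf_def using adj_sym by metis

lemma conf_irrefl: "\<not> conf e e" by (auto simp: conf_def)

lemma conf_share: "e \<in> E \<Longrightarrow> f \<in> E \<Longrightarrow> e \<noteq> f \<Longrightarrow> x \<in> e \<Longrightarrow> x \<in> f \<Longrightarrow> conf e f"
  by (auto simp: conf_def)

lemma conf_adj: "e \<in> E \<Longrightarrow> f \<in> E \<Longrightarrow> e \<noteq> f \<Longrightarrow> x \<in> e \<Longrightarrow> y \<in> f \<Longrightarrow> adj x y \<Longrightarrow> conf e f"
  by (auto simp: conf_def)

lemma star_subset_N:
  assumes "e \<in> E" "x \<in> e" "adj x y" "y \<notin> e"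
  shows "star y \<subseteq> N e"
  using assms conf_adj[of e _ x y] by (auto simp: N_def star_def)

text \<open>The degree sum over \<open>S\<close> counts an edge with one end in \<open>S\<close>
  once and an edge inside \<open>S\<close> twice.\<close>

lemma card_meeting:
  assumes "S \<subseteq> V"
  shows "card {f \<in> E. f \<inter> S \<noteq> {}} + card {f \<in> E. f \<subseteq> S} = 4 * card S"
proof -
  have finS: "finite S" using assms finite_V finite_subset by blast
  have "4 * card S = (\<Sum>x\<in>S. card (star x))" using assms card_star by (simp add: subset_iff)
  also have "\<dots> = (\<Sum>x\<in>S. \<Sum>f\<in>E. if x \<in> f then 1 else 0)"
    by (intro sum.cong refl) (simp add: star_def card_filter_sum[OF finite_E])
  also have "\<dots> = (\<Sum>f\<in>E. \<Sum>x\<in>S. if x \<in> f then 1 else 0)" by (rule sum.swap)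
  also have "\<dots> = (\<Sum>f\<in>E. (if f \<inter> S \<noteq> {} then 1 else 0) + (if f \<subseteq> S then 1 else 0))"
  proof (intro sum.cong refl)
    fix f assume "f \<in> E"
    then obtain x y where xy: "f = {x, y}" "x \<noteq> y" using E_cases by blast
    have "(\<Sum>z\<in>S. if z \<in> f then 1 else 0) = card {z \<in> S. z \<in> f}"
      by (simp add: card_filter_sum[OF finS])
    also have "{z \<in> S. z \<in> f} = f \<inter> S" by auto
    also have "card (f \<inter> S) = (if f \<inter> S \<noteq> {} then 1 else 0) + (if f \<subseteq> S then 1 else 0)"
      using xy by (cases "x \<in> S"; cases "y \<in> S") auto
    finally show "(\<Sum>z\<in>S. if z \<in> f then 1 else 0) = (if f \<inter> S \<noteq> {} then 1 else (0::nat)) + (if f \<subseteq> S then 1 else 0)" .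
  qed
  also have "\<dots> = card {f \<in> E. f \<inter> S \<noteq> {}} + card {f \<in> E. f \<subseteq> S}"
    by (simp add: sum.distrib card_filter_sum[OF finite_E])
  finally show ?thesis by simp
qed

text \<open>The edges conflicting with \<open>{u, w}\<close> are those meeting the eight neighbours of \<open>u\<close> and \<open>w\<close>;
  each edge joining a neighbour of \<open>u\<close> to a neighbour of \<open>w\<close> is counted twice in \<open>8 \<cdot> 4\<close>.\<close>

lemma card_N_gain:
  assumes uw: "adj u w" and "finite D"
    and D: "\<And>d. d \<in> D \<Longrightarrow> \<exists>x y. d = {x, y} \<and> adj u x \<and> x \<noteq> w \<and> adj w y \<and> y \<noteq> u \<and> adj x y"
  shows "card (N {u, w}) + card D \<le> 24"
proof -
  let ?S = "nb u \<union> nb w"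
  have V: "u \<in> V" "w \<in> V" using uw adj_V adj_V2 by auto
  have disj: "nb u \<inter> nb w = {}" using triangle_free[of u w] uw adj_commute by (auto simp: nb_def)
  have cS: "card ?S = 8" using V card_nb disj finite_nb by (subst card_Un_disjoint) (auto simp: nb_def)
  have SV: "?S \<subseteq> V" using adj_V2 by (auto simp: nb_def)
  have eE: "{u, w} \<in> E" using uw edge_in_E by simp
  have M: "{f \<in> E. f \<inter> ?S \<noteq> {}} = insert {u, w} (N {u, w})"
  proof (intro equalityI subsetI)
    fix f assume "f \<in> {f \<in> E. f \<inter> ?S \<noteq> {}}"
    then obtain y where "f \<in> E" "y \<in> f" "adj u y \<or> adj w y" by (auto simp: nb_def)
    then show "f \<in> insert {u, w} (N {u, w})"
      using eE conf_adj[of "{u, w}" f] by (auto simp: N_def)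
  next
    fix f assume f: "f \<in> insert {u, w} (N {u, w})"
    then have "f \<in> E" "\<exists>y\<in>f. y = u \<or> y = w \<or> adj u y \<or> adj w y"
      using eE by (auto simp: N_def conf_def)
    then show "f \<in> {f \<in> E. f \<inter> ?S \<noteq> {}}" using uw adj_commute by (auto simp: nb_def)
  qed
  \<comment> \<open>The seven edges at \<open>u\<close> or \<open>w\<close> lie inside
    \<open>?S\<close> as well, since \<open>u\<close> and \<open>w\<close> are neighbours of each
    other. Now 32 - 7 = 25 still includes \<open>{u, w}\<close> itself, which leaves 24.\<close>
  have sub: "(star u \<union> star w) \<union> D \<subseteq> {f \<in> E. f \<subseteq> ?S}"
  proof -
    have "star u \<union> star w \<subseteq> {f \<in> E. f \<subseteq> ?S}"
      using uw adj_commute by (auto simp: star_image nb_def edge_in_E)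
    moreover have "D \<subseteq> {f \<in> E. f \<subseteq> ?S}" using D by (fastforce simp: nb_def edge_in_E)
    ultimately show ?thesis by blast
  qed
  have "star u \<inter> star w = {{u, w}}"
  proof (intro equalityI subsetI)
    fix e assume "e \<in> star u \<inter> star w"
    then have e: "e \<in> E" "u \<in> e" "w \<in> e" by (auto simp: star_def)
    obtain x y where "e = {x, y}" using E_cases[OF e(1)] by blast
    then show "e \<in> {{u, w}}" using e uw adj_irrefl by auto
  qed (use eE in \<open>auto simp: star_def\<close>)
  then have c7: "card (star u \<union> star w) = 7"
    using card_Un_Int[of "star u" "star w"] card_star V by simp
  have "(star u \<union> star w) \<inter> D = {}"
  proof -
    have "u \<notin> d \<and> w \<notin> d" if "d \<in> D" for d
      using D[OF that] adj_irrefl triangle_free uw adj_commute by blast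
    then show ?thesis by (auto simp: star_def)
  qed
  then have "card ((star u \<union> star w) \<union> D) = 7 + card D"
    using c7 \<open>finite D\<close> by (subst card_Un_disjoint) auto
  then have "7 + card D \<le> card {f \<in> E. f \<subseteq> ?S}" using card_mono[OF _ sub] by simp
  moreover have "card (insert {u, w} (N {u, w})) = Suc (card (N {u, w}))"
    by (rule card_insert_disjoint) (auto simp: N_def conf_def)
  ultimately show ?thesis using card_meeting[OF SV] M cS by simp
qed

lemma card_N:
  assumes "e \<in> E" shows "card (N e) \<le> 24"
proof -
  obtain x y where "e = {x, y}" "adj x y" using E_cases[OF assms] by blast
  then show ?thesis using card_N_gain[of x y "{}"] by simp
qed

lemma card_N_minus:
  assumes "e \<in> E" "X \<subseteq> N e" shows "card (N e - X) + card X \<le> 24"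
proof -
  have "finite X" using assms(2) finite_sub_E(3) finite_subset by blast
  then have "card (N e - X) + card X = card (N e)"
    using assms(2) card_mono[OF finite_sub_E(3) assms(2)] by (simp add: card_Diff_subset)
  then show ?thesis using card_N[OF assms(1)] by simp
qed

text \<open>The four edges at a vertex nearer to \<open>T\<close> are either coloured later or
  belong to \<open>U\<close>; in both cases they forbid nothing.\<close>

lemma colour_outside:
  assumes T: "T \<subseteq> V" "T \<noteq> {}" and U: "\<And>v. v \<in> T \<Longrightarrow> star v \<subseteq> U"
  shows "\<exists>\<phi>. proper_on conf (E - U) \<phi> \<and> \<phi> ` (E - U) \<subseteq> {..<21}"
proof -
  have "\<exists>d :: 'v \<Rightarrow> nat. (\<forall>x\<in>V - T. \<exists>y. adj y x \<and> d y < d x) \<and> (\<forall>x. x \<in> V \<longrightarrow> (d x = 0 \<longleftrightarrow> x \<in> T))"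
    by (rule descent_rank) (use connected T in blast)
  then obtain d :: "'v \<Rightarrow> nat" where d: "\<forall>x\<in>V - T. \<exists>y. adj y x \<and> d y < d x" by blast
  let ?r = "\<lambda>f. Min (d ` f)"
  have "\<exists>\<psi>. proper_on conf ({} \<union> (E - U)) \<psi> \<and> \<psi> ` ({} \<union> (E - U)) \<subseteq> {..<21} \<and> (\<forall>e\<in>{}. \<psi> e = (\<lambda>_. 0) e)"
  proof (rule greedy_extend[where r = ?r])
    show "proper_on conf {} (\<lambda>_. 0)" by (simp add: proper_on_def)
    show "card ((\<lambda>_. 0) ` {g \<in> {}. conf f g}) + card {g \<in> E - U. conf f g \<and> ?r f \<le> ?r g} \<le> 20"
      if f: "f \<in> E - U" for f
    proof -
      have fe: "f \<in> E" using f by auto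
      have fin: "finite g" if "g \<in> E" for g using that by (auto elim: E_cases)
      obtain x where x: "x \<in> f" "d x = Min (d ` f)"
        using Min_in[of "d ` f"] fin[OF fe] fe by (fastforce elim: E_cases)
      have "x \<in> V" using x(1) fe adj_V adj_V2 by (auto elim!: E_cases)
      moreover have "x \<notin> T" using x(1) f U by (auto simp: star_def)
      ultimately obtain y where y: "adj y x" "d y < d x" using d by blast
      have ynf: "y \<notin> f" using y(2) x(2) fin[OF fe] by (metis Min_le finite_imageI imageI linorder_not_le)
      have "\<not> ?r f \<le> ?r g" if "g \<in> star y" for g
      proof -
        have "g \<in> E" "y \<in> g" using that by (auto simp: star_def)
        then have "?r g \<le> d y" using fin by (intro Min_le) auto
        then show ?thesis using y(2) x(2) by simp
      qed
      then have "{g \<in> E - U. conf f g \<and> ?r f \<le> ?r g} \<subseteq> N f - star y" by (auto simp: N_def)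
      then have "card {g \<in> E - U. conf f g \<and> ?r f \<le> ?r g} \<le> card (N f - star y)" by (rule card_mono[rotated]) simp
      moreover have "star y \<subseteq> N f" using star_subset_N[OF fe x(1)] y adj_sym ynf by blast
      then have "card (N f - star y) + 4 \<le> 24"
        using card_N_minus[OF fe, of "star y"] card_star[OF adj_V[OF y(1)]] by simp
      ultimately show ?thesis by simp
    qed
  qed (use finite_E in \<open>auto intro: conf_sym simp: conf_irrefl\<close>)
  then show ?thesis by simp
qed

text \<open>The first component is near \<open>u\<close>, the second near \<open>w\<close>. No
  vertex is near both, so distinct ordered pairs are distinct edges.\<close>

lemma gain:
  assumes "adj u w" "finite R"
    and R: "\<And>x y. (x, y) \<in> R \<Longrightarrow> adj u x \<and> x \<noteq> w \<and> adj w y \<and> y \<noteq> u \<and> adj x y"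
  shows "card (N {u, w}) + card R \<le> 24"
proof -
  let ?f = "\<lambda>p. {fst p, snd p}"
  have "inj_on ?f R"
  proof (rule inj_onI)
    fix p q assume pq: "p \<in> R" "q \<in> R" "?f p = ?f q"
    have *: "adj u (fst p)" "adj w (snd p)" "adj u (fst q)" "adj w (snd q)" using pq R by (metis prod.collapse)+
    then have "fst p \<noteq> snd q" "fst q \<noteq> snd p"
      using triangle_free[of u w] assms(1) adj_sym by metis+
    then show "p = q" using pq(3) by (auto simp: doubleton_eq_iff prod_eq_iff)
  qed
  then have "card (?f ` R) = card R" by (rule card_image)
  moreover have "card (N {u, w}) + card (?f ` R) \<le> 24"
  proof (rule card_N_gain)
    fix d assume "d \<in> ?f ` R"
    then obtain x y where "(x, y) \<in> R" "d = {x, y}" by auto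
    then show "\<exists>x y. d = {x, y} \<and> adj u x \<and> x \<noteq> w \<and> adj w y \<and> y \<noteq> u \<and> adj x y" using R by blast
  qed (use assms in auto)
  ultimately show ?thesis by simp
qed

end

section \<open>Cycles of length four\<close>

text \<open>The outer neighbours of opposite cycle vertices may coincide; this distinguishes the
  cases below. The four names in one neighbourhood are distinct because its cardinality is
  four.\<close>

locale four_cycle = quartic_graph +
  fixes v0 v1 v2 v3 a0 b0 a1 b1 a2 b2 a3 b3 :: 'a
  assumes nb0: "nb v0 = {v1, v3, a0, b0}" and nb1: "nb v1 = {v0, v2, a1, b1}"
    and nb2: "nb v2 = {v1, v3, a2, b2}" and nb3: "nb v3 = {v0, v2, a3, b3}"
    and v02: "v0 \<noteq> v2" and v13: "v1 \<noteq> v3"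
begin

definition C :: "'a set set" where "C = {{v0, v1}, {v1, v2}, {v2, v3}, {v3, v0}}"

definition U0 :: "'a set set" where "U0 = star v0 \<union> star v1 \<union> star v2 \<union> star v3"

text \<open>The edges of \<open>U0 \<union> W\<close> that may receive the colour of \<open>e\<close>.\<close>

definition misses :: "'a set set \<Rightarrow> 'a set \<Rightarrow> 'a set set" where
  "misses W e = U0 \<union> W - N e - {e}"

lemma adj_iffs:
  "adj v0 x \<longleftrightarrow> x \<in> {v1, v3, a0, b0}" "adj v1 x \<longleftrightarrow> x \<in> {v0, v2, a1, b1}"
  "adj v2 x \<longleftrightarrow> x \<in> {v1, v3, a2, b2}" "adj v3 x \<longleftrightarrow> x \<in> {v0, v2, a3, b3}"
  by (simp_all only: nb0[symmetric] nb1[symmetric] nb2[symmetric] nb3[symmetric] nb_def mem_Collect_eq)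

lemma adjs_out:
  "adj v0 v1" "adj v1 v2" "adj v2 v3" "adj v3 v0" "adj v1 v0" "adj v2 v1" "adj v3 v2" "adj v0 v3"
  "adj v0 a0" "adj v0 b0" "adj v1 a1" "adj v1 b1" "adj v2 a2" "adj v2 b2" "adj v3 a3" "adj v3 b3"
  by (simp_all add: adj_iffs)

lemmas adjs = adjs_out adjs_out(9-16)[THEN adj_sym]

lemma verts_V: "v0 \<in> V" "v1 \<in> V" "v2 \<in> V" "v3 \<in> V"
  using adjs adj_V by blast+

lemma four_distinct: "card {w, x, y, z} = 4 \<Longrightarrow> w \<noteq> x \<and> w \<noteq> y \<and> w \<noteq> z \<and> x \<noteq> y \<and> x \<noteq> z \<and> y \<noteq> z"
  by (auto simp: card_insert_if split: if_splits)

lemma distinct_nb: "a0 \<noteq> b0" "a1 \<noteq> b1" "a2 \<noteq> b2" "a3 \<noteq> b3"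
  "v1 \<noteq> a0" "v1 \<noteq> b0" "v3 \<noteq> a0" "v3 \<noteq> b0" "v0 \<noteq> a1" "v0 \<noteq> b1" "v2 \<noteq> a1" "v2 \<noteq> b1"
  "v1 \<noteq> a2" "v1 \<noteq> b2" "v3 \<noteq> a2" "v3 \<noteq> b2" "v0 \<noteq> a3" "v0 \<noteq> b3" "v2 \<noteq> a3" "v2 \<noteq> b3"
  using four_distinct[OF card_nb[OF verts_V(1), folded nb_def, unfolded nb0]]
    four_distinct[OF card_nb[OF verts_V(2), folded nb_def, unfolded nb1]]
    four_distinct[OF card_nb[OF verts_V(3), folded nb_def, unfolded nb2]]
    four_distinct[OF card_nb[OF verts_V(4), folded nb_def, unfolded nb3]] by blast+

lemma no_tri: "adj x y \<Longrightarrow> adj x z \<Longrightarrow> adj y w \<Longrightarrow> z \<noteq> w"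
  using triangle_free adj_sym by blast

lemma distinct_v: "v0 \<noteq> v1" "v1 \<noteq> v2" "v2 \<noteq> v3" "v3 \<noteq> v0"
  using adjs adj_irrefl by metis+

lemma distinct_tri:
  "v2 \<noteq> a0" "v2 \<noteq> b0" "v3 \<noteq> a1" "v3 \<noteq> b1" "v0 \<noteq> a2" "v0 \<noteq> b2" "v1 \<noteq> a3" "v1 \<noteq> b3"
  "v0 \<noteq> a0" "v0 \<noteq> b0" "v1 \<noteq> a1" "v1 \<noteq> b1" "v2 \<noteq> a2" "v2 \<noteq> b2" "v3 \<noteq> a3" "v3 \<noteq> b3"
  "a0 \<noteq> a1" "a0 \<noteq> b1" "b0 \<noteq> a1" "b0 \<noteq> b1" "a1 \<noteq> a2" "a1 \<noteq> b2" "b1 \<noteq> a2" "b1 \<noteq> b2"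
  "a2 \<noteq> a3" "a2 \<noteq> b3" "b2 \<noteq> a3" "b2 \<noteq> b3" "a3 \<noteq> a0" "a3 \<noteq> b0" "b3 \<noteq> a0" "b3 \<noteq> b0"
  using no_tri adjs adj_irrefl by metis+

lemmas dst = distinct_nb distinct_v distinct_tri v02 v13
lemmas dsts = dst dst[symmetric]

lemma card_C: "card C = 4"
  using dsts by (simp add: C_def doubleton_eq_iff)

lemma C_subset: "C \<subseteq> U0" "C \<subseteq> E"
  using adjs by (auto simp: C_def U0_def star_def edge_in_E)

lemma U0_subset: "U0 \<subseteq> E" using star_subset_E by (auto simp: U0_def)

text \<open>Opposite cycle vertices are nonadjacent, so their stars are disjoint. The two unions of
  size eight overlap only in cycle edges.\<close>

lemma card_U0: "12 \<le> card U0"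
proof -
  have disj: "star v0 \<inter> star v2 = {}" "star v1 \<inter> star v3 = {}"
  proof -
    have "\<not> adj v0 v2" "\<not> adj v1 v3" using adjs triangle_free by blast+
    then show "star v0 \<inter> star v2 = {}" "star v1 \<inter> star v3 = {}"
      using v02 v13 adj_commute unfolding star_image nb_def by (auto simp: doubleton_eq_iff)
  qed
  have "(star v0 \<union> star v2) \<inter> (star v1 \<union> star v3) \<subseteq> C"
  proof
    fix e assume "e \<in> (star v0 \<union> star v2) \<inter> (star v1 \<union> star v3)"
    then have e: "e \<in> E" "v0 \<in> e \<or> v2 \<in> e" "v1 \<in> e \<or> v3 \<in> e" by (auto simp: star_def)
    obtain x y where "e = {x, y}" using E_cases[OF e(1)] by blast
    then show "e \<in> C" using e(2,3) dsts by (auto simp: C_def)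
  qed
  then have "card ((star v0 \<union> star v2) \<inter> (star v1 \<union> star v3)) \<le> 4"
    using card_mono[of C] card_C by (simp add: C_def)
  moreover have "card (star v0 \<union> star v2) = 8" "card (star v1 \<union> star v3) = 8"
    using disj card_star verts_V by (subst card_Un_disjoint; simp)+
  moreover have "U0 = (star v0 \<union> star v2) \<union> (star v1 \<union> star v3)" by (auto simp: U0_def)
  ultimately show ?thesis
    using card_Un_Int[of "star v0 \<union> star v2" "star v1 \<union> star v3"] by simp
qed

text \<open>On a four-cycle every vertex lies on, or is adjacent to an end of, every cycle
  edge.\<close>

lemma U0_conf_C:
  assumes "e \<in> U0" "c \<in> C" "e \<noteq> c" shows "conf e c"
proof -
  have e: "e \<in> E" "v0 \<in> e \<or> v1 \<in> e \<or> v2 \<in> e \<or> v3 \<in> e" using assms U0_subset by (auto simp: U0_def star_def)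
  have "c \<in> E" using assms C_subset by blast
  have "\<exists>x\<in>e. \<exists>y\<in>c. x = y \<or> adj x y" using e(2) assms(2) adjs by (auto simp: C_def)
  then show ?thesis using e \<open>c \<in> E\<close> assms(3) by (auto simp: conf_def)
qed

text \<open>All edges outside \<open>U0 \<union> W\<close> are coloured first; \<open>g c\<close> counts the conflicts that the cycle edge
  \<open>c\<close> lacks to the maximal number 24.\<close>

lemma reduce:
  assumes W: "W \<subseteq> E" "W \<inter> U0 = {}" "\<And>w c. w \<in> W \<Longrightarrow> c \<in> C \<Longrightarrow> conf w c"
    and ps: "\<And>a b. (a, b) \<in> set ps \<Longrightarrow> a \<in> (U0 - C) \<union> W \<and> b \<in> (U0 - C) \<union> W \<and> \<not> conf a b \<and>
      card (misses W a) + card (misses W b) \<le> 4 + card W"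
    and dist: "distinct (map fst ps @ map snd ps)"
    and g: "\<And>c. c \<in> C \<Longrightarrow> card (N c) + g c \<le> 24 \<and> 3 \<le> g c + length ps"
    and g4: "\<exists>c\<in>C. 4 \<le> g c + length ps"
  shows "colourable conf E"
proof -
  let ?U = "U0 \<union> W"
  have UE: "?U \<subseteq> E" using W U0_subset by blast
  have finU: "finite ?U" using UE finite_E finite_subset by blast
  have CW: "C \<inter> W = {}" using C_subset W by blast
  have cU: "12 + card W \<le> card ?U"
    using card_U0 W finU by (subst card_Un_disjoint) (auto simp: Int_commute)
  have "\<exists>\<phi>. proper_on conf (E - ?U) \<phi> \<and> \<phi> ` (E - ?U) \<subseteq> {..<21}"
    by (rule colour_outside[of "{v0, v1, v2, v3}"]) (use verts_V in \<open>auto simp: U0_def\<close>)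
  then obtain \<phi> where \<phi>: "proper_on conf (E - ?U) \<phi>" "\<phi> ` (E - ?U) \<subseteq> {..<21}" by blast
  define L where "L e = {..<21} - \<phi> ` (N e - ?U)" for e
  have cN: "card (N e) = card (N e - ?U) + card (N e \<inter> ?U)" for e
    using card_Un_disjoint[of "N e - ?U" "N e \<inter> ?U"] by (simp add: Un_Diff_Int Diff_Int_distrib2 inf_commute)
  have Lge: "21 \<le> card (L e) + card (N e - ?U)" for e
  proof -
    have "card {..<21::nat} - card (\<phi> ` (N e - ?U)) \<le> card (L e)"
      unfolding L_def by (rule diff_card_le_card_Diff) simp
    moreover have "card (\<phi> ` (N e - ?U)) \<le> card (N e - ?U)" by (rule card_image_le) simp
    ultimately show ?thesis by simp
  qed
  have cm: "card (N e \<inter> ?U) + card (misses W e) + 1 = card ?U" if e: "e \<in> ?U" for e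
  proof -
    have "?U = insert e ((N e \<inter> ?U) \<union> misses W e)" using e by (auto simp: misses_def)
    moreover have "e \<notin> (N e \<inter> ?U) \<union> misses W e" by (auto simp: misses_def N_def conf_irrefl)
    ultimately have "card ?U = Suc (card ((N e \<inter> ?U) \<union> misses W e))"
      using finU by (metis card_insert_disjoint finite_insert)
    moreover have "card ((N e \<inter> ?U) \<union> misses W e) = card (N e \<inter> ?U) + card (misses W e)"
      by (rule card_Un_disjoint) (use finU in \<open>auto simp: misses_def\<close>)
    ultimately show ?thesis by simp
  qed
  have CN: "C - {e} \<subseteq> N e \<inter> ?U" if "e \<in> ?U" for e
    using that U0_conf_C[of e] W(3)[of e] C_subset by (auto simp: N_def)
  have "\<exists>\<psi>. (\<forall>e\<in>?U. \<psi> e \<in> L e) \<and> proper_on conf ?U \<psi>"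
  proof (rule pairs_hall)
    show "finite ?U" "C \<subseteq> ?U" using finU C_subset by auto
    show "conf e f \<Longrightarrow> conf f e" for e f by (rule conf_sym)
    show "\<not> conf e e" for e by (rule conf_irrefl)
    show "finite (L e)" for e by (simp add: L_def)
    \<comment> \<open>The four cycle edges are conflicts of \<open>e\<close> left out of this count,
      while the list may fall short of \<open>card (N e \<inter> ?U)\<close> by three only, from 24
      - 21.\<close>
    show "card {f \<in> ?U - C. conf e f} < card (L e)" if e: "e \<in> ?U - C" for e
    proof -
      have "{f \<in> ?U - C. conf e f} = (N e \<inter> ?U) - C" by (auto simp: N_def)
      moreover have "C \<subseteq> N e \<inter> ?U" using CN[of e] e by blast
      ultimately have "card {f \<in> ?U - C. conf e f} + 4 = card (N e \<inter> ?U)"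
        using card_C card_mono[of "N e \<inter> ?U" C] card_Diff_subset[of C "N e \<inter> ?U"] by (simp add: C_def)
      then show ?thesis using Lge[of e] cN[of e] card_N[of e] e UE by force
    qed
    \<comment> \<open>Each list has at least \<open>card ?U\<close> - 4 colours less the misses of
      its edge. Two such lists have at least 2 \<open>card ?U\<close> - 12 - \<open>card W\<close>
      colours, and \<open>card ?U\<close> is at least 12 + \<open>card W\<close>; this is the origin
      of the bound 4 + \<open>card W\<close>.\<close>
    show "a \<in> ?U - C \<and> b \<in> ?U - C \<and> \<not> conf a b \<and> card ?U \<le> card (L a) + card (L b)"
      if ab: "(a, b) \<in> set ps" for a b
    proof -
      have p: "a \<in> ?U - C" "b \<in> ?U - C" "\<not> conf a b" "card (misses W a) + card (misses W b) \<le> 4 + card W"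
        using ps[OF ab] CW by auto
      have "a \<in> E" "b \<in> E" using p UE by auto
      then show ?thesis
        using p cm[of a] cm[of b] Lge[of a] Lge[of b] cN[of a] cN[of b] card_N[of a] card_N[of b] cU by auto
    qed
    show "distinct (map fst ps @ map snd ps)" by (rule dist)
    \<comment> \<open>All of \<open>?U\<close> except \<open>c\<close> conflicts with
      \<open>c\<close>, so at most 24 - \<open>g c\<close> - (\<open>card ?U\<close> - 1) conflicts
      of \<open>c\<close> are coloured.\<close>
    have c: "card ?U + g c \<le> card (L c) + 4" if c: "c \<in> C" for c
    proof -
      have "conf c e" if "e \<in> ?U" "e \<noteq> c" for e
        using that c U0_conf_C[of e c] W(3)[of e c] conf_sym by blast
      then have m: "misses W c = {}" by (auto simp: misses_def N_def)
      have "c \<in> ?U" using c C_subset by auto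
      then show ?thesis using cm[of c] Lge[of c] cN[of c] g[OF c] m by simp
    qed
    show "card ?U \<le> card (L c) + length ps + 1" if "c \<in> C" for c
      using c[OF that] g[OF that] by linarith
    obtain c0 where c0: "c0 \<in> C" "4 \<le> g c0 + length ps" using g4 by blast
    then have "card ?U \<le> card (L c0) + length ps" using c[OF c0(1)] by linarith
    then show "\<exists>c\<in>C. card ?U \<le> card (L c) + length ps" using c0(1) by blast
  qed
  then obtain \<psi> where \<psi>: "\<forall>e\<in>?U. \<psi> e \<in> L e" "proper_on conf ?U \<psi>" by blast
  let ?\<chi> = "\<lambda>e. if e \<in> ?U then \<psi> e else \<phi> e"
  have cross: "\<psi> e \<noteq> \<phi> f" if "e \<in> ?U" "f \<in> E - ?U" "conf e f" for e f
    using \<psi>(1) that by (auto simp: L_def N_def)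
  have "proper_on conf E ?\<chi>"
    unfolding proper_on_def
  proof (intro ballI impI)
    fix e f assume ef: "e \<in> E" "f \<in> E" "conf e f"
    consider "e \<in> ?U" "f \<in> ?U" | "e \<in> ?U" "f \<notin> ?U" | "e \<notin> ?U" "f \<in> ?U" | "e \<notin> ?U" "f \<notin> ?U" by blast
    then show "?\<chi> e \<noteq> ?\<chi> f"
    proof cases
      case 1 then show ?thesis using \<psi>(2) ef by (auto simp: proper_on_def)
    next
      case 2 then show ?thesis using cross[of e f] ef by auto
    next
      case 3 then show ?thesis using cross[of f e] ef conf_sym by auto
    next
      case 4 then show ?thesis using \<phi>(1) ef by (auto simp: proper_on_def)
    qed
  qed
  moreover have "?\<chi> ` E \<subseteq> {..<21}"
  proof
    fix n assume "n \<in> ?\<chi> ` E"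
    then obtain e where e: "e \<in> E" "n = ?\<chi> e" by blast
    show "n \<in> {..<21}"
    proof (cases "e \<in> ?U")
      case True
      then show ?thesis using \<psi>(1) e by (auto simp: L_def)
    next
      case False
      then show ?thesis using \<phi>(2) e by auto
    qed
  qed
  ultimately show ?thesis unfolding colourable_def by blast
qed

end

context quartic_graph
begin

lemma conf_pair:
  "conf {x, y} {z, w} \<longleftrightarrow> adj x y \<and> adj z w \<and> {x, y} \<noteq> {z, w} \<and>
    (x = z \<or> x = w \<or> y = z \<or> y = w \<or> adj x z \<or> adj x w \<or> adj y z \<or> adj y w)"
  by (auto simp: conf_def edge_in_E)

lemma conf_near: "e \<in> E \<Longrightarrow> v \<in> e \<Longrightarrow> w = v \<or> adj v w \<Longrightarrow> f \<in> star w \<Longrightarrow> f \<noteq> e \<Longrightarrow> conf e f"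
  using conf_share[of e f v] conf_adj[of e f v w] by (auto simp: star_def)

lemma star_sub: "nb w = {p, q, x, y} \<Longrightarrow> star w \<subseteq> star p \<union> star q \<union> {{w, x}, {w, y}}"
proof
  fix f assume nb: "nb w = {p, q, x, y}" and "f \<in> star w"
  then obtain z where z: "z \<in> {p, q, x, y}" "f = {w, z}" unfolding star_image nb by blast
  then have "adj w z" using nb by (metis mem_Collect_eq nb_def)
  then have "f \<in> star z" using z edge_in_E by (simp add: star_def)
  then show "f \<in> star p \<union> star q \<union> {{w, x}, {w, y}}" using z by auto
qed

text \<open>In list form the simplifier checks explicit gains one by one.\<close>

lemma gain_list:
  assumes "adj u w" "distinct ps"
    "list_all (\<lambda>(x, y). adj u x \<and> x \<noteq> w \<and> adj w y \<and> y \<noteq> u \<and> adj x y) ps"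
  shows "card (N {u, w}) + length ps \<le> 24"
  using gain[of u w "set ps"] assms by (fastforce simp: list_all_iff distinct_card)

end

section \<open>Pendant edges and crossing edges of a four-cycle\<close>

context four_cycle
begin

lemma adj_iffs_sym:
  "adj x v0 \<longleftrightarrow> x \<in> {v1, v3, a0, b0}" "adj x v1 \<longleftrightarrow> x \<in> {v0, v2, a1, b1}"
  "adj x v2 \<longleftrightarrow> x \<in> {v1, v3, a2, b2}" "adj x v3 \<longleftrightarrow> x \<in> {v0, v2, a3, b3}"
  by (simp_all only: adj_commute[of x] adj_iffs)

lemma pendants:
  "{v0, a0} \<in> U0 - C" "{v0, b0} \<in> U0 - C" "{v1, a1} \<in> U0 - C" "{v1, b1} \<in> U0 - C"
  "{v2, a2} \<in> U0 - C" "{v2, b2} \<in> U0 - C" "{v3, a3} \<in> U0 - C" "{v3, b3} \<in> U0 - C"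
  using dsts adjs by (simp_all add: U0_def star_def edge_in_E C_def doubleton_eq_iff)

lemma missesD: "f \<in> misses W e \<Longrightarrow> (f \<in> U0 \<or> f \<in> W) \<and> f \<noteq> e \<and> \<not> conf e f"
  by (auto simp: misses_def N_def)

text \<open>A pendant edge at a cycle vertex conflicts with the stars of that vertex and of its two
  cycle neighbours; the first four cases leave the pendants at the opposite vertex. The last two
  serve edges crossing between the outer neighbours of opposite vertices and leave four
  pendants.\<close>

lemma U0_cases:
  "f \<in> U0 \<Longrightarrow> f \<in> star v0 \<or> f \<in> star v1 \<or> f \<in> star v3 \<or> f \<in> {{v2, a2}, {v2, b2}}"
  "f \<in> U0 \<Longrightarrow> f \<in> star v1 \<or> f \<in> star v2 \<or> f \<in> star v0 \<or> f \<in> {{v3, a3}, {v3, b3}}"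
  "f \<in> U0 \<Longrightarrow> f \<in> star v2 \<or> f \<in> star v3 \<or> f \<in> star v1 \<or> f \<in> {{v0, a0}, {v0, b0}}"
  "f \<in> U0 \<Longrightarrow> f \<in> star v3 \<or> f \<in> star v0 \<or> f \<in> star v2 \<or> f \<in> {{v1, a1}, {v1, b1}}"
  "f \<in> U0 \<Longrightarrow> f \<in> star v1 \<or> f \<in> star v3 \<or> f \<in> {{v0, a0}, {v0, b0}, {v2, a2}, {v2, b2}}"
  "f \<in> U0 \<Longrightarrow> f \<in> star v0 \<or> f \<in> star v2 \<or> f \<in> {{v1, a1}, {v1, b1}, {v3, a3}, {v3, b3}}"
  using star_sub[OF nb0, THEN subsetD, of f] star_sub[OF nb1, THEN subsetD, of f]
    star_sub[OF nb2, THEN subsetD, of f] star_sub[OF nb3, THEN subsetD, of f]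
  unfolding U0_def Un_iff insert_iff empty_iff by argo+

lemma misses_opposite:
  "x \<in> {a0, b0} \<Longrightarrow> misses W {v0, x} \<subseteq> {f \<in> {{v2, a2}, {v2, b2}} \<union> W. \<not> conf {v0, x} f}"
  "x \<in> {a1, b1} \<Longrightarrow> misses W {v1, x} \<subseteq> {f \<in> {{v3, a3}, {v3, b3}} \<union> W. \<not> conf {v1, x} f}"
  "x \<in> {a2, b2} \<Longrightarrow> misses W {v2, x} \<subseteq> {f \<in> {{v0, a0}, {v0, b0}} \<union> W. \<not> conf {v2, x} f}"
  "x \<in> {a3, b3} \<Longrightarrow> misses W {v3, x} \<subseteq> {f \<in> {{v1, a1}, {v1, b1}} \<union> W. \<not> conf {v3, x} f}"
proof -
  have near: "f \<in> X" if "f \<in> misses W {v, x}" "adj v x" "f \<in> U0 \<Longrightarrow> f \<in> star v \<or> f \<in> star w \<or> f \<in> star w' \<or> f \<in> X"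
    "adj v w" "adj v w'" "f \<notin> W" for f X v x w w'
    using missesD[OF that(1)] that(2-) conf_near[of "{v, x}" v _ f] by (auto simp: edge_in_E)
  show "x \<in> {a0, b0} \<Longrightarrow> misses W {v0, x} \<subseteq> {f \<in> {{v2, a2}, {v2, b2}} \<union> W. \<not> conf {v0, x} f}"
    using near[OF _ _ U0_cases(1)] adjs missesD by blast
  show "x \<in> {a1, b1} \<Longrightarrow> misses W {v1, x} \<subseteq> {f \<in> {{v3, a3}, {v3, b3}} \<union> W. \<not> conf {v1, x} f}"
    using near[OF _ _ U0_cases(2)] adjs missesD by blast
  show "x \<in> {a2, b2} \<Longrightarrow> misses W {v2, x} \<subseteq> {f \<in> {{v0, a0}, {v0, b0}} \<union> W. \<not> conf {v2, x} f}"
    using near[OF _ _ U0_cases(3)] adjs missesD by blast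
  show "x \<in> {a3, b3} \<Longrightarrow> misses W {v3, x} \<subseteq> {f \<in> {{v1, a1}, {v1, b1}} \<union> W. \<not> conf {v3, x} f}"
    using near[OF _ _ U0_cases(4)] adjs missesD by blast
qed

text \<open>The ends of a crossing edge are adjacent to two opposite cycle vertices, so it conflicts
  with all edges there. Such edges are the candidates for \<open>W\<close>.\<close>

lemma misses_across:
  "x \<in> {a1, b1} \<Longrightarrow> y \<in> {a3, b3} \<Longrightarrow> adj x y \<Longrightarrow>
    misses W {x, y} \<subseteq> {{v0, a0}, {v0, b0}, {v2, a2}, {v2, b2}} \<union> {f \<in> W. f \<noteq> {x, y} \<and> \<not> conf {x, y} f}"
  "x \<in> {a0, b0} \<Longrightarrow> y \<in> {a2, b2} \<Longrightarrow> adj x y \<Longrightarrow>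
    misses W {x, y} \<subseteq> {{v1, a1}, {v1, b1}, {v3, a3}, {v3, b3}} \<union> {f \<in> W. f \<noteq> {x, y} \<and> \<not> conf {x, y} f}"
proof -
  have near: "f \<in> X" if "f \<in> misses W {x, y}" "adj x y" "f \<in> U0 \<Longrightarrow> f \<in> star w \<or> f \<in> star w' \<or> f \<in> X"
    "adj x w" "adj y w'" "f \<notin> W" for f X x y w w'
    using missesD[OF that(1)] that(2-) conf_near[of "{x, y}" _ _ f] by (auto simp: edge_in_E)
  show "x \<in> {a1, b1} \<Longrightarrow> y \<in> {a3, b3} \<Longrightarrow> adj x y \<Longrightarrow>
    misses W {x, y} \<subseteq> {{v0, a0}, {v0, b0}, {v2, a2}, {v2, b2}} \<union> {f \<in> W. f \<noteq> {x, y} \<and> \<not> conf {x, y} f}"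
    (is "_ \<Longrightarrow> _ \<Longrightarrow> _ \<Longrightarrow> _ \<subseteq> ?X \<union> ?Y")
  proof (rule subsetI)
    fix f assume xy: "x \<in> {a1, b1}" "y \<in> {a3, b3}" "adj x y" and f: "f \<in> misses W {x, y}"
    have "adj x v1" "adj y v3" using xy(1,2) adjs by auto
    then have "f \<notin> W \<Longrightarrow> f \<in> ?X" using near[OF f xy(3) U0_cases(5)] by blast
    then show "f \<in> ?X \<union> ?Y" using missesD[OF f]
      by (cases "f \<in> W") simp_all
  qed
  show "x \<in> {a0, b0} \<Longrightarrow> y \<in> {a2, b2} \<Longrightarrow> adj x y \<Longrightarrow>
    misses W {x, y} \<subseteq> {{v1, a1}, {v1, b1}, {v3, a3}, {v3, b3}} \<union> {f \<in> W. f \<noteq> {x, y} \<and> \<not> conf {x, y} f}"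
    (is "_ \<Longrightarrow> _ \<Longrightarrow> _ \<Longrightarrow> _ \<subseteq> ?X \<union> ?Y")
  proof (rule subsetI)
    fix f assume xy: "x \<in> {a0, b0}" "y \<in> {a2, b2}" "adj x y" and f: "f \<in> misses W {x, y}"
    have "adj x v0" "adj y v2" using xy(1,2) adjs by auto
    then have "f \<notin> W \<Longrightarrow> f \<in> ?X" using near[OF f xy(3) U0_cases(6)] by blast
    then show "f \<in> ?X \<union> ?Y" using missesD[OF f]
      by (cases "f \<in> W") simp_all
  qed
qed

lemma across_notin:
  "x \<in> {a1, b1} \<Longrightarrow> y \<in> {a3, b3} \<Longrightarrow> {x, y} \<notin> U0"
  "x \<in> {a0, b0} \<Longrightarrow> y \<in> {a2, b2} \<Longrightarrow> {x, y} \<notin> U0"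
  using dsts by (auto simp: U0_def star_def)

text \<open>Every cycle edge has an end in \<open>{v1, v3}\<close> and an end in
  \<open>{v0, v2}\<close>.\<close>

lemma across_conf_C:
  "x \<in> {a1, b1} \<Longrightarrow> y \<in> {a3, b3} \<Longrightarrow> adj x y \<Longrightarrow> c \<in> C \<Longrightarrow> conf {x, y} c"
  "x \<in> {a0, b0} \<Longrightarrow> y \<in> {a2, b2} \<Longrightarrow> adj x y \<Longrightarrow> c \<in> C \<Longrightarrow> conf {x, y} c"
proof -
  have c: "c \<in> star v1 \<or> c \<in> star v3" "c \<in> star v0 \<or> c \<in> star v2" if "c \<in> C" for c
    using that C_subset(2) by (auto simp: C_def star_def)
  have near: "conf {x, y} c" if "adj x y" "adj x w" "adj y w'" "c \<in> star w \<or> c \<in> star w'" "{x, y} \<notin> U0" "c \<in> C" for x y w w'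
  proof -
    have "c \<noteq> {x, y}" using that(5,6) C_subset(1) by blast
    then show ?thesis using that conf_near[of "{x, y}" x w c] conf_near[of "{x, y}" y w' c]
      by (auto simp: edge_in_E)
  qed
  show "x \<in> {a1, b1} \<Longrightarrow> y \<in> {a3, b3} \<Longrightarrow> adj x y \<Longrightarrow> c \<in> C \<Longrightarrow> conf {x, y} c"
    using near[OF _ _ _ c(1) across_notin(1)] adjs by blast
  show "x \<in> {a0, b0} \<Longrightarrow> y \<in> {a2, b2} \<Longrightarrow> adj x y \<Longrightarrow> c \<in> C \<Longrightarrow> conf {x, y} c"
    using near[OF _ _ _ c(2) across_notin(2)] adjs by blast
qed

lemma card_le2: "X \<subseteq> {p, q} \<Longrightarrow> card X \<le> 2"
  by (rule order.trans[OF card_mono[of "{p, q}"]]) (auto simp: card_insert_if)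

lemma card_le4: "X \<subseteq> {p, q, r, s} \<Longrightarrow> card X \<le> 4"
  by (rule order.trans[OF card_mono[of "{p, q, r, s}"]]) (auto simp: card_insert_if)

lemma misses_le2:
  assumes "\<And>w. w \<in> W \<Longrightarrow> conf e w" and "misses W e \<subseteq> {f \<in> {p, q} \<union> W. \<not> conf e f}"
  shows "card (misses W e) \<le> 2"
  by (rule card_le2[of _ p q]) (use assms in auto)

text \<open>The opposite cycle edge joins neighbours of the two ends of \<open>c\<close>, so every
  four-cycle gains one. In \<open>gain2\<close> to \<open>gain4\<close> each coincidence of outer
  neighbours of opposite vertices adds one more such edge for every \<open>c\<close>.\<close>

lemma gain1:
  assumes "c \<in> C"
  shows "card (N c) + 1 \<le> 24"
proof -
  have e0: "card (N {v0, v1}) + 1 \<le> 24"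
    using gain_list[of v0 v1 "[(v3, v2)]"] by (simp add: adjs dsts)
  have e1: "card (N {v1, v2}) + 1 \<le> 24"
    using gain_list[of v1 v2 "[(v0, v3)]"] by (simp add: adjs dsts)
  have e2: "card (N {v2, v3}) + 1 \<le> 24"
    using gain_list[of v2 v3 "[(v1, v0)]"] by (simp add: adjs dsts)
  have e3: "card (N {v3, v0}) + 1 \<le> 24"
    using gain_list[of v3 v0 "[(v2, v1)]"] by (simp add: adjs dsts)
  show ?thesis using assms(1) e0 e1 e2 e3 unfolding C_def by blast
qed

lemma gain2:
  assumes "a0 = a2" "c \<in> C"
  shows "card (N c) + 2 \<le> 24"
proof -
  have h: "adj v2 a0" "adj a0 v2" using assms adjs by simp_all
  have e0: "card (N {v0, v1}) + 2 \<le> 24"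
    using gain_list[of v0 v1 "[(v3, v2), (a0, v2)]"] by (simp add: adjs dsts h)
  have e1: "card (N {v1, v2}) + 2 \<le> 24"
    using gain_list[of v1 v2 "[(v0, v3), (v0, a0)]"] by (simp add: adjs dsts h)
  have e2: "card (N {v2, v3}) + 2 \<le> 24"
    using gain_list[of v2 v3 "[(v1, v0), (a0, v0)]"] by (simp add: adjs dsts h)
  have e3: "card (N {v3, v0}) + 2 \<le> 24"
    using gain_list[of v3 v0 "[(v2, v1), (v2, a0)]"] by (simp add: adjs dsts h)
  show ?thesis using assms(2) e0 e1 e2 e3 unfolding C_def by blast
qed

lemma gain3:
  assumes "a0 = a2" "a1 = a3" "c \<in> C"
  shows "card (N c) + 3 \<le> 24"
proof -
  have h: "adj v2 a0" "adj a0 v2" "adj v3 a1" "adj a1 v3" using assms adjs by simp_all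
  have e0: "card (N {v0, v1}) + 3 \<le> 24"
    using gain_list[of v0 v1 "[(v3, v2), (a0, v2), (v3, a1)]"] by (simp add: adjs dsts h)
  have e1: "card (N {v1, v2}) + 3 \<le> 24"
    using gain_list[of v1 v2 "[(v0, v3), (v0, a0), (a1, v3)]"] by (simp add: adjs dsts h)
  have e2: "card (N {v2, v3}) + 3 \<le> 24"
    using gain_list[of v2 v3 "[(v1, v0), (a0, v0), (v1, a1)]"] by (simp add: adjs dsts h)
  have e3: "card (N {v3, v0}) + 3 \<le> 24"
    using gain_list[of v3 v0 "[(v2, v1), (v2, a0), (a1, v1)]"] by (simp add: adjs dsts h)
  show ?thesis using assms(3) e0 e1 e2 e3 unfolding C_def by blast
qed

lemma gain4:
  assumes "a0 = a2" "a1 = a3" "b1 = b3" "c \<in> C"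
  shows "card (N c) + 4 \<le> 24"
proof -
  have h: "adj v2 a0" "adj a0 v2" "adj v3 a1" "adj a1 v3" "adj v3 b1" "adj b1 v3" using assms adjs by simp_all
  have e0: "card (N {v0, v1}) + 4 \<le> 24"
    using gain_list[of v0 v1 "[(v3, v2), (a0, v2), (v3, a1), (v3, b1)]"] by (simp add: adjs dsts h)
  have e1: "card (N {v1, v2}) + 4 \<le> 24"
    using gain_list[of v1 v2 "[(v0, v3), (v0, a0), (a1, v3), (b1, v3)]"] by (simp add: adjs dsts h)
  have e2: "card (N {v2, v3}) + 4 \<le> 24"
    using gain_list[of v2 v3 "[(v1, v0), (a0, v0), (v1, a1), (v1, b1)]"] by (simp add: adjs dsts h)
  have e3: "card (N {v3, v0}) + 4 \<le> 24"
    using gain_list[of v3 v0 "[(v2, v1), (v2, a0), (a1, v1), (b1, v1)]"] by (simp add: adjs dsts h)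
  show ?thesis using assms(4) e0 e1 e2 e3 unfolding C_def by blast
qed

section \<open>Combining gains and pairs\<close>

lemma C_nonempty: "{v0, v1} \<in> C" "{v1, v2} \<in> C" by (auto simp: C_def)

text \<open>If \<open>a0 = a2\<close>, then \<open>v0\<close> and \<open>v2\<close> have the three common neighbours \<open>v1\<close>, \<open>v3\<close>, \<open>a0\<close>.\<close>

lemma K23_two_shared: "a0 = a2 \<Longrightarrow> a1 = a3 \<Longrightarrow> b1 = b3 \<Longrightarrow> colourable conf E"
  by (rule reduce[of "{}" "[]" "\<lambda>_. 4"]) (use gain4 C_nonempty in auto)

lemma nonconf_opposite:
  "x \<in> {a0, b0} \<Longrightarrow> y \<in> {a2, b2} \<Longrightarrow> x \<notin> {a2, b2} \<Longrightarrow> y \<notin> {a0, b0} \<Longrightarrow> \<not> adj x y \<Longrightarrow> \<not> conf {v0, x} {v2, y}"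
  "x \<in> {a1, b1} \<Longrightarrow> y \<in> {a3, b3} \<Longrightarrow> x \<notin> {a3, b3} \<Longrightarrow> y \<notin> {a1, b1} \<Longrightarrow> \<not> adj x y \<Longrightarrow> \<not> conf {v1, x} {v3, y}"
  using dsts by (auto simp: conf_pair adj_iffs adj_iffs_sym)

lemma pendant_misses:
  "x \<in> {a0, b0} \<Longrightarrow> (\<And>w. w \<in> W \<Longrightarrow> conf {v0, x} w) \<Longrightarrow> card (misses W {v0, x}) \<le> 2"
  "x \<in> {a1, b1} \<Longrightarrow> (\<And>w. w \<in> W \<Longrightarrow> conf {v1, x} w) \<Longrightarrow> card (misses W {v1, x}) \<le> 2"
  "x \<in> {a2, b2} \<Longrightarrow> (\<And>w. w \<in> W \<Longrightarrow> conf {v2, x} w) \<Longrightarrow> card (misses W {v2, x}) \<le> 2"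
  "x \<in> {a3, b3} \<Longrightarrow> (\<And>w. w \<in> W \<Longrightarrow> conf {v3, x} w) \<Longrightarrow> card (misses W {v3, x}) \<le> 2"
  by (rule misses_le2[OF _ misses_opposite(1)] misses_le2[OF _ misses_opposite(2)]
      misses_le2[OF _ misses_opposite(3)] misses_le2[OF _ misses_opposite(4)]; assumption)+

text \<open>A pendant to the third common neighbour conflicts with both pendants at the opposite
  vertex. Having so few misses, it is a good partner for a crossing edge with up to four.\<close>

lemma pendant_misses_third:
  assumes "a0 = a2"
  shows "misses W {v0, a0} \<subseteq> W" "misses W {v2, a2} \<subseteq> W"
proof -
  have E: "{v0, a0} \<in> E" "{v2, a2} \<in> E" "{v2, b2} \<in> E" "{v0, b0} \<in> E" using adjs edge_in_E by auto
  have h: "adj a0 v2" "adj a2 v0" using assms adjs by simp_all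
  have "conf {v0, a0} {v2, a2}" by (rule conf_share[of _ _ a0]) (use E assms v02 in \<open>auto simp: doubleton_eq_iff\<close>)
  moreover have "conf {v0, a0} {v2, b2}"
    by (rule conf_adj[of _ _ a0 v2]) (use E h v02 dsts in \<open>auto simp: doubleton_eq_iff\<close>)
  moreover have "conf {v2, a2} {v0, b0}"
    by (rule conf_adj[of _ _ a2 v0]) (use E h v02 dsts in \<open>auto simp: doubleton_eq_iff\<close>)
  ultimately show "misses W {v0, a0} \<subseteq> W" "misses W {v2, a2} \<subseteq> W"
    using misses_opposite(1)[of a0 W] misses_opposite(3)[of a2 W] conf_sym by blast+
qed

lemma notin_ne: "w \<notin> U0 \<Longrightarrow> f \<in> U0 - C \<Longrightarrow> w \<noteq> f \<and> f \<noteq> w"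
  by blast

text \<open>The gain is three; the pendants to \<open>b1\<close> and \<open>b3\<close> are the one
  pair still wanted.\<close>

lemma K23_one_shared_nonadj:
  assumes "a0 = a2" "a1 = a3" "b1 \<noteq> b3" "\<not> adj b1 b3"
  shows "colourable conf E"
proof (rule reduce[of "{}" "[({v1, b1}, {v3, b3})]" "\<lambda>_. 3"])
  have "card (misses {} {v1, b1}) \<le> 2" "card (misses {} {v3, b3}) \<le> 2"
    by (rule pendant_misses; simp)+
  moreover have "\<not> conf {v1, b1} {v3, b3}"
    by (rule nonconf_opposite(2)) (use assms distinct_nb in auto)
  ultimately show "a \<in> U0 - C \<union> {} \<and> b \<in> U0 - C \<union> {} \<and> \<not> conf a b \<and>
      card (misses {} a) + card (misses {} b) \<le> 4 + card ({} :: 'a set set)"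
    if "(a, b) \<in> set [({v1, b1}, {v3, b3})]" for a b
    using that pendants by simp
  show "distinct (map fst [({v1, b1}, {v3, b3})] @ map snd [({v1, b1}, {v3, b3})])"
    using dsts by (simp add: doubleton_eq_iff)
  show "\<exists>c\<in>C. 4 \<le> 3 + length [({v1, b1}, {v3, b3})]" using C_nonempty by auto
qed (use gain3[OF assms(1,2)] in simp_all)

text \<open>The edge \<open>{a0, b1}\<close> is a fourth gain for \<open>{v0, v1}\<close>. The other
  cycle edges stay at three, which \<open>reduce\<close> permits.\<close>

lemma K23_one_shared_gain:
  assumes "a0 = a2" "a1 = a3" "adj a0 b1"
  shows "colourable conf E"
proof (rule reduce[of "{}" "[]" "\<lambda>c. if c = {v0, v1} then 4 else 3"])
  have h: "adj a0 v2" "adj v3 a1" using assms(1,2) adjs by simp_all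
  have "card (N {v0, v1}) + 4 \<le> 24"
    using gain_list[of v0 v1 "[(v3, v2), (a0, v2), (v3, a1), (a0, b1)]"] h assms(3) by (simp add: adjs dsts)
  then show "card (N c) + (if c = {v0, v1} then 4 else 3) \<le> 24 \<and>
      3 \<le> (if c = {v0, v1} then 4 else 3) + length ([] :: ('a set \<times> 'a set) list)" if "c \<in> C" for c
    using gain3[OF assms(1,2) that] by auto
  show "\<exists>c\<in>C. 4 \<le> (if c = {v0, v1} then 4 else 3) + length ([] :: ('a set \<times> 'a set) list)"
    using C_nonempty(1) by (intro bexI[of _ "{v0, v1}"]) simp_all
qed simp_all

text \<open>Here the pendants to \<open>b1\<close> and \<open>b3\<close> conflict. The crossing edge
  \<open>{b1, b3}\<close> is paired with a pendant to the third common neighbour instead; the misses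
  are at most 4 + 1.\<close>

lemma K23_one_shared_adj:
  assumes "a0 = a2" "a1 = a3" "adj b1 b3" "\<not> adj a0 b1" "\<not> adj a0 b3"
  shows "colourable conf E"
proof -
  let ?w = "{b1, b3}" and ?p = "{v0, a0}"
  show ?thesis
  proof (rule reduce[of "{?w}" "[(?w, ?p)]" "\<lambda>_. 3"])
    have "misses {?w} ?w \<subseteq> {{v0, a0}, {v0, b0}, {v2, a2}, {v2, b2}}"
      using misses_across(1)[of b1 b3 "{?w}"] assms(3) by auto
    then have "card (misses {?w} ?w) \<le> 4" by (rule card_le4)
    moreover have "card (misses {?w} ?p) \<le> 1"
      using card_mono[OF _ pendant_misses_third(1)[OF assms(1), of "{?w}"]] by simp
    moreover have "\<not> conf ?w ?p"
    proof -
      have "\<not> adj b1 a0" "\<not> adj b3 a0" using assms adj_commute by blast+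
      then show ?thesis using dsts by (simp add: conf_pair adj_iffs_sym)
    qed
    ultimately show "a \<in> U0 - C \<union> {?w} \<and> b \<in> U0 - C \<union> {?w} \<and> \<not> conf a b \<and>
        card (misses {?w} a) + card (misses {?w} b) \<le> 4 + card {?w}"
      if "(a, b) \<in> set [(?w, ?p)]" for a b
      using that pendants by simp
    show "{?w} \<inter> U0 = {}" using across_notin(1)[of b1 b3] by simp
    show "distinct (map fst [(?w, ?p)] @ map snd [(?w, ?p)])"
      using dsts by (simp add: doubleton_eq_iff)
    show "conf w c" if "w \<in> {?w}" "c \<in> C" for w c using that across_conf_C(1)[of b1 b3 c] assms(3) by simp
    show "{?w} \<subseteq> E" using assms(3) edge_in_E by simp
    show "\<exists>c\<in>C. 4 \<le> 3 + length [(?w, ?p)]" using C_nonempty by auto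
  qed (use gain3[OF assms(1,2)] in simp_all)
qed

text \<open>Two pairs of pendants are added to the gain of two.\<close>

lemma K23_none_adj:
  assumes "a0 = a2" "{a1, b1} \<inter> {a3, b3} = {}" "\<not> adj a1 a3" "\<not> adj b1 b3"
  shows "colourable conf E"
proof -
  let ?ps = "[({v1, a1}, {v3, a3}), ({v1, b1}, {v3, b3})]"
  show ?thesis
  proof (rule reduce[of "{}" ?ps "\<lambda>_. 2"])
    have "card (misses {} {v1, a1}) \<le> 2" "card (misses {} {v3, a3}) \<le> 2"
      "card (misses {} {v1, b1}) \<le> 2" "card (misses {} {v3, b3}) \<le> 2"
      by (rule pendant_misses; simp)+
    moreover have "\<not> conf {v1, a1} {v3, a3}" "\<not> conf {v1, b1} {v3, b3}"
      by (rule nonconf_opposite(2); use assms in auto)+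
    ultimately show "a \<in> U0 - C \<union> {} \<and> b \<in> U0 - C \<union> {} \<and> \<not> conf a b \<and>
        card (misses {} a) + card (misses {} b) \<le> 4 + card ({} :: 'a set set)"
      if "(a, b) \<in> set ?ps" for a b
      using that pendants by auto
    show "distinct (map fst ?ps @ map snd ?ps)" using dsts by (simp add: doubleton_eq_iff)
    show "\<exists>c\<in>C. 4 \<le> 2 + length ?ps" using C_nonempty by auto
  qed (use gain2[OF assms(1)] in simp_all)
qed

text \<open>One pair consists of a crossing edge and a pendant to the third common neighbour, the
  other of two pendants. The latter conflict with the crossing edge and so keep at most two misses
  each.\<close>

lemma K23_some_adj:
  assumes "a0 = a2" "{a1, b1} \<inter> {a3, b3} = {}" "x \<in> {a1, b1}" "y \<in> {a3, b3}" "adj x y"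
    and "s \<in> {a1, b1}" "t \<in> {a3, b3}" "\<not> adj s t" "\<not> adj a0 x" "\<not> adj a0 y"
  shows "colourable conf E"
proof -
  let ?w = "{x, y}" and ?p = "{v0, a0}"
  let ?ps = "[(?w, ?p), ({v1, s}, {v3, t})]"
  have wE: "?w \<in> E" using assms(5) edge_in_E by simp
  have wU: "?w \<notin> U0" by (rule across_notin(1)) fact+
  have st: "{v1, s} \<in> U0 - C" "{v3, t} \<in> U0 - C" using assms(6,7) pendants by auto
  show ?thesis
  proof (rule reduce[of "{?w}" ?ps "\<lambda>_. 2"])
    have "misses {?w} ?w \<subseteq> {{v0, a0}, {v0, b0}, {v2, a2}, {v2, b2}}"
      using misses_across(1)[of x y "{?w}"] assms(3-5) by auto
    then have m1: "card (misses {?w} ?w) \<le> 4" by (rule card_le4)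
    have m2: "card (misses {?w} ?p) \<le> 1"
      using card_mono[OF _ pendant_misses_third(1)[OF assms(1), of "{?w}"]] by simp
    have n1: "\<not> conf ?w ?p"
    proof -
      have "\<not> adj x a0" "\<not> adj y a0" using assms(9,10) adj_commute by blast+
      then show ?thesis using dsts assms(3,4) by (auto simp: conf_pair adj_iffs_sym)
    qed
    have cs: "conf {v1, s} ?w" "conf {v3, t} ?w"
    proof -
      have "adj v1 x" "adj v3 y" using assms(3,4) adjs by auto
      moreover have "{v1, s} \<in> E" "{v3, t} \<in> E" using st U0_subset by auto
      moreover have "{v1, s} \<noteq> ?w" "{v3, t} \<noteq> ?w" using st wU by auto
      ultimately show "conf {v1, s} ?w" "conf {v3, t} ?w"
        using conf_adj[of "{v1, s}" ?w v1 x] conf_adj[of "{v3, t}" ?w v3 y] wE by auto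
    qed
    have m3: "card (misses {?w} {v1, s}) \<le> 2" "card (misses {?w} {v3, t}) \<le> 2"
      by (rule pendant_misses; use cs assms(6,7) in simp)+
    have n2: "\<not> conf {v1, s} {v3, t}" by (rule nonconf_opposite(2)) (use assms in auto)
    show "a \<in> U0 - C \<union> {?w} \<and> b \<in> U0 - C \<union> {?w} \<and> \<not> conf a b \<and>
        card (misses {?w} a) + card (misses {?w} b) \<le> 4 + card {?w}"
      if "(a, b) \<in> set ?ps" for a b
      using that pendants(1) st m1 m2 m3 n1 n2 by auto
    show "{?w} \<inter> U0 = {}" using wU by simp
    have "{v1, s} \<noteq> ?p" "{v3, t} \<noteq> ?p" "{v1, s} \<noteq> {v3, t}"
      using dsts assms(6,7) by (auto simp: doubleton_eq_iff)
    then show "distinct (map fst ?ps @ map snd ?ps)"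
      using notin_ne[OF wU st(1)] notin_ne[OF wU st(2)] notin_ne[OF wU pendants(1)] by simp
    show "conf w c" if "w \<in> {?w}" "c \<in> C" for w c using that across_conf_C(1)[of x y c] assms(3-5) by simp
    show "{?w} \<subseteq> E" using wE by simp
    show "\<exists>c\<in>C. 4 \<le> 2 + length ?ps" using C_nonempty by auto
  qed (use gain2[OF assms(1)] in simp_all)
qed

text \<open>Two crossing edges are paired with the two pendants to the third common neighbour.
  Adjacency of \<open>a1\<close> and \<open>b3\<close> makes the crossing edges conflict, so neither
  misses the other and each pair has at most 4 + 2 misses.\<close>

lemma K23_all_adj:
  assumes "a0 = a2" "adj a1 a3" "adj b1 b3" "adj a1 b3"
    and "\<not> adj a0 a1" "\<not> adj a0 b1" "\<not> adj a0 a3" "\<not> adj a0 b3"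
  shows "colourable conf E"
proof -
  let ?w = "{a1, a3}" and ?w' = "{b1, b3}" and ?p = "{v0, a0}" and ?p' = "{v2, a2}"
  let ?ps = "[(?w, ?p), (?w', ?p')]" and ?W = "{{a1, a3}, {b1, b3}}"
  have wE: "?w \<in> E" "?w' \<in> E" using assms edge_in_E by auto
  have wU: "?w \<notin> U0" "?w' \<notin> U0" using across_notin(1) by auto
  have b31: "b3 \<noteq> a1" using assms(4) adj_irrefl by blast
  have ww: "?w \<noteq> ?w'" using dsts b31 by (auto simp: doubleton_eq_iff)
  have cww: "conf ?w ?w'" by (rule conf_adj[of _ _ a1 b3]) (use wE ww assms in auto)
  show ?thesis
  proof (rule reduce[of ?W ?ps "\<lambda>_. 2"])
    have "misses ?W ?w \<subseteq> {{v0, a0}, {v0, b0}, {v2, a2}, {v2, b2}}"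
      using misses_across(1)[of a1 a3 ?W] assms(2) cww by auto
    then have m1: "card (misses ?W ?w) \<le> 4" by (rule card_le4)
    have "misses ?W ?w' \<subseteq> {{v0, a0}, {v0, b0}, {v2, a2}, {v2, b2}}"
      using misses_across(1)[of b1 b3 ?W] assms(3) conf_sym[OF cww] by auto
    then have m2: "card (misses ?W ?w') \<le> 4" by (rule card_le4)
    have m3: "card (misses ?W ?p) \<le> 2" "card (misses ?W ?p') \<le> 2"
      by (rule card_le2[OF pendant_misses_third(1)[OF assms(1)]], rule card_le2[OF pendant_misses_third(2)[OF assms(1)]])
    have na: "\<not> adj a1 a0" "\<not> adj b1 a0" "\<not> adj a3 a0" "\<not> adj b3 a0" using assms adj_commute by blast+
    have n1: "\<not> conf ?w ?p"
      using dsts na by (simp add: conf_pair adj_iffs_sym)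
    have n2: "\<not> conf ?w' ?p'"
    proof -
      have "\<not> adj b1 a2" "\<not> adj b3 a2" using na assms(1) by simp_all
      then show ?thesis using dsts by (simp add: conf_pair adj_iffs_sym)
    qed
    show "a \<in> U0 - C \<union> ?W \<and> b \<in> U0 - C \<union> ?W \<and> \<not> conf a b \<and>
        card (misses ?W a) + card (misses ?W b) \<le> 4 + card ?W"
      if "(a, b) \<in> set ?ps" for a b
      using that pendants m1 m2 m3 n1 n2 ww by auto
    show "?W \<inter> U0 = {}" using wU by simp
    have "?p \<noteq> ?p'" using dsts by (simp add: doubleton_eq_iff)
    then show "distinct (map fst ?ps @ map snd ?ps)"
      using notin_ne[OF wU(1) pendants(1)] notin_ne[OF wU(1) pendants(5)]
        notin_ne[OF wU(2) pendants(1)] notin_ne[OF wU(2) pendants(5)] ww by simp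
    show "conf w c" if "w \<in> ?W" "c \<in> C" for w c
      using that across_conf_C(1)[of a1 a3 c] across_conf_C(1)[of b1 b3 c] assms by auto
    show "?W \<subseteq> E" using wE by simp
    show "\<exists>c\<in>C. 4 \<le> 2 + length ?ps" using C_nonempty by auto
  qed (use gain2[OF assms(1)] in simp_all)
qed

text \<open>Two pairs across one diagonal and one across the other are added to the gain of
  one.\<close>

lemma diagonal_matched:
  assumes "{a0, b0} \<inter> {a2, b2} = {}" "{a1, b1} \<inter> {a3, b3} = {}"
    and "\<not> adj a0 a2" "\<not> adj b0 b2" "s \<in> {a1, b1}" "t \<in> {a3, b3}" "\<not> adj s t"
  shows "colourable conf E"
proof -
  let ?ps = "[({v0, a0}, {v2, a2}), ({v0, b0}, {v2, b2}), ({v1, s}, {v3, t})]"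
  have st: "{v1, s} \<in> U0 - C" "{v3, t} \<in> U0 - C" using assms pendants by auto
  show ?thesis
  proof (rule reduce[of "{}" ?ps "\<lambda>_. 1"])
    have "card (misses {} {v0, a0}) \<le> 2" "card (misses {} {v2, a2}) \<le> 2"
      "card (misses {} {v0, b0}) \<le> 2" "card (misses {} {v2, b2}) \<le> 2"
      "card (misses {} {v1, s}) \<le> 2" "card (misses {} {v3, t}) \<le> 2"
      by (rule pendant_misses; use assms(5,6) in simp)+
    moreover have "\<not> conf {v0, a0} {v2, a2}" "\<not> conf {v0, b0} {v2, b2}" "\<not> conf {v1, s} {v3, t}"
      by (rule nonconf_opposite; use assms in auto)+
    ultimately show "a \<in> U0 - C \<union> {} \<and> b \<in> U0 - C \<union> {} \<and> \<not> conf a b \<and>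
        card (misses {} a) + card (misses {} b) \<le> 4 + card ({} :: 'a set set)"
      if "(a, b) \<in> set ?ps" for a b
      using that pendants st by auto
    show "distinct (map fst ?ps @ map snd ?ps)" using dsts assms(5,6) by (auto simp: doubleton_eq_iff)
    show "\<exists>c\<in>C. 4 \<le> 1 + length ?ps" using C_nonempty by auto
  qed (use gain1 in simp_all)
qed

text \<open>Two pairs and the gain of one make three everywhere; \<open>c0\<close> is the edge that
  reaches four.\<close>

lemma two_pairs_with_gain:
  assumes "{a0, b0} \<inter> {a2, b2} = {}" "{a1, b1} \<inter> {a3, b3} = {}"
    and "x \<in> {a0, b0}" "y \<in> {a2, b2}" "\<not> adj x y" "s \<in> {a1, b1}" "t \<in> {a3, b3}" "\<not> adj s t"
    and c: "c0 \<in> C" "card (N c0) + 2 \<le> 24"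
  shows "colourable conf E"
proof -
  let ?ps = "[({v0, x}, {v2, y}), ({v1, s}, {v3, t})]"
  have st: "{v1, s} \<in> U0 - C" "{v3, t} \<in> U0 - C" "{v0, x} \<in> U0 - C" "{v2, y} \<in> U0 - C"
    using assms pendants by auto
  show ?thesis
  proof (rule reduce[of "{}" ?ps "\<lambda>c. if c = c0 then 2 else 1"])
    have "card (misses {} {v0, x}) \<le> 2" "card (misses {} {v2, y}) \<le> 2"
      "card (misses {} {v1, s}) \<le> 2" "card (misses {} {v3, t}) \<le> 2"
      by (rule pendant_misses; use assms(3-8) in simp)+
    moreover have "\<not> conf {v0, x} {v2, y}" "\<not> conf {v1, s} {v3, t}"
      by (rule nonconf_opposite; use assms in auto)+
    ultimately show "a \<in> U0 - C \<union> {} \<and> b \<in> U0 - C \<union> {} \<and> \<not> conf a b \<and>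
        card (misses {} a) + card (misses {} b) \<le> 4 + card ({} :: 'a set set)"
      if "(a, b) \<in> set ?ps" for a b
      using that st by auto
    show "distinct (map fst ?ps @ map snd ?ps)" using dsts assms(3-7) by (auto simp: doubleton_eq_iff)
    show "\<exists>c\<in>C. 4 \<le> (if c = c0 then 2 else 1) + length ?ps" using c(1) by (intro bexI[of _ c0]) simp_all
    show "card (N c) + (if c = c0 then 2 else 1) \<le> 24 \<and> 3 \<le> (if c = c0 then 2 else 1) + length ?ps"
      if "c \<in> C" for c using gain1[OF that] c(2) by simp
  qed simp_all
qed

text \<open>An adjacency of \<open>a1\<close> to \<open>p\<close> or \<open>q\<close> is a second
  gain for some cycle edge. Otherwise \<open>{p, q}\<close> stays uncoloured and is paired with
  \<open>{v1, a1}\<close>. That pendant conflicts with both pendants at \<open>v3\<close>, as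
  \<open>a1\<close> is adjacent to both their outer ends, and can miss only \<open>{p, q}\<close>.
  The misses of the three pairs are at most 4 + 1, 2 + 2 and 3 + 2.\<close>

lemma diagonals_unmatched:
  assumes "{a0, b0} \<inter> {a2, b2} = {}" "{a1, b1} \<inter> {a3, b3} = {}"
    and xy: "x \<in> {a0, b0}" "y \<in> {a2, b2}" "\<not> adj x y"
    and pq: "p \<in> {a0, b0}" "q \<in> {a2, b2}" "adj p q"
    and d: "adj a1 a3" "adj a1 b3" and t: "t \<in> {a3, b3}" "\<not> adj b1 t"
  shows "colourable conf E"
proof (cases "adj a1 p \<or> adj a1 q")
  case True
  have "\<exists>c\<in>C. card (N c) + 2 \<le> 24"
  proof (cases "adj a1 p")
    case True
    have h: "adj v0 p" "p \<noteq> v1" "p \<noteq> v3" "adj p a1" using pq dsts adjs adj_sym[OF True] by auto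
    have "card (N {v0, v1}) + 2 \<le> 24"
      using gain_list[of v0 v1 "[(v3, v2), (p, a1)]"] h by (simp add: adjs dsts)
    then show ?thesis using C_nonempty by blast
  next
    case False
    then have T: "adj a1 q" using True by blast
    have h: "adj v2 q" "q \<noteq> v1" "q \<noteq> v3" using pq dsts adjs by auto
    have "card (N {v1, v2}) + 2 \<le> 24"
      using gain_list[of v1 v2 "[(v0, v3), (a1, q)]"] h T by (simp add: adjs dsts)
    then show ?thesis using C_nonempty by blast
  qed
  then obtain c0 where "c0 \<in> C" "card (N c0) + 2 \<le> 24" by blast
  then show ?thesis using two_pairs_with_gain[OF assms(1,2) xy, of b1 t] t by blast
next
  case False
  let ?w = "{p, q}" let ?W = "{{p, q}}"
  let ?ps = "[(?w, {v1, a1}), ({v0, x}, {v2, y}), ({v1, b1}, {v3, t})]"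
  have wE: "?w \<in> E" using pq edge_in_E by simp
  have wU: "?w \<notin> U0" by (rule across_notin(2)) fact+
  have st: "{v3, t} \<in> U0 - C" "{v0, x} \<in> U0 - C" "{v2, y} \<in> U0 - C"
    using xy t pendants by auto
  have E: "{v3, t} \<in> E" "{v1, a1} \<in> E" "{v1, b1} \<in> E" "{v3, a3} \<in> E" "{v3, b3} \<in> E"
    using st pendants U0_subset by auto
  show ?thesis
  proof (rule reduce[of ?W ?ps "\<lambda>_. 1"])
    have "misses ?W ?w \<subseteq> {{v1, a1}, {v1, b1}, {v3, a3}, {v3, b3}}"
      using misses_across(2)[of p q ?W] pq by auto
    then have m1: "card (misses ?W ?w) \<le> 4" by (rule card_le4)
    have ca: "conf {v1, a1} {v3, z}" if "z \<in> {a3, b3}" for z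
      by (rule conf_adj[of _ _ a1 z]) (use E d that dsts in \<open>auto simp: doubleton_eq_iff\<close>)
    have "misses ?W {v1, a1} \<subseteq> ?W" using misses_opposite(2)[of a1 ?W] ca by blast
    then have m2: "card (misses ?W {v1, a1}) \<le> 1" using card_mono[of ?W "misses ?W {v1, a1}"] by simp
    have cs: "conf {v0, x} ?w" "conf {v2, y} ?w"
    proof -
      have "adj v0 p" "adj v2 q" using pq adjs by auto
      moreover have "{v0, x} \<in> E" "{v2, y} \<in> E" using st U0_subset by auto
      moreover have "{v0, x} \<noteq> ?w" "{v2, y} \<noteq> ?w" using st wU by auto
      ultimately show "conf {v0, x} ?w" "conf {v2, y} ?w"
        using conf_adj[of "{v0, x}" ?w v0 p] conf_adj[of "{v2, y}" ?w v2 q] wE by auto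
    qed
    have m3: "card (misses ?W {v0, x}) \<le> 2" "card (misses ?W {v2, y}) \<le> 2"
      by (rule pendant_misses; use cs xy in simp)+
    have "misses ?W {v1, b1} \<subseteq> insert ?w {{v3, a3}, {v3, b3}}" using misses_opposite(2)[of b1 ?W] by auto
    then have m4: "card (misses ?W {v1, b1}) \<le> 3"
      by (rule order.trans[OF card_mono[rotated]]) (auto simp: card_insert_if)
    have "conf {v3, t} {v1, a1}" using ca[OF t(1)] conf_sym by blast
    then have "misses ?W {v3, t} \<subseteq> {{v1, b1}, ?w}" using misses_opposite(4)[OF t(1), of ?W] by auto
    then have m5: "card (misses ?W {v3, t}) \<le> 2" by (rule card_le2)
    have n1: "\<not> conf ?w {v1, a1}"
    proof -
      have "\<not> adj p a1" "\<not> adj q a1" using False adj_commute by blast+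
      then show ?thesis using pq dsts by (auto simp: conf_pair adj_iffs_sym)
    qed
    have n2: "\<not> conf {v0, x} {v2, y}" by (rule nonconf_opposite(1)) (use assms(1) xy in auto)
    have n3: "\<not> conf {v1, b1} {v3, t}" by (rule nonconf_opposite(2)) (use assms(2) t in auto)
    show "a \<in> U0 - C \<union> ?W \<and> b \<in> U0 - C \<union> ?W \<and> \<not> conf a b \<and>
        card (misses ?W a) + card (misses ?W b) \<le> 4 + card ?W"
      if "(a, b) \<in> set ?ps" for a b
      using that pendants(3,4) st m1 m2 m3 m4 m5 n1 n2 n3 by auto
    show "?W \<inter> U0 = {}" using wU by simp
    have "{v0, x} \<noteq> {v1, b1}" "{v0, x} \<noteq> {v1, a1}" "{v0, x} \<noteq> {v2, y}" "{v0, x} \<noteq> {v3, t}"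
      "{v1, b1} \<noteq> {v1, a1}" "{v1, b1} \<noteq> {v2, y}" "{v1, b1} \<noteq> {v3, t}"
      "{v1, a1} \<noteq> {v2, y}" "{v1, a1} \<noteq> {v3, t}" "{v2, y} \<noteq> {v3, t}"
      using dsts xy(1,2) t(1) by (auto simp: doubleton_eq_iff)
    then show "distinct (map fst ?ps @ map snd ?ps)"
      using notin_ne[OF wU st(1)] notin_ne[OF wU st(2)] notin_ne[OF wU st(3)]
        notin_ne[OF wU pendants(3)] notin_ne[OF wU pendants(4)] by simp
    show "conf w c" if "w \<in> ?W" "c \<in> C" for w c using that across_conf_C(2)[of p q c] pq by simp
    show "?W \<subseteq> E" using wE by simp
    show "\<exists>c\<in>C. 4 \<le> 1 + length ?ps" using C_nonempty by auto
  qed (use gain1 in simp_all)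
qed

end

section \<open>Choosing and labelling the four-cycle\<close>

context quartic_graph
begin

lemma nb_split2:
  assumes "v \<in> V" "p \<in> nb v" "q \<in> nb v" "p \<noteq> q"
  obtains a b where "nb v = {p, q, a, b}" "a \<noteq> b" "a \<notin> {p, q}" "b \<notin> {p, q}"
proof -
  have "card (nb v - {p, q}) = 2" using card_nb4[OF assms(1)] assms(2-4) by (subst card_Diff_subset) auto
  then obtain a b where ab: "nb v - {p, q} = {a, b}" "a \<noteq> b" by (meson card_2_iff)
  then have "nb v = {p, q, a, b}" using assms(2,3) by blast
  then show ?thesis using ab that[of a b] by blast
qed

lemma nb_split3:
  assumes "v \<in> V" "p \<in> nb v" "q \<in> nb v" "r \<in> nb v" "p \<noteq> q" "p \<noteq> r" "q \<noteq> r"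
  obtains b where "nb v = {p, q, r, b}"
proof -
  obtain a b where ab: "nb v = {p, q, a, b}" by (rule nb_split2[OF assms(1,2,3,5)])
  have "r = a \<or> r = b" using assms(4,6,7) unfolding ab by simp
  then show ?thesis using that[of b] that[of a] ab by (auto simp: insert_commute)
qed

lemma four_cycleI:
  assumes "nb v0 = {v1, v3, a0, b0}" "nb v1 = {v0, v2, a1, b1}" "nb v2 = {v1, v3, a2, b2}"
    "nb v3 = {v0, v2, a3, b3}" "v0 \<noteq> v2" "v1 \<noteq> v3"
  shows "four_cycle V adj v0 v1 v2 v3 a0 b0 a1 b1 a2 b2 a3 b3"
  using assms quartic_graph_axioms by (simp add: four_cycle_def four_cycle_axioms_def)

text \<open>\<open>v0\<close>, \<open>v2\<close> have three common neighbours \<open>v1\<close>, \<open>v3\<close>, \<open>z\<close>; of these, \<open>v1\<close> and \<open>v3\<close> share a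
  neighbour outside \<open>{v0, v2}\<close> whenever any two of the three do.\<close>

lemma colourable_K23_chosen:
  assumes v02: "v0 \<noteq> v2" and com: "{v1, v3, z} \<subseteq> nb v0 \<inter> nb v2" and d: "v1 \<noteq> v3" "v1 \<noteq> z" "v3 \<noteq> z"
    and choice: "nb v1 \<inter> nb v3 \<subseteq> {v0, v2} \<Longrightarrow> nb v1 \<inter> nb z \<subseteq> {v0, v2} \<and> nb v3 \<inter> nb z \<subseteq> {v0, v2}"
  shows "colourable conf E"
proof -
  have inV: "v0 \<in> V" "v2 \<in> V" "v1 \<in> V" "v3 \<in> V" "z \<in> V"
    using com adj_V adj_V2 by (auto simp: nb_def)
  have rev: "v0 \<in> nb v1" "v2 \<in> nb v1" "v0 \<in> nb v3" "v2 \<in> nb v3" "v0 \<in> nb z" "v2 \<in> nb z"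
    using com adj_sym by (auto simp: nb_def)
  obtain b0 where n0: "nb v0 = {v1, v3, z, b0}" by (rule nb_split3[of v0 v1 v3 z]) (use inV com d in auto)
  obtain b2 where n2: "nb v2 = {v1, v3, z, b2}" by (rule nb_split3[of v2 v1 v3 z]) (use inV com d in auto)
  obtain a1 b1 where n1: "nb v1 = {v0, v2, a1, b1}" "a1 \<noteq> b1" "a1 \<notin> {v0, v2}" "b1 \<notin> {v0, v2}"
    by (rule nb_split2[of v1 v0 v2]) (use inV rev v02 in auto)
  obtain a3 b3 where n3: "nb v3 = {v0, v2, a3, b3}" "a3 \<noteq> b3" "a3 \<notin> {v0, v2}" "b3 \<notin> {v0, v2}"
    by (rule nb_split2[of v3 v0 v2]) (use inV rev v02 in auto)
  have fc: "four_cycle V adj v0 v1 v2 v3 z b0 x y z b2 x' y'"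
    if "{x, y} = {a1, b1}" "{x', y'} = {a3, b3}" for x y x' y'
    by (rule four_cycleI) (use n0 n1(1) n2 n3(1) that v02 d in auto)
  \<comment> \<open>The reflection exchanging \<open>v1\<close> and \<open>v3\<close> transfers the
    gain for an outer neighbour of \<open>v1\<close> to one of \<open>v3\<close>.\<close>
  have fc': "four_cycle V adj v0 v3 v2 v1 z b0 x' y' z b2 x y"
    if "{x, y} = {a1, b1}" "{x', y'} = {a3, b3}" for x y x' y'
    by (rule four_cycleI) (use n0 n1(1) n2 n3(1) that v02 d in auto)
  show ?thesis
  proof (cases "{a1, b1} \<inter> {a3, b3} = {}")
    case True
    then have "nb v1 \<inter> nb v3 \<subseteq> {v0, v2}" using n1 n3 by auto
    then have "nb v1 \<inter> nb z \<subseteq> {v0, v2}" "nb v3 \<inter> nb z \<subseteq> {v0, v2}" using choice by auto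
    \<comment> \<open>Such an adjacency would give \<open>z\<close> and \<open>v1\<close>, or
      \<open>z\<close> and \<open>v3\<close>, a further common neighbour.\<close>
    then have nz: "\<not> adj z x" if "x \<in> {a1, b1, a3, b3}" for x
      using that n1 n3 by (auto simp: nb_def)
    show ?thesis
    proof (cases "\<exists>x\<in>{a1, b1}. \<exists>y\<in>{a3, b3}. adj x y")
      case False
      then show ?thesis using four_cycle.K23_none_adj[OF fc[OF refl refl] refl True] by blast
    next
      case T: True
      then obtain x y where xy: "x \<in> {a1, b1}" "y \<in> {a3, b3}" "adj x y" by blast
      show ?thesis
      proof (cases "\<exists>s\<in>{a1, b1}. \<exists>t\<in>{a3, b3}. \<not> adj s t")
        case True2: True
        then obtain s t where "s \<in> {a1, b1}" "t \<in> {a3, b3}" "\<not> adj s t" by blast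
        then show ?thesis using four_cycle.K23_some_adj[OF fc[OF refl refl] refl True xy] nz xy by blast
      next
        case False
        then show ?thesis
          by (intro four_cycle.K23_all_adj[OF fc[OF refl refl] refl] nz) auto
      qed
    qed
  next
    case False
    then obtain a where "a \<in> {a1, b1}" "a \<in> {a3, b3}" by blast
    then have "\<exists>b. {a, b} = {a1, b1}" "\<exists>b'. {a, b'} = {a3, b3}" by auto
    then obtain b b' where ab: "{a, b} = {a1, b1}" "{a, b'} = {a3, b3}" by blast
    show ?thesis
    proof (cases "b = b'")
      case True
      then show ?thesis using four_cycle.K23_two_shared[OF fc[OF ab] refl refl] by blast
    next
      case ne: False
      show ?thesis
      proof (cases "adj b b'")
        case False
        then show ?thesis using four_cycle.K23_one_shared_nonadj[OF fc[OF ab] refl refl ne] by blast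
      next
        case True
        then show ?thesis
          using four_cycle.K23_one_shared_gain[OF fc[OF ab] refl refl] four_cycle.K23_one_shared_gain[OF fc'[OF ab] refl refl]
            four_cycle.K23_one_shared_adj[OF fc[OF ab] refl refl True] by blast
      qed
    qed
  qed
qed

text \<open>The three common neighbours are interchangeable, so two that share a further neighbour,
  if there are any, can be put on the cycle.\<close>

lemma colourable_K23:
  assumes v02: "v0 \<noteq> v2" and com: "{x, y, z} \<subseteq> nb v0 \<inter> nb v2" and d: "x \<noteq> y" "x \<noteq> z" "y \<noteq> z"
  shows "colourable conf E"
proof (cases "nb x \<inter> nb y \<subseteq> {v0, v2}")
  case False
  then show ?thesis using colourable_K23_chosen[OF v02, of x y z] com d by blast
next
  case xy: True
  show ?thesis
  proof (cases "nb x \<inter> nb z \<subseteq> {v0, v2}")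
    case False
    then show ?thesis using colourable_K23_chosen[OF v02, of x z y] com d by blast
  next
    case xz: True
    show ?thesis
    proof (cases "nb y \<inter> nb z \<subseteq> {v0, v2}")
      case False
      then show ?thesis using colourable_K23_chosen[OF v02, of y z x] com d by blast
    next
      case True
      then show ?thesis using colourable_K23_chosen[OF v02, of x y z] xy xz com d by blast
    qed
  qed
qed

lemma colourable_four_cycle:
  assumes c: "adj v0 v1" "adj v1 v2" "adj v2 v3" "adj v3 v0" and d: "v0 \<noteq> v2" "v1 \<noteq> v3"
  shows "colourable conf E"
proof (cases "\<exists>p q x y z. p \<noteq> q \<and> {x, y, z} \<subseteq> nb p \<inter> nb q \<and> x \<noteq> y \<and> x \<noteq> z \<and> y \<noteq> z")
  case True
  then show ?thesis using colourable_K23 by blast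
next
  case False
  then have noK: "\<not> ({x, y, z} \<subseteq> nb p \<inter> nb q \<and> x \<noteq> y \<and> x \<noteq> z \<and> y \<noteq> z)" if "p \<noteq> q" for p q x y z
    using that by blast
  have inV: "v0 \<in> V" "v1 \<in> V" "v2 \<in> V" "v3 \<in> V" using c adj_V by auto
  have mem: "v1 \<in> nb v0" "v3 \<in> nb v0" "v0 \<in> nb v1" "v2 \<in> nb v1" "v1 \<in> nb v2" "v3 \<in> nb v2" "v0 \<in> nb v3" "v2 \<in> nb v3"
    using c adj_sym by (auto simp: nb_def)
  obtain a0 b0 where n0: "nb v0 = {v1, v3, a0, b0}" "a0 \<noteq> b0" "a0 \<notin> {v1, v3}" "b0 \<notin> {v1, v3}"
    by (rule nb_split2[of v0 v1 v3]) (use inV mem d in auto)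
  obtain a1 b1 where n1: "nb v1 = {v0, v2, a1, b1}" "a1 \<noteq> b1" "a1 \<notin> {v0, v2}" "b1 \<notin> {v0, v2}"
    by (rule nb_split2[of v1 v0 v2]) (use inV mem d in auto)
  obtain a2 b2 where n2: "nb v2 = {v1, v3, a2, b2}" "a2 \<noteq> b2" "a2 \<notin> {v1, v3}" "b2 \<notin> {v1, v3}"
    by (rule nb_split2[of v2 v1 v3]) (use inV mem d in auto)
  obtain a3 b3 where n3: "nb v3 = {v0, v2, a3, b3}" "a3 \<noteq> b3" "a3 \<notin> {v0, v2}" "b3 \<notin> {v0, v2}"
    by (rule nb_split2[of v3 v0 v2]) (use inV mem d in auto)
  have dj02: "{a0, b0} \<inter> {a2, b2} = {}"
  proof (rule ccontr)
    assume "{a0, b0} \<inter> {a2, b2} \<noteq> {}"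
    then obtain z where "z \<in> {a0, b0}" "z \<in> {a2, b2}" by blast
    then show False using noK[OF d(1), of v1 v3 z] n0 n2 d by auto
  qed
  have dj13: "{a1, b1} \<inter> {a3, b3} = {}"
  proof (rule ccontr)
    assume "{a1, b1} \<inter> {a3, b3} \<noteq> {}"
    then obtain z where "z \<in> {a1, b1}" "z \<in> {a3, b3}" by blast
    then show False using noK[OF d(2), of v0 v2 z] n1 n3 d by auto
  qed
  \<comment> \<open>Otherwise \<open>a0\<close> and \<open>b0\<close> would have the three common
    neighbours \<open>v0\<close>, \<open>a2\<close>, \<open>b2\<close>.\<close>
  have ex02: "\<exists>x\<in>{a0, b0}. \<exists>y\<in>{a2, b2}. \<not> adj x y"
  proof (rule ccontr)
    assume "\<not> ?thesis"
    then have "{v0, a2, b2} \<subseteq> nb a0 \<inter> nb b0" using n0(1) adj_sym by (auto simp: nb_def)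
    moreover have "a2 \<in> nb v2" "b2 \<in> nb v2" using n2(1) by auto
    then have "v0 \<noteq> a2" "v0 \<noteq> b2"
      using c triangle_free adj_sym unfolding nb_iff by blast+
    ultimately show False using noK[OF n0(2)] n2(2) by blast
  qed
  have ex13: "\<exists>x\<in>{a1, b1}. \<exists>y\<in>{a3, b3}. \<not> adj x y"
  proof (rule ccontr)
    assume "\<not> ?thesis"
    then have "{v1, a3, b3} \<subseteq> nb a1 \<inter> nb b1" using n1(1) adj_sym by (auto simp: nb_def)
    moreover have "a3 \<in> nb v3" "b3 \<in> nb v3" using n3(1) by auto
    then have "v1 \<noteq> a3" "v1 \<noteq> b3"
      using c triangle_free adj_sym unfolding nb_iff by blast+
    ultimately show False using noK[OF n1(2)] n3(2) by blast
  qed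
  have fc: "four_cycle V adj v0 v1 v2 v3 p0 q0 p1 q1 p2 q2 p3 q3"
    if "{p0, q0} = {a0, b0}" "{p1, q1} = {a1, b1}" "{p2, q2} = {a2, b2}" "{p3, q3} = {a3, b3}"
    for p0 q0 p1 q1 p2 q2 p3 q3
    by (rule four_cycleI) (use n0(1) n1(1) n2(1) n3(1) that d in auto)
  \<comment> \<open>Rotation exchanges the two diagonals; the reflection \<open>fc3\<close>
    exchanges \<open>v1\<close> and \<open>v3\<close>.\<close>
  have fc1: "four_cycle V adj v1 v2 v3 v0 p1 q1 p2 q2 p3 q3 p0 q0"
    if "{p0, q0} = {a0, b0}" "{p1, q1} = {a1, b1}" "{p2, q2} = {a2, b2}" "{p3, q3} = {a3, b3}"
    for p0 q0 p1 q1 p2 q2 p3 q3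
    by (rule four_cycleI) (use n0(1) n1(1) n2(1) n3(1) that d in auto)
  have fc3: "four_cycle V adj v0 v3 v2 v1 p0 q0 p3 q3 p2 q2 p1 q1"
    if "{p0, q0} = {a0, b0}" "{p1, q1} = {a1, b1}" "{p2, q2} = {a2, b2}" "{p3, q3} = {a3, b3}"
    for p0 q0 p1 q1 p2 q2 p3 q3
    by (rule four_cycleI) (use n0(1) n1(1) n2(1) n3(1) that d in auto)
  obtain x y where xy: "x \<in> {a0, b0}" "y \<in> {a2, b2}" "\<not> adj x y" using ex02 by blast
  obtain s t where st: "s \<in> {a1, b1}" "t \<in> {a3, b3}" "\<not> adj s t" using ex13 by blast
  have sw: "{b0, a0} = {a0, b0}" "{b1, a1} = {a1, b1}" "{b2, a2} = {a2, b2}" "{b3, a3} = {a3, b3}" by auto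
  show ?thesis
  proof (cases "(\<not> adj a0 a2 \<and> \<not> adj b0 b2) \<or> (\<not> adj a0 b2 \<and> \<not> adj b0 a2)")
    case True
    then show ?thesis
    proof
      assume "\<not> adj a0 a2 \<and> \<not> adj b0 b2"
      then show ?thesis
        using four_cycle.diagonal_matched[OF fc[OF refl refl refl refl] dj02 dj13 _ _ st] by blast
    next
      assume "\<not> adj a0 b2 \<and> \<not> adj b0 a2"
      then show ?thesis
        using four_cycle.diagonal_matched[OF fc[OF refl refl sw(3) refl] _ dj13 _ _ st] dj02 sw by metis
    qed
  next
    case bad02: False
    show ?thesis
    proof (cases "(\<not> adj a1 a3 \<and> \<not> adj b1 b3) \<or> (\<not> adj a1 b3 \<and> \<not> adj b1 a3)")
      case True
      have yx: "y \<in> {a2, b2}" "x \<in> {a0, b0}" "\<not> adj y x" using xy adj_commute by auto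
      from True show ?thesis
      proof
        assume "\<not> adj a1 a3 \<and> \<not> adj b1 b3"
        then show ?thesis
          using four_cycle.diagonal_matched[OF fc1[OF refl refl refl refl] dj13 _ _ _ yx] dj02 by blast
      next
        assume "\<not> adj a1 b3 \<and> \<not> adj b1 a3"
        then show ?thesis
          using four_cycle.diagonal_matched[OF fc1[OF refl refl refl sw(4)] _ _ _ _ yx] dj02 dj13 by blast
      qed
    next
      case bad13: False
      obtain p q where pq: "p \<in> {a0, b0}" "q \<in> {a2, b2}" "adj p q" using bad02 by blast
      have main: ?thesis if "{d, d'} = {a1, b1}" "adj d a3" "adj d b3" for d d'
      proof -
        have "\<exists>t\<in>{a3, b3}. \<not> adj d' t" using st that by (metis doubleton_eq_iff insertE singletonD)
        then obtain t where "t \<in> {a3, b3}" "\<not> adj d' t" by blast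
        moreover have "{d, d'} \<inter> {a3, b3} = {}" using dj13 that(1) by simp
        ultimately show ?thesis
          using four_cycle.diagonals_unmatched[OF fc[OF refl that(1) refl refl] dj02 _ xy pq that(2,3)] by blast
      qed
      have main': ?thesis if "{d, d'} = {a3, b3}" "adj d a1" "adj d b1" for d d'
      proof -
        have "\<exists>s\<in>{a1, b1}. \<not> adj d' s" using st that adj_commute by (metis doubleton_eq_iff insertE singletonD)
        then obtain s where "s \<in> {a1, b1}" "\<not> adj d' s" by blast
        moreover have "{d, d'} \<inter> {a1, b1} = {}" using dj13 that(1) by auto
        ultimately show ?thesis
          using four_cycle.diagonals_unmatched[OF fc3[OF refl refl refl that(1)] dj02 _ xy pq that(2,3)] by blast
      qed
      \<comment> \<open>Each of the two matchings between the outer neighbours of \<open>v1\<close>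
        and \<open>v3\<close> contains an adjacency. Two edges from different matchings share a
        vertex, which is then adjacent to both outer neighbours on the other side.\<close>
      consider "adj a1 a3" "adj a1 b3" | "adj a1 a3" "adj b1 a3" | "adj b1 b3" "adj a1 b3" | "adj b1 b3" "adj b1 a3"
        using bad13 by blast
      then show ?thesis
      proof cases
        case 1 then show ?thesis using main[OF refl] by blast
      next
        case 2 then show ?thesis using main'[OF refl] adj_commute by blast
      next
        case 3 then show ?thesis using main'[OF sw(4)] adj_commute by blast
      next
        case 4 then show ?thesis using main[OF sw(2)] by blast
      qed
    qed
  qed
qed

end

section \<open>Graphs without cycles of length four\<close>

locale C4_free = quartic_graph +
  assumes no_C4: "p \<noteq> q \<Longrightarrow> adj p x \<Longrightarrow> adj q x \<Longrightarrow> adj p y \<Longrightarrow> adj q y \<Longrightarrow> x = y"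
begin

text \<open>Edges \<open>{u i, a i}\<close> will share one colour and edges \<open>{u i, b i}\<close> another.\<close>

definition config :: "'a \<Rightarrow> (nat \<Rightarrow> 'a) \<Rightarrow> (nat \<Rightarrow> 'a) \<Rightarrow> (nat \<Rightarrow> 'a) \<Rightarrow> bool" where
  "config v u a b \<longleftrightarrow> inj_on u {..<3} \<and>
    (\<forall>i<3. adj v (u i) \<and> adj (u i) (a i) \<and> adj (u i) (b i) \<and> a i \<noteq> v \<and> b i \<noteq> v \<and> a i \<noteq> b i) \<and>
    (\<forall>i<3. \<forall>j<3. \<not> adj (a i) (a j) \<and> \<not> adj (b i) (b j))"

definition blocked :: "(nat \<Rightarrow> 'a) \<Rightarrow> (nat \<Rightarrow> 'a) \<Rightarrow> (nat \<Rightarrow> 'a) \<Rightarrow> 'a set" where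
  "blocked u a b = u ` {..<3} \<union> (a ` {..<3} \<union> b ` {..<3})"

definition step :: "'a set \<Rightarrow> 'a \<Rightarrow> 'a \<Rightarrow> bool" where
  "step B x y \<longleftrightarrow> adj x y \<and> x \<notin> B \<and> y \<notin> B"

definition comp :: "'a set \<Rightarrow> 'a \<Rightarrow> 'a set" where
  "comp B r = {x. (step B)\<^sup>*\<^sup>* r x}"

text \<open>At most one element has \<open>A\<close> and at most one, a different one, has
  \<open>B\<close>. With \<open>A\<close> and \<open>B\<close> as adjacency to two chosen vertices,
  \<open>q\<close> and \<open>p\<close> suit one kind of outer end each, and \<open>r\<close> is a
  spare for both.\<close>

lemma three_of_nb:
  assumes P: "card P = 3" and A: "\<And>x y. x \<in> P \<Longrightarrow> y \<in> P \<Longrightarrow> A x \<Longrightarrow> A y \<Longrightarrow> x = y"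
    and B: "\<And>x y. x \<in> P \<Longrightarrow> y \<in> P \<Longrightarrow> B x \<Longrightarrow> B y \<Longrightarrow> x = y"
    and AB: "\<And>x. x \<in> P \<Longrightarrow> \<not> (A x \<and> B x)"
  shows "\<exists>p q r. p \<in> P \<and> q \<in> P \<and> r \<in> P \<and> p \<noteq> q \<and> p \<noteq> r \<and> q \<noteq> r \<and> \<not> A q \<and> \<not> A r \<and> \<not> B p \<and> \<not> B r"
proof -
  obtain x y z where xyz: "P = {x, y, z}" "x \<noteq> y" "x \<noteq> z" "y \<noteq> z" using P by (metis card_3_iff)
  have a: "\<not> (A x \<and> A y)" "\<not> (A x \<and> A z)" "\<not> (A y \<and> A z)"
    and b: "\<not> (B x \<and> B y)" "\<not> (B x \<and> B z)" "\<not> (B y \<and> B z)"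
    and ab: "\<not> (A x \<and> B x)" "\<not> (A y \<and> B y)" "\<not> (A z \<and> B z)"
    using A B AB xyz by blast+
  have m: "x \<in> P" "y \<in> P" "z \<in> P" using xyz by auto
  have perm: ?thesis if "p \<in> P" "q \<in> P" "r \<in> P" "p \<noteq> q" "p \<noteq> r" "q \<noteq> r" "\<not> A q" "\<not> A r" "\<not> B p" "\<not> B r" for p q r
    using that by blast
  note ne = xyz(2-4) xyz(2-4)[symmetric]
  consider "\<not> A y" "\<not> A z" "\<not> B x" "\<not> B z" | "\<not> A y" "\<not> A z" "\<not> B x" "\<not> B y"
    | "\<not> A x" "\<not> A z" "\<not> B y" "\<not> B z" | "\<not> A x" "\<not> A z" "\<not> B y" "\<not> B x"
    | "\<not> A x" "\<not> A y" "\<not> B z" "\<not> B y" | "\<not> A x" "\<not> A y" "\<not> B z" "\<not> B x"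
    using a b ab by blast
  then show ?thesis
  proof cases
    case 1 then show ?thesis using perm[of x y z] m ne by blast
  next
    case 2 then show ?thesis using perm[of x z y] m ne by blast
  next
    case 3 then show ?thesis using perm[of y x z] m ne by blast
  next
    case 4 then show ?thesis using perm[of y z x] m ne by blast
  next
    case 5 then show ?thesis using perm[of z x y] m ne by blast
  next
    case 6 then show ?thesis using perm[of z y x] m ne by blast
  qed
qed

lemma less3: "i < 3 \<longleftrightarrow> i = 0 \<or> i = 1 \<or> i = (2::nat)" by auto

text \<open>Only \<open>u2\<close> can have \<open>x\<close> as an outer neighbour, so its ends
  \<open>p\<close>, \<open>q\<close> are chosen first, away from \<open>x\<close>. The ends at
  \<open>u0\<close> and \<open>u1\<close> are then taken nonadjacent to \<open>p\<close> or
  \<open>q\<close> as required, with a spare to resolve an adjacency between them.\<close>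

lemma config_exists:
  assumes v: "adj v u0" "adj v u1" "adj v u2" and d: "u0 \<noteq> u1" "u0 \<noteq> u2" "u1 \<noteq> u2"
    and x: "adj u0 x \<Longrightarrow> x = v" "adj u1 x \<Longrightarrow> x = v"
  shows "\<exists>u a b. config v u a b \<and> u ` {..<3} = {u0, u1, u2} \<and> x \<notin> a ` {..<3} \<union> b ` {..<3}"
proof -
  let ?P = "\<lambda>w. nb w - {v}"
  have cP: "card (?P w) = 3" if "adj v w" for w
    using card_nb4[of w] that adj_V2[OF that] adj_sym[OF that] finite_nb[of w] by (simp add: nb_def)
  have "2 \<le> card (?P u2 - {x})" using cP[OF v(3)] by (simp add: card_Diff_singleton_if)
  then obtain T where T: "T \<subseteq> ?P u2 - {x}" "card T = 2" by (rule obtain_subset_with_card_n)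
  then obtain p q where "T = {p, q}" "p \<noteq> q" by (meson card_2_iff)
  then have pq: "p \<in> ?P u2 - {x}" "q \<in> ?P u2 - {x}" "p \<noteq> q" using T by auto
  have pqu: "adj u2 p" "adj u2 q" "p \<noteq> v" "q \<noteq> v" "p \<noteq> x" "q \<noteq> x" using pq by (auto simp: nb_def)
  have choose: "\<exists>p' q' r'. p' \<in> ?P w \<and> q' \<in> ?P w \<and> r' \<in> ?P w \<and> p' \<noteq> q' \<and> p' \<noteq> r' \<and> q' \<noteq> r' \<and>
      \<not> adj p q' \<and> \<not> adj p r' \<and> \<not> adj q p' \<and> \<not> adj q r'" if w: "adj v w" "w \<noteq> u2" for w
  proof (rule three_of_nb[OF cP[OF w(1)]])
    have "p \<noteq> w" "q \<noteq> w" using pqu v w triangle_free adj_sym by blast+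
    then show "x = y" if "x \<in> ?P w" "y \<in> ?P w" "adj p x" "adj p y" for x y
      using no_C4[of w p x y] that by (auto simp: nb_def)
    show "x = y" if "x \<in> ?P w" "y \<in> ?P w" "adj q x" "adj q y" for x y
      using no_C4[of w q x y] that \<open>q \<noteq> w\<close> by (auto simp: nb_def)
    show "\<not> (adj p x \<and> adj q x)" if "x \<in> ?P w" for x
    proof
      assume h: "adj p x \<and> adj q x"
      have "x \<noteq> u2" using that w v triangle_free[of v w u2] by (auto simp: nb_def)
      then show False using no_C4[of x u2 p q] h pqu pq(3) adj_sym by blast
    qed
  qed
  obtain p0 q0 r0 where 0: "p0 \<in> ?P u0" "q0 \<in> ?P u0" "r0 \<in> ?P u0" "p0 \<noteq> q0" "p0 \<noteq> r0" "q0 \<noteq> r0"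
    "\<not> adj p q0" "\<not> adj p r0" "\<not> adj q p0" "\<not> adj q r0" using choose[OF v(1) d(2)] by blast
  obtain p1 q1 r1 where 1: "p1 \<in> ?P u1" "q1 \<in> ?P u1" "r1 \<in> ?P u1" "p1 \<noteq> q1" "p1 \<noteq> r1" "q1 \<noteq> r1"
    "\<not> adj p q1" "\<not> adj p r1" "\<not> adj q p1" "\<not> adj q r1" using choose[OF v(2) d(3)] by blast
  \<comment> \<open>If \<open>q0\<close> is adjacent to \<open>q1\<close>, it is not adjacent to
    \<open>r1\<close>, as two neighbours of \<open>u1\<close> have no second common neighbour. The
    spare \<open>r0\<close> serves \<open>t\<close> in the same way.\<close>
  define s where "s = (if adj q0 q1 then r1 else q1)"
  define t where "t = (if adj p0 p1 then r0 else p0)"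
  have far: "y = z" if "adj w y" "adj w z" "y \<in> ?P w'" "z \<in> ?P w'" "w \<noteq> w'" for w w' y z
    using no_C4[of w w' y z] that by (auto simp: nb_def)
  have q01: "q0 \<noteq> u1" using 0(2) triangle_free[OF v(1), of u1] v(2) by (auto simp: nb_def)
  have p10: "p1 \<noteq> u0" using 1(1) triangle_free[OF v(2), of u0] v(1) by (auto simp: nb_def)
  have s: "s \<in> ?P u1" "s \<noteq> p1" "\<not> adj p s" "\<not> adj q0 s"
    using 1 far[of q0 q1 r1 u1] q01 by (auto simp: s_def)
  have t: "t \<in> ?P u0" "t \<noteq> q0" "\<not> adj q t" "\<not> adj t p1"
    using 0 far[of p1 p0 r0 u0] p10 adj_commute[of p1 p0] adj_commute[of p1 r0] by (auto simp: t_def)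
  let ?u = "\<lambda>i::nat. if i = 0 then u0 else if i = 1 then u1 else u2"
  let ?a = "\<lambda>i::nat. if i = 0 then q0 else if i = 1 then s else p"
  let ?b = "\<lambda>i::nat. if i = 0 then t else if i = 1 then p1 else q"
  have I3: "{..<3} = {0, 1, 2::nat}" by auto
  have "config v ?u ?a ?b"
    unfolding config_def less3
    using v d 0(2) s(1) t(1) 1(1) pqu pq(3) s(2-) t(2-) 0(7,9) 1(7,9) adj_irrefl
      adj_commute[of p q0] adj_commute[of p s] adj_commute[of s q0] adj_commute[of q p1]
      adj_commute[of q t] adj_commute[of p1 t]
    by (auto simp: inj_on_def I3 nb_def)
  moreover have "?u ` {..<3} = {u0, u1, u2}" unfolding I3 by auto
  moreover have "x \<notin> ?a ` {..<3} \<union> ?b ` {..<3}"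
    unfolding I3 using pqu(5,6) x 0(2) s(1) t(1) 1(1) by (auto simp: nb_def)
  ultimately show ?thesis by blast
qed

text \<open>Two of the \<open>u\<close>'s have only \<open>v\<close> as a common neighbour, so at
  most one of them is adjacent to \<open>x\<close> unless \<open>x\<close> is \<open>v\<close>; that
  one takes the place of \<open>u2\<close>.\<close>

lemma config_avoiding:
  assumes v: "adj v u0" "adj v u1" "adj v u2" and d: "u0 \<noteq> u1" "u0 \<noteq> u2" "u1 \<noteq> u2"
  shows "\<exists>u a b. config v u a b \<and> u ` {..<3} = {u0, u1, u2} \<and> x \<notin> a ` {..<3} \<union> b ` {..<3}"
proof -
  have only: "x = v" if "adj w x" "adj w' x" "adj v w" "adj v w'" "w \<noteq> w'" for w w'
    using no_C4[of w w' x v] that adj_sym by blast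
  consider "adj u0 x \<longrightarrow> x = v" "adj u1 x \<longrightarrow> x = v" | "adj u0 x \<longrightarrow> x = v" "adj u2 x \<longrightarrow> x = v"
    | "adj u1 x \<longrightarrow> x = v" "adj u2 x \<longrightarrow> x = v"
    using only v d by blast
  then show ?thesis
  proof cases
    case 1 then show ?thesis using config_exists[of v u0 u1 u2 x] v d by blast
  next
    case 2
    have "{u0, u2, u1} = {u0, u1, u2}" by auto
    then show ?thesis using config_exists[of v u0 u2 u1 x] v d 2 by metis
  next
    case 3
    have "{u1, u2, u0} = {u0, u1, u2}" by auto
    then show ?thesis using config_exists[of v u1 u2 u0 x] v d 3 by metis
  qed
qed

end

text \<open>Maximality ranges over all centres and roots, so a configuration around any other vertex
  can be compared. That the component contains \<open>v\<close> is proved later.\<close>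

locale extremal_config = C4_free +
  fixes v :: 'a and u a b :: "nat \<Rightarrow> 'a" and r :: 'a
  assumes cfg: "config v u a b" and r: "r \<in> V" "r \<notin> blocked u a b"
    and maximal: "\<And>v' u' a' b' r'. config v' u' a' b' \<Longrightarrow> r' \<in> V \<Longrightarrow> r' \<notin> blocked u' a' b' \<Longrightarrow>
      card (comp (blocked u' a' b') r') \<le> card (comp (blocked u a b) r)"
begin

definition B :: "'a set" where "B = blocked u a b"
definition X :: "'a set" where "X = a ` {..<3} \<union> b ` {..<3}"
definition R :: "'a set" where "R = comp B r"
definition Y :: "'a set" where "Y = V - B - R"

lemma B_def': "B = u ` {..<3} \<union> X" by (simp add: B_def X_def blocked_def)

lemma cfgD:
  "inj_on u {..<3}"
  "i < 3 \<Longrightarrow> adj v (u i)" "i < 3 \<Longrightarrow> adj (u i) (a i)" "i < 3 \<Longrightarrow> adj (u i) (b i)"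
  "i < 3 \<Longrightarrow> a i \<noteq> v" "i < 3 \<Longrightarrow> b i \<noteq> v" "i < 3 \<Longrightarrow> a i \<noteq> b i"
  "i < 3 \<Longrightarrow> j < 3 \<Longrightarrow> \<not> adj (a i) (a j)" "i < 3 \<Longrightarrow> j < 3 \<Longrightarrow> \<not> adj (b i) (b j)"
  using cfg unfolding config_def by blast+

lemma X_cases: "x \<in> X \<Longrightarrow> \<exists>i<3. adj (u i) x \<and> x \<noteq> v \<and> (x = a i \<or> x = b i)"
  using cfgD by (auto simp: X_def)

lemma not_adj_v_X: "x \<in> X \<Longrightarrow> \<not> adj v x"
  using X_cases cfgD(2) triangle_free by blast

lemma u_notin_X: "i < 3 \<Longrightarrow> u i \<notin> X"
  using cfgD(2) not_adj_v_X by blast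

lemma v_notin_B: "v \<notin> B"
  using cfgD(2) adj_irrefl X_cases unfolding B_def' by blast

lemma R_subset: "R \<subseteq> V - B"
proof
  fix x assume "x \<in> R"
  then have "(step B)\<^sup>*\<^sup>* r x" by (simp add: R_def comp_def)
  then show "x \<in> V - B"
    by (induction rule: rtranclp_induct) (use r adj_V2 in \<open>auto simp: step_def B_def\<close>)
qed

lemma r_in_R: "r \<in> R" by (simp add: R_def comp_def)

lemma R_closed:
  assumes "x \<in> R" "adj x y" "y \<notin> B" shows "y \<in> R"
proof -
  have "step B x y" using assms R_subset by (auto simp: step_def)
  then show ?thesis using assms(1) unfolding R_def comp_def by simp
qed

lemma Y_R_nonadj: "x \<in> R \<Longrightarrow> y \<in> Y \<Longrightarrow> \<not> adj x y"
  using R_closed by (auto simp: Y_def)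

lemma Y_subset: "Y \<subseteq> V" "Y \<inter> B = {}" "Y \<inter> R = {}" by (auto simp: Y_def)

lemma nb_Y: "y \<in> Y \<Longrightarrow> nb y \<subseteq> Y \<union> B"
  using Y_R_nonadj adj_sym adj_V2 by (auto simp: Y_def nb_def)

lemma exists_exit:
  assumes "Y \<noteq> {}"
  shows "\<exists>x y. x \<in> R \<and> y \<in> B \<and> adj x y"
proof (rule ccontr)
  assume no: "\<not> ?thesis"
  obtain y where "y \<in> Y" using assms by blast
  then have "adj\<^sup>*\<^sup>* r y" using connected r Y_subset by blast
  then have "y \<in> R"
    by (induction rule: rtranclp_induct) (use no r_in_R R_closed in blast)+
  then show False using \<open>y \<in> Y\<close> Y_subset by blast
qed

text \<open>Otherwise the configuration could be moved around \<open>w\<close>, unblocking some exit of \<open>R\<close>.\<close>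

lemma few_in_Y: "card (nb w \<inter> Y) \<le> 2"
proof (rule ccontr)
  assume "\<not> ?thesis"
  then have "3 \<le> card (nb w \<inter> Y)" by simp
  then obtain T where T: "T \<subseteq> nb w \<inter> Y" "card T = 3" by (rule obtain_subset_with_card_n)
  then obtain y0 y1 y2 where y: "T = {y0, y1, y2}" "y0 \<noteq> y1" "y0 \<noteq> y2" "y1 \<noteq> y2" by (metis card_3_iff)
  have yY: "{y0, y1, y2} \<subseteq> Y" and yw: "adj w y0" "adj w y1" "adj w y2" using T y by (auto simp: nb_def)
  obtain p x where p: "p \<in> R" and xB: "x \<in> B" and px: "adj p x" using exists_exit yY by blast
  obtain u' a' b' where c: "config w u' a' b'" and u': "u' ` {..<3} = {y0, y1, y2}"
    and x: "x \<notin> a' ` {..<3} \<union> b' ` {..<3}"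
    using config_avoiding[of w y0 y1 y2 x] yw y(2-4) by blast
  let ?B = "blocked u' a' b'"
  \<comment> \<open>The new middle vertices lie in \<open>Y\<close>, and \<open>Y\<close> has no
    edges to \<open>R\<close>; so the new configuration blocks nothing in \<open>R\<close>, and the
    exit \<open>x\<close> can join the component.\<close>
  have ab: "a' i \<notin> R" "b' i \<notin> R" if "i < 3" for i
  proof -
    have "adj (u' i) (a' i)" "adj (u' i) (b' i)" using c that by (auto simp: config_def)
    moreover have "u' i \<in> Y" using u' yY that by blast
    ultimately show "a' i \<notin> R" "b' i \<notin> R" using Y_R_nonadj adj_sym by blast+
  qed
  have "u' ` {..<3} \<inter> R = {}" "x \<notin> u' ` {..<3}" using u' yY Y_subset xB by auto
  then have BR: "?B \<inter> R = {}" "x \<notin> ?B" using ab x by (auto simp: blocked_def)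
  have sub: "(step ?B)\<^sup>*\<^sup>* r z" if "z \<in> R" for z
  proof -
    have "(step B)\<^sup>*\<^sup>* r z" using that by (simp add: R_def comp_def)
    then show ?thesis
    proof (induction rule: rtranclp_induct)
      case (step y z)
      have "y \<in> R" using step.hyps(1) by (simp add: R_def comp_def)
      moreover have "z \<in> R" using R_closed[OF \<open>y \<in> R\<close>, of z] step.hyps(2) by (simp add: step_def)
      ultimately have "C4_free.step adj ?B y z" using BR step.hyps(2) by (auto simp: step_def)
      then show ?case using step.IH by simp
    qed simp
  qed
  have "step ?B p x" using px p BR by (auto simp: step_def)
  then have "x \<in> comp ?B r" using sub[OF p] by (simp add: comp_def)
  then have "insert x R \<subseteq> comp ?B r" using sub by (auto simp: comp_def)
  moreover have rB: "r \<notin> ?B" using r_in_R BR by blast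
  have "comp ?B r \<subseteq> V"
  proof
    fix z assume "z \<in> comp ?B r"
    then have "(step ?B)\<^sup>*\<^sup>* r z" by (simp add: comp_def)
    then show "z \<in> V" by (induction rule: rtranclp_induct) (use r adj_V2 in \<open>auto simp: step_def\<close>)
  qed
  then have "finite (comp ?B r)" using finite_V finite_subset by blast
  ultimately have "card (insert x R) \<le> card (comp ?B r)" by (simp add: card_mono)
  moreover have "card (insert x R) = Suc (card R)"
    using xB R_subset finite_V finite_subset by (subst card_insert_disjoint) auto
  moreover have "card (comp ?B r) \<le> card R" using maximal[OF c r(1) rB] by (simp add: R_def B_def)
  ultimately show False by simp
qed

text \<open>Otherwise the fourth neighbour \<open>w\<close> of \<open>v\<close> lies in
  \<open>Y\<close>. A neighbour of \<open>w\<close> in \<open>B\<close> would close a triangle or a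
  four-cycle with \<open>v\<close>, so all four neighbours of \<open>w\<close> lie in
  \<open>Y\<close>, too many for \<open>few_in_Y\<close>.\<close>

lemma v_in_R: "v \<in> R"
proof (rule ccontr)
  assume "v \<notin> R"
  have "v \<in> V" using cfgD(2)[of 0] adj_V by auto
  then have vY: "v \<in> Y" using \<open>v \<notin> R\<close> v_notin_B by (simp add: Y_def)
  have "card (u ` {..<3}) = 3" using card_image[OF cfgD(1)] by simp
  then have "\<not> nb v \<subseteq> u ` {..<3}" using card_nb4[OF \<open>v \<in> V\<close>] card_mono[of "u ` {..<3}" "nb v"] by auto
  then obtain w where w: "adj v w" "w \<notin> u ` {..<3}" by (auto simp: nb_def)
  have "w \<notin> X" using w(1) not_adj_v_X by blast
  then have wY: "w \<in> Y" using nb_Y[OF vY] w by (auto simp: nb_def B_def')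
  have "nb w \<inter> B = {}"
  proof (rule ccontr)
    assume "nb w \<inter> B \<noteq> {}"
    then obtain z where z: "adj w z" "z \<in> B" by (auto simp: nb_def)
    show False
    proof (cases "z \<in> X")
      case True
      then obtain i where "i < 3" "adj (u i) z" "z \<noteq> v" using X_cases by blast
      moreover have "u i \<noteq> w" using w(2) \<open>i < 3\<close> by blast
      ultimately show False using no_C4[of v z w "u i"] w z cfgD(2)[of i] adj_sym by blast
    next
      case False
      then obtain i where "i < 3" "z = u i" using z by (auto simp: B_def')
      then show False using z w cfgD(2)[of i] triangle_free by blast
    qed
  qed
  then have "nb w \<subseteq> nb w \<inter> Y" using nb_Y[OF wY] by blast
  then have "card (nb w) \<le> card (nb w \<inter> Y)" by (rule card_mono[rotated]) (simp add: finite_nb)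
  then show False using few_in_Y[of w] card_nb4[of w] wY Y_subset by auto
qed

section \<open>Edges meeting the other components\<close>

lemma finite_sets: "finite Y" "finite B" "finite X" "finite R"
proof -
  show "finite Y" "finite R" using finite_V Y_subset(1) R_subset finite_subset by blast+
  show "finite B" "finite X" by (simp_all add: B_def' X_def)
qed

text \<open>The distance from \<open>v\<close> inside \<open>R\<close> gives no order for edges
  meeting \<open>Y\<close>, so these are coloured at the start. Those at some \<open>u i\<close> can
  wait, since they conflict with the edges at \<open>v\<close>.\<close>

definition E1 :: "'a set set" where "E1 = {e \<in> E. e \<inter> Y \<noteq> {} \<and> e \<inter> u ` {..<3} = {}}"

text \<open>Between \<open>B\<close> and \<open>Y\<close> there are at most 15 edges: one at each of
  the three \<open>u i\<close>, two at each of at most six vertices of \<open>X\<close>. A vertex of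
  \<open>Y\<close> has at least as many neighbours in \<open>B\<close> as in \<open>Y\<close>, so
  degrees inside \<open>Y\<close> sum to at most 15, giving at most 7 edges. With at most 12 between
  \<open>X\<close> and \<open>Y\<close> this makes 19.\<close>

lemma card_E1: "card E1 \<le> 19"
proof -
  let ?I = "{e \<in> E. e \<subseteq> Y}"
  have u1: "card (nb (u i) \<inter> Y) \<le> 1" if i: "i < 3" for i
  proof -
    have "nb (u i) \<inter> Y \<subseteq> nb (u i) - {v, a i, b i}"
      using v_in_R Y_subset i by (auto simp: B_def' X_def)
    then have "card (nb (u i) \<inter> Y) \<le> card (nb (u i) - {v, a i, b i})"
      by (rule card_mono[rotated]) (simp add: finite_nb)
    also have "\<dots> = 4 - 3"
      using cfgD(2-7)[OF i] card_nb4[OF adj_V2[OF cfgD(2)[OF i]]] adj_sym[OF cfgD(2)[OF i]]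
      by (subst card_Diff_subset) (auto simp: nb_def)
    finally show ?thesis by simp
  qed
  have cX: "card X \<le> 6"
    using card_Un_le[of "a ` {..<3}" "b ` {..<3}"] card_image_le[of "{..<3}" a] card_image_le[of "{..<3}" b]
    by (simp add: X_def)
  have "(\<Sum>x\<in>B. card (nb x \<inter> Y)) \<le> (\<Sum>x\<in>u ` {..<3}. card (nb x \<inter> Y)) + (\<Sum>x\<in>X. card (nb x \<inter> Y))"
    unfolding B_def' using sum_Un_nat[of "u ` {..<3}" X "\<lambda>x. card (nb x \<inter> Y)"] finite_sets by simp
  moreover have "(\<Sum>x\<in>u ` {..<3}. card (nb x \<inter> Y)) \<le> card (u ` {..<3}) * 1"
    using sum_bounded_above[of "u ` {..<3}" "\<lambda>x. card (nb x \<inter> Y)" 1] u1 by force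
  moreover have "card (u ` {..<3}) \<le> 3" using card_image_le[of "{..<3}" u] by simp
  moreover have sX: "(\<Sum>x\<in>X. card (nb x \<inter> Y)) \<le> 12"
    using sum_bounded_above[of X "\<lambda>x. card (nb x \<inter> Y)" 2] few_in_Y cX by force
  ultimately have sB: "(\<Sum>x\<in>B. card (nb x \<inter> Y)) \<le> 15" by linarith
  have "(\<Sum>y\<in>Y. card (nb y \<inter> Y)) \<le> (\<Sum>y\<in>Y. card (nb y \<inter> B))"
  proof (rule sum_mono)
    fix y assume y: "y \<in> Y"
    have "4 = card (nb y)" using y Y_subset card_nb4 by auto
    also have "nb y = (nb y \<inter> Y) \<union> (nb y \<inter> B)" using nb_Y[OF y] by blast
    finally have "4 \<le> card (nb y \<inter> Y) + card (nb y \<inter> B)" by (metis card_Un_le)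
    then show "card (nb y \<inter> Y) \<le> card (nb y \<inter> B)" using few_in_Y[of y] by simp
  qed
  also have "\<dots> = (\<Sum>y\<in>Y. \<Sum>x\<in>B. if adj x y then 1 else 0)"
  proof (intro sum.cong refl)
    fix y
    have "nb y \<inter> B = {x \<in> B. adj x y}" using adj_commute by (auto simp: nb_def)
    then show "card (nb y \<inter> B) = (\<Sum>x\<in>B. if adj x y then 1 else 0)"
      using card_filter_sum[of B "\<lambda>x. adj x y"] finite_sets by simp
  qed
  also have "\<dots> = (\<Sum>x\<in>B. \<Sum>y\<in>Y. if adj x y then 1 else 0)" by (rule sum.swap)
  also have "\<dots> = (\<Sum>x\<in>B. card (nb x \<inter> Y))"
  proof (intro sum.cong refl)
    fix x
    have "nb x \<inter> Y = {y \<in> Y. adj x y}" by (auto simp: nb_def)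
    then show "(\<Sum>y\<in>Y. if adj x y then 1 else 0) = card (nb x \<inter> Y)"
      using card_filter_sum[of Y "\<lambda>y. adj x y"] finite_sets by simp
  qed
  also note sB
  finally have YY: "(\<Sum>y\<in>Y. card (nb y \<inter> Y)) \<le> 15" .
  have "(\<Sum>y\<in>Y. card (nb y \<inter> Y)) = (\<Sum>y\<in>Y. \<Sum>e\<in>?I. if y \<in> e then 1 else 0)"
  proof (intro sum.cong refl)
    fix y assume "y \<in> Y"
    then have "{e \<in> ?I. y \<in> e} = (\<lambda>z. {y, z}) ` (nb y \<inter> Y)"
      using adj_sym by (auto simp: E_def nb_def)
    moreover have "inj_on (\<lambda>z. {y, z}) (nb y \<inter> Y)" by (auto simp: inj_on_def doubleton_eq_iff)
    ultimately have "card {e \<in> ?I. y \<in> e} = card (nb y \<inter> Y)" by (simp add: card_image)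
    then show "card (nb y \<inter> Y) = (\<Sum>e\<in>?I. if y \<in> e then 1 else 0)"
      using card_filter_sum[of ?I "\<lambda>e. y \<in> e"] by simp
  qed
  also have "\<dots> = (\<Sum>e\<in>?I. \<Sum>y\<in>Y. if y \<in> e then 1 else 0)" by (rule sum.swap)
  also have "\<dots> = (\<Sum>e\<in>?I. (2::nat))"
  proof (intro sum.cong refl)
    fix e assume e: "e \<in> ?I"
    then have "{y \<in> Y. y \<in> e} = e" by auto
    moreover have "card e = 2" using e by (auto elim!: E_cases)
    ultimately show "(\<Sum>y\<in>Y. if y \<in> e then 1 else 0) = (2::nat)"
      using card_filter_sum[of Y "\<lambda>y. y \<in> e"] finite_sets by simp
  qed
  also have "\<dots> = card ?I * 2" by simp
  finally have I: "card ?I \<le> 7" using YY by linarith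
  let ?J = "\<Union>x\<in>X. (\<lambda>y. {x, y}) ` (nb x \<inter> Y)"
  have "card ?J \<le> (\<Sum>x\<in>X. card ((\<lambda>y. {x, y}) ` (nb x \<inter> Y)))" by (rule card_UN_le) (rule finite_sets)
  also have "\<dots> \<le> (\<Sum>x\<in>X. card (nb x \<inter> Y))" by (rule sum_mono) (simp add: card_image_le finite_nb)
  finally have J: "card ?J \<le> 12" using sX by linarith
  have "E1 \<subseteq> ?I \<union> ?J"
  proof
    fix e assume "e \<in> E1"
    then obtain y where y: "e \<in> E" "y \<in> e" "y \<in> Y" "e \<inter> u ` {..<3} = {}" by (auto simp: E1_def)
    then obtain z where z: "e = {y, z}" "adj y z" using edge_other[OF y(1,2)] by blast
    then have "z \<in> Y \<union> X" using nb_Y[OF y(3)] y(4) by (auto simp: nb_def B_def')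
    then show "e \<in> ?I \<union> ?J"
    proof
      assume "z \<in> X"
      moreover have "e = {z, y}" "y \<in> nb z \<inter> Y" using z y adj_sym by (auto simp: nb_def)
      ultimately show ?thesis by blast
    qed (use y z in auto)
  qed
  moreover have "finite (?I \<union> ?J)" using finite_sets finite_nb by auto
  ultimately have "card E1 \<le> card (?I \<union> ?J)" by (intro card_mono)
  also have "\<dots> \<le> card ?I + card ?J" by (rule card_Un_le)
  finally show ?thesis using I J by linarith
qed

lemma star_disjoint_E1:
  assumes "y \<in> R" shows "star y \<inter> E1 = {}"
proof (rule ccontr)
  assume "star y \<inter> E1 \<noteq> {}"
  then obtain e z where e: "e \<in> E" "y \<in> e" "z \<in> e" "z \<in> Y" by (auto simp: star_def E1_def)
  obtain p q where "e = {p, q}" "adj p q" using E_cases[OF e(1)] by blast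
  then have "y = z \<or> adj y z" using e(2,3) adj_sym by auto
  then show False using Y_R_nonadj[OF assms e(4)] assms e(4) Y_subset(3) by blast
qed

section \<open>Colouring around the extremal configuration\<close>

definition Z0 :: "'a set set" where "Z0 = (\<lambda>i. {u i, a i}) ` {..<3}"
definition Z1 :: "'a set set" where "Z1 = (\<lambda>i. {u i, b i}) ` {..<3}"

lemma u_inj: "i < 3 \<Longrightarrow> j < 3 \<Longrightarrow> u i = u j \<longleftrightarrow> i = j"
  using cfgD(1) by (auto simp: inj_on_def)

lemma u_neq_ab: "i < 3 \<Longrightarrow> j < 3 \<Longrightarrow> u i \<noteq> a j" "i < 3 \<Longrightarrow> j < 3 \<Longrightarrow> u i \<noteq> b j"
  using u_notin_X by (auto simp: X_def)

text \<open>Otherwise \<open>u i\<close> and \<open>u j\<close> would have a second common neighbour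
  besides \<open>v\<close>.\<close>

lemma adj_u_X:
  assumes "i < 3" "j < 3" "x = a j \<or> x = b j" "adj (u i) x"
  shows "i = j"
proof -
  have "adj (u j) x" "x \<noteq> v" using assms(2,3) cfgD by blast+
  then have "u i = u j"
    using no_C4[of v x "u i" "u j"] assms(1,2,4) cfgD(2) adj_sym by metis
  then show ?thesis using u_inj assms by blast
qed

lemma card_Z: "card (Z0 \<union> Z1) = 6"
proof -
  have "card Z0 = 3" "card Z1 = 3"
    unfolding Z0_def Z1_def using u_inj u_neq_ab
    by (subst card_image; fastforce simp: inj_on_def doubleton_eq_iff)+
  moreover have "Z0 \<inter> Z1 = {}"
    using u_inj u_neq_ab cfgD(7) by (fastforce simp: Z0_def Z1_def doubleton_eq_iff)
  ultimately show ?thesis by (subst card_Un_disjoint) (auto simp: Z0_def Z1_def)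
qed

lemma Z_subset_E: "Z0 \<union> Z1 \<subseteq> E"
  using cfgD by (auto simp: Z0_def Z1_def edge_in_E)

lemma Z_E1: "(Z0 \<union> Z1) \<inter> E1 = {}"
  by (auto simp: Z0_def Z1_def E1_def)

lemma Z_nonconf: "e \<in> Z0 \<Longrightarrow> f \<in> Z0 \<Longrightarrow> \<not> conf e f" "e \<in> Z1 \<Longrightarrow> f \<in> Z1 \<Longrightarrow> \<not> conf e f"
proof -
  have gen: "\<not> conf {u i, x} {u j, y}"
    if "i < 3" "j < 3" "x = a i \<or> x = b i" "y = a j \<or> y = b j" "\<not> adj x y" "i \<noteq> j" for i j x y
  proof
    assume "conf {u i, x} {u j, y}"
    then have "u i = u j \<or> u i = y \<or> x = u j \<or> x = y \<or> adj (u i) (u j) \<or> adj (u i) y \<or> adj x (u j) \<or> adj x y"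
      by (auto simp: conf_def)
    moreover have "u i \<noteq> u j" using that u_inj by blast
    moreover have "u i \<noteq> y" "x \<noteq> u j" using that u_neq_ab by metis+
    moreover have "\<not> adj (u i) (u j)" using cfgD(2) that triangle_free by blast
    moreover have "\<not> adj (u i) y" "\<not> adj x (u j)" using adj_u_X that adj_sym by metis+
    moreover have "x \<noteq> y" using adj_u_X[of i j y] that cfgD(3,4) by metis
    ultimately show False using that by blast
  qed
  show "\<not> conf e f" if ef: "e \<in> Z0" "f \<in> Z0"
  proof -
    obtain i j where ij: "i < 3" "j < 3" "e = {u i, a i}" "f = {u j, a j}" using ef by (auto simp: Z0_def)
    then show ?thesis using gen[of i j "a i" "a j"] cfgD(8) conf_irrefl by metis
  qed
  show "\<not> conf e f" if ef: "e \<in> Z1" "f \<in> Z1"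
  proof -
    obtain i j where ij: "i < 3" "j < 3" "e = {u i, b i}" "f = {u j, b j}" using ef by (auto simp: Z1_def)
    then show ?thesis using gen[of i j "b i" "b j"] cfgD(9) conf_irrefl by metis
  qed
qed

lemma star_u_Z:
  assumes i: "i < 3" shows "star (u i) \<inter> (Z0 \<union> Z1) \<subseteq> {{u i, a i}, {u i, b i}}"
  using u_inj[OF i] u_neq_ab(1)[OF i] u_neq_ab(2)[OF i]
  by (auto simp: star_def Z0_def Z1_def)

theorem colourable_config: "colourable conf E"
proof -
  have "\<exists>d :: 'a \<Rightarrow> nat. (\<forall>x\<in>R - {v}. \<exists>y. step B y x \<and> d y < d x) \<and>
    (\<forall>x. x \<in> R \<longrightarrow> (d x = 0 \<longleftrightarrow> x \<in> {v}))"
  proof (rule descent_rank)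
    fix x assume "x \<in> R"
    have sym: "(step B)\<^sup>*\<^sup>* y x" if "(step B)\<^sup>*\<^sup>* x y" for x y
      using that
    proof (induction rule: rtranclp_induct)
      case (step y z)
      have "C4_free.step adj B z y" using step.hyps(2) adj_sym by (auto simp: step_def)
      then show ?case using step.IH by (simp add: converse_rtranclp_into_rtranclp)
    qed simp
    have "(step B)\<^sup>*\<^sup>* r x" "(step B)\<^sup>*\<^sup>* r v" using \<open>x \<in> R\<close> v_in_R by (auto simp: R_def comp_def)
    then show "\<exists>t\<in>{v}. (step B)\<^sup>*\<^sup>* t x" using sym[of r v] by (simp add: rtranclp_trans[of "step B" v r x])
  qed
  then obtain d :: "'a \<Rightarrow> nat" where d: "\<And>x. x \<in> R \<Longrightarrow> x \<noteq> v \<Longrightarrow> \<exists>y. step B y x \<and> d y < d x"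
    by blast
  \<comment> \<open>Edges meeting \<open>R\<close> come by decreasing distance from
    \<open>v\<close>, then those inside \<open>X\<close>, those at the \<open>u i\<close>, and those
    at \<open>v\<close>. Every class but the last has enough conflicts in what follows.\<close>
  define rk where "rk f = (if v \<in> f then 0 else if f \<inter> u ` {..<3} \<noteq> {} then 1
    else if f \<inter> R = {} then 2 else 3 + Min (d ` (f \<inter> R)))" for f
  have finE1: "finite E1" by (simp add: E1_def)
  \<comment> \<open>Colours 0 and 1 are kept for \<open>Z0\<close> and \<open>Z1\<close>; the other
    19 suffice for an injection.\<close>
  have "card E1 \<le> card {2..<21::nat}" using card_E1 by simp
  then obtain h where h: "h ` E1 \<subseteq> {2..<21::nat}" "inj_on h E1"
    using card_le_inj[OF finE1, of "{2..<21::nat}"] by blast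
  define \<phi> where "\<phi> e = (if e \<in> Z0 then 0 else if e \<in> Z1 then 1 else h e)" for e
  let ?D = "E1 \<union> (Z0 \<union> Z1)"
  have finD: "finite ?D" using finE1 by (simp add: Z0_def Z1_def)
  have DE: "?D \<subseteq> E" using Z_subset_E by (auto simp: E1_def)
  have hE1: "\<phi> e = h e" "2 \<le> h e" if "e \<in> E1" for e using Z_E1 that h by (auto simp: \<phi>_def)
  have \<phi>Z: "\<phi> e = 0 \<or> \<phi> e = 1" if "e \<in> Z0 \<union> Z1" for e using that by (auto simp: \<phi>_def)
  have prp: "proper_on conf ?D \<phi>"
    unfolding proper_on_def
  proof (intro ballI impI)
    fix e f assume ef: "e \<in> ?D" "f \<in> ?D" "conf e f"
    have "e \<noteq> f" using ef conf_irrefl by blast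
    show "\<phi> e \<noteq> \<phi> f"
    proof (cases "e \<in> E1"; cases "f \<in> E1")
      assume "e \<in> E1" "f \<in> E1"
      then show ?thesis using h(2) hE1 \<open>e \<noteq> f\<close> by (auto simp: inj_on_def)
    next
      assume "e \<in> E1" "f \<notin> E1"
      then show ?thesis using hE1[of e] \<phi>Z[of f] ef by auto
    next
      assume "e \<notin> E1" "f \<in> E1"
      then show ?thesis using hE1[of f] \<phi>Z[of e] ef by auto
    next
      assume "e \<notin> E1" "f \<notin> E1"
      then have "e \<in> Z0 \<union> Z1" "f \<in> Z0 \<union> Z1" using ef by auto
      then show ?thesis using Z_nonconf ef(3) by (auto simp: \<phi>_def)
    qed
  qed
  have rng: "\<phi> ` ?D \<subseteq> {..<21}"
  proof
    fix n assume "n \<in> \<phi> ` ?D"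
    then obtain e where e: "e \<in> ?D" "n = \<phi> e" by blast
    show "n \<in> {..<21}"
    proof (cases "e \<in> E1")
      case True
      then show ?thesis using h(1) hE1(1)[OF True] e by auto
    next
      case False
      then show ?thesis using \<phi>Z[of e] e by auto
    qed
  qed
  let ?F = "E - ?D"
  \<comment> \<open>Four conflicts neither precoloured nor coloured before \<open>f\<close> leave at
    most 20 that count.\<close>
  have four: "card (\<phi> ` {g \<in> ?D. conf f g}) + card {g \<in> ?F. conf f g \<and> rk f \<le> rk g} \<le> 20"
    if f: "f \<in> E" and S: "S \<subseteq> N f" "4 \<le> card S" "S \<inter> ?D = {}" "\<And>g. g \<in> S \<Longrightarrow> rk g < rk f" for f S
  proof -
    let ?P = "{g \<in> ?D. conf f g}" and ?Q = "{g \<in> ?F. conf f g \<and> rk f \<le> rk g}"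
    have "card (\<phi> ` ?P) \<le> card ?P" by (rule card_image_le) (use finD in simp)
    moreover have "card ?P + card ?Q = card (?P \<union> ?Q)"
      by (rule card_Un_disjoint[symmetric]) (use finD in auto)
    moreover have "?P \<union> ?Q \<subseteq> N f - S" using S(3) S(4) by (fastforce simp: N_def)
    then have "card (?P \<union> ?Q) \<le> card (N f - S)" by (rule card_mono[rotated]) simp
    ultimately show ?thesis using card_N_minus[OF f S(1)] S(2) by linarith
  qed
  have "\<exists>\<psi>. proper_on conf (?D \<union> ?F) \<psi> \<and> \<psi> ` (?D \<union> ?F) \<subseteq> {..<21} \<and> (\<forall>e\<in>?D. \<psi> e = \<phi> e)"
  proof (rule greedy_extend[where r = rk])
    fix f assume f: "f \<in> ?F"
    then have fE: "f \<in> E" and fD: "f \<notin> ?D" by auto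
    have vV: "v \<in> V" using v_in_R R_subset by blast
    consider (K) "v \<in> f" | (C) "v \<notin> f" "f \<inter> u ` {..<3} \<noteq> {}" | (X) "v \<notin> f" "f \<inter> u ` {..<3} = {}" "f \<inter> R = {}"
      | (R) "v \<notin> f" "f \<inter> u ` {..<3} = {}" "f \<inter> R \<noteq> {}" by blast
    then show "card (\<phi> ` {g \<in> ?D. conf f g}) + card {g \<in> ?F. conf f g \<and> rk f \<le> rk g} \<le> 20"
    proof cases
      case K
      \<comment> \<open>All six edges of \<open>?Z\<close> conflict with \<open>f\<close> but show
        two colours only, so the bound is 18 + 2.\<close>
      let ?Z = "Z0 \<union> Z1" and ?P = "{g \<in> E1. conf f g}" and ?Q = "{g \<in> ?F. conf f g \<and> rk f \<le> rk g}"
      have "?Z \<subseteq> N f"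
      proof
        fix g assume g: "g \<in> ?Z"
        then obtain i where "i < 3" "u i \<in> g" by (auto simp: Z0_def Z1_def)
        moreover have "g \<noteq> f" using g fD by blast
        ultimately show "g \<in> N f"
          using conf_adj[of f g v "u i"] K fE g Z_subset_E cfgD(2) by (auto simp: N_def)
      qed
      then have c: "card (N f - ?Z) \<le> 18" using card_N_minus[OF fE, of ?Z] card_Z by simp
      have "\<phi> ` {g \<in> ?D. conf f g} \<subseteq> {0, 1} \<union> \<phi> ` ?P"
      proof (rule image_subsetI)
        fix g assume g: "g \<in> {g \<in> ?D. conf f g}"
        show "\<phi> g \<in> {0, 1} \<union> \<phi> ` ?P"
        proof (cases "g \<in> E1")
          case True
          then show ?thesis using g by blast
        next
          case False
          then show ?thesis using \<phi>Z[of g] g by auto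
        qed
      qed
      then have "card (\<phi> ` {g \<in> ?D. conf f g}) \<le> card ({0, 1} \<union> \<phi> ` ?P)"
        by (rule card_mono[rotated]) (use finE1 in simp)
      also have "\<dots> \<le> card {0, 1::nat} + card (\<phi> ` ?P)" by (rule card_Un_le)
      also have "\<dots> \<le> 2 + card ?P" using card_image_le[of ?P \<phi>] finE1 by simp
      finally have "card (\<phi> ` {g \<in> ?D. conf f g}) \<le> 2 + card ?P" .
      moreover have "card ?P + card ?Q = card (?P \<union> ?Q)"
        by (rule card_Un_disjoint[symmetric]) (use finE1 in auto)
      moreover have "?P \<union> ?Q \<subseteq> N f - ?Z" using Z_E1 by (auto simp: N_def)
      then have "card (?P \<union> ?Q) \<le> card (N f - ?Z)" by (rule card_mono[rotated]) simp
      ultimately show ?thesis using c by linarith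
    next
      case C
      then obtain i where i: "i < 3" "u i \<in> f" by blast
      show ?thesis
      proof (rule four[OF fE])
        show "star v \<subseteq> N f" by (rule star_subset_N[OF fE i(2)]) (use cfgD(2) i C adj_sym in auto)
        show "4 \<le> card (star v)" using card_star[OF vV] by simp
        have "star v \<inter> (Z0 \<union> Z1) = {}" using v_notin_B by (auto simp: star_def Z0_def Z1_def B_def' X_def)
        then show "star v \<inter> ?D = {}" using star_disjoint_E1[OF v_in_R] by blast
        show "rk g < rk f" if "g \<in> star v" for g using that C by (auto simp: rk_def star_def)
      qed
    next
      case X
      \<comment> \<open>An edge meeting \<open>Y\<close> and avoiding the \<open>u i\<close> would
        be in \<open>E1\<close>; so both ends of \<open>f\<close> are in \<open>X\<close>.\<close>
      have "f \<inter> Y = {}" using fD X fE by (auto simp: E1_def)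
      moreover have "f \<subseteq> V" using fE adj_V adj_V2 by (auto simp: E_def)
      ultimately have fX: "f \<subseteq> X" using X unfolding Y_def B_def' by blast
      obtain x y where xy: "f = {x, y}" "adj x y" using E_cases[OF fE] by blast
      then obtain i j where i: "i < 3" "adj (u i) x" and j: "j < 3" "adj (u j) y"
        using fX X_cases by (metis insert_subset)
      have ij: "u i \<noteq> u j" using i j xy triangle_free by metis
      \<comment> \<open>The eight edges at the distinct nonadjacent vertices \<open>u i\<close> and
        \<open>u j\<close> conflict with \<open>f\<close>, and at most four of them are
        precoloured.\<close>
      let ?S = "(star (u i) \<union> star (u j)) - (Z0 \<union> Z1)"
      have uf: "u i \<notin> f" "u j \<notin> f" using X i j by auto
      show ?thesis
      proof (rule four[OF fE])
        have "star (u i) \<subseteq> N f" "star (u j) \<subseteq> N f"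
          using star_subset_N[OF fE, of x "u i"] star_subset_N[OF fE, of y "u j"] xy i j uf adj_sym by auto
        then show "?S \<subseteq> N f" by blast
        have "\<not> adj (u i) (u j)" using cfgD(2) i j triangle_free by blast
        then have "star (u i) \<inter> star (u j) = {}" using ij by (auto simp: star_def E_def adj_commute)
        then have c8: "card (star (u i) \<union> star (u j)) = 8"
          using card_star i j adj_V by (subst card_Un_disjoint) auto
        have "?S = (star (u i) \<union> star (u j)) - (star (u i) \<union> star (u j)) \<inter> (Z0 \<union> Z1)" by blast
        moreover have "card ((star (u i) \<union> star (u j)) \<inter> (Z0 \<union> Z1)) \<le>
            card {{u i, a i}, {u i, b i}, {u j, a j}, {u j, b j}}"
          by (rule card_mono) (use star_u_Z[OF i(1)] star_u_Z[OF j(1)] in auto)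
        moreover have "\<dots> \<le> 4" by (auto simp: card_insert_if)
        ultimately show "4 \<le> card ?S"
          using diff_card_le_card_Diff[of "(star (u i) \<union> star (u j)) \<inter> (Z0 \<union> Z1)" "star (u i) \<union> star (u j)"] c8
          by simp
        show "?S \<inter> ?D = {}" using i(1) j(1) by (auto simp: E1_def star_def)
        show "rk g < rk f" if "g \<in> ?S" for g using that X i(1) j(1) by (auto simp: rk_def star_def)
      qed
    next
      case R
      have finf: "finite (f \<inter> R)" using finite_sets by simp
      then obtain x where x: "x \<in> f" "x \<in> R" "d x = Min (d ` (f \<inter> R))"
        using Min_in[of "d ` (f \<inter> R)"] R by fastforce
      then obtain y where y: "step B y x" "d y < d x" using d R by blast
      have yR: "y \<in> R" using R_closed[OF x(2)] y(1) adj_sym by (auto simp: step_def)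
      have yf: "y \<notin> f" using y(2) x(3) finf yR by (metis IntI Min_le finite_imageI imageI linorder_not_le)
      show ?thesis
      proof (rule four[OF fE])
        show "star y \<subseteq> N f" by (rule star_subset_N[OF fE x(1)]) (use y yf adj_sym in \<open>auto simp: step_def\<close>)
        show "4 \<le> card (star y)" using card_star[of y] yR R_subset by auto
        have "y \<notin> B" using yR R_subset by blast
        then have "star y \<inter> (Z0 \<union> Z1) = {}" by (auto simp: star_def Z0_def Z1_def B_def' X_def)
        then show "star y \<inter> ?D = {}" using star_disjoint_E1[OF yR] by blast
        show "rk g < rk f" if "g \<in> star y" for g
        proof -
          have "y \<in> g \<inter> R" using that yR by (simp add: star_def)
          then have "Min (d ` (g \<inter> R)) \<le> d y" using finite_sets by (intro Min_le) auto
          then have "rk g \<le> 3 + d y" using \<open>y \<in> g \<inter> R\<close> by (auto simp: rk_def)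
          then show ?thesis using R x(3) y(2) by (auto simp: rk_def)
        qed
      qed
    qed
  qed (use finD prp rng finite_E conf_sym conf_irrefl in auto)
  moreover have "?D \<union> ?F = E" using DE by blast
  ultimately show ?thesis unfolding colourable_def by metis
qed

end

context C4_free
begin

theorem colourable_C4_free:
  assumes "V \<noteq> {}"
  shows "colourable conf E"
proof -
  obtain v where v: "v \<in> V" using assms by blast
  have "3 \<le> card (nb v)" using card_nb4[OF v] by simp
  then obtain T where T: "T \<subseteq> nb v" "card T = 3" by (rule obtain_subset_with_card_n)
  then obtain y0 y1 y2 where "T = {y0, y1, y2}" "y0 \<noteq> y1" "y0 \<noteq> y2" "y1 \<noteq> y2" by (metis card_3_iff)
  \<comment> \<open>A configuration has no outer end at its centre, so avoiding \<open>v\<close>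
    asks for nothing beyond \<open>config\<close>.\<close>
  then obtain u a b where c: "config v u a b"
    using config_avoiding[of v y0 y1 y2 v] T by (auto simp: nb_def)
  \<comment> \<open>So \<open>v\<close> is an admissible root, and the maximum is taken over a
    nonempty family.\<close>
  have "v \<notin> blocked u a b" using c adj_irrefl by (auto simp: config_def blocked_def)
  let ?P = "\<lambda>(v, u, a, b, r). config v u a b \<and> r \<in> V \<and> r \<notin> blocked u a b"
  let ?f = "\<lambda>(v :: 'a, u, a, b, r). card (comp (blocked u a b) r)"
  have bound: "?f t \<le> card V" if "?P t" for t
  proof -
    obtain v' u' a' b' r' where t: "t = (v', u', a', b', r')" by (cases t) auto
    have "comp (blocked u' a' b') r' \<subseteq> V"
    proof
      fix z assume "z \<in> comp (blocked u' a' b') r'"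
      then have "(step (blocked u' a' b'))\<^sup>*\<^sup>* r' z" by (simp add: comp_def)
      then show "z \<in> V" by (induction rule: rtranclp_induct) (use that t adj_V2 in \<open>auto simp: step_def\<close>)
    qed
    then show ?thesis using t finite_V by (simp add: card_mono)
  qed
  have "?P (v, u, a, b, v)" using c v \<open>v \<notin> blocked u a b\<close> by simp
  then have "\<exists>t. ?P t \<and> (\<forall>t'. ?P t' \<longrightarrow> ?f t' \<le> ?f t)"
    using ex_has_greatest_nat[of ?P "(v, u, a, b, v)" ?f "card V + 1"] bound by (metis (no_types, lifting) less_Suc_eq_le Suc_eq_plus1 le_SucI)
  then obtain t where t: "?P t" "\<And>t'. ?P t' \<Longrightarrow> ?f t' \<le> ?f t" by blast
  obtain v1 u1 a1 b1 r1 where t1: "t = (v1, u1, a1, b1, r1)" by (cases t) auto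
  interpret extremal_config V adj v1 u1 a1 b1 r1
  proof unfold_locales
    show "config v1 u1 a1 b1" "r1 \<in> V" "r1 \<notin> blocked u1 a1 b1" using t(1) t1 by auto
    show "card (comp (blocked u' a' b') r') \<le> card (comp (blocked u1 a1 b1) r1)"
      if "config v' u' a' b'" "r' \<in> V" "r' \<notin> blocked u' a' b'" for v' u' a' b' r'
      using t(2)[of "(v', u', a', b', r')"] that t1 by simp
  qed
  show ?thesis by (rule colourable_config)
qed

end

section \<open>The general bound\<close>

lemma (in quartic_graph) colourable_quartic:
  assumes "V \<noteq> {}"
  shows "colourable conf E"
proof (cases "\<exists>p q x y. p \<noteq> q \<and> x \<noteq> y \<and> adj p x \<and> adj q x \<and> adj p y \<and> adj q y")
  case True
  then obtain p q x y where "p \<noteq> q" "x \<noteq> y" "adj p x" "adj x q" "adj q y" "adj y p"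
    using adj_sym by blast
  then show ?thesis using colourable_four_cycle by blast
next
  case False
  then interpret C4_free V adj by unfold_locales blast
  show ?thesis by (rule colourable_C4_free[OF assms])
qed

section \<open>From simple graphs back to multigraphs\<close>

context finite_loopless_multigraph
begin

lemma link_neq: "link x y \<Longrightarrow> x \<noteq> y"
  using card_ends by (fastforce simp: link_def)

lemma link_verts: "link x y \<Longrightarrow> x \<in> verts G \<and> y \<in> verts G"
  using ends_subset_verts by (fastforce simp: link_def)

lemma link_ends: "e \<in> edges G \<Longrightarrow> x \<in> ends G e \<Longrightarrow> y \<in> ends G e \<Longrightarrow> x \<noteq> y \<Longrightarrow> ends G e = {x, y} \<and> link x y"
proof -
  assume e: "e \<in> edges G" "x \<in> ends G e" "y \<in> ends G e" "x \<noteq> y"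
  obtain p q where "ends G e = {p, q}" using ends_pair[OF e(1)] by blast
  then have "ends G e = {x, y}" using e(2-4) by auto
  then show ?thesis using e(1) by (auto simp: link_def)
qed

text \<open>An edge incident with both \<open>e\<close> and \<open>f\<close> meets them in ends that
  are equal or linked by it, and \<open>conflict\<close> covers both.\<close>

lemma strong_chromatic_index_le:
  assumes "colourable conflict (edges G)"
  shows "strong_chromatic_index G \<le> 21"
proof -
  obtain c where c: "proper_on conflict (edges G) c" "c ` edges G \<subseteq> {..<21}"
    using assms by (auto simp: colourable_def)
  have "strong_edge_coloring G c"
    unfolding strong_edge_coloring_def
  proof (intro ballI impI)
    fix e f assume ef: "e \<in> edges G" "f \<in> edges G" "e \<noteq> f" "c e = c f"
    then have no: "x \<noteq> y \<and> \<not> link x y" if "x \<in> ends G e" "y \<in> ends G f" for x y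
      using c(1) that by (auto simp: proper_on_def conflict_def)
    have "\<not> incident_edges G e f" using no by (auto simp: incident_edges_def)
    moreover have "\<not> (incident_edges G e h \<and> incident_edges G f h)" if "h \<in> edges G" for h
    proof
      assume "incident_edges G e h \<and> incident_edges G f h"
      then obtain x y where "x \<in> ends G e" "x \<in> ends G h" "y \<in> ends G f" "y \<in> ends G h"
        by (auto simp: incident_edges_def)
      then show False using no link_ends[OF that] by blast
    qed
    ultimately show "\<not> incident_edges G e f \<and> \<not> (\<exists>h\<in>edges G. incident_edges G e h \<and> incident_edges G f h)"
      by blast
  qed
  then have "strong_chromatic_index G \<le> card (c ` edges G)"
    unfolding strong_chromatic_index_def by (intro Least_le) blast
  also have "\<dots> \<le> card {..<21::nat}" by (rule card_mono) (use c in auto)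
  finally show ?thesis by simp
qed

end

context quartic_multigraph
begin

text \<open>If none of the special cases occurs, \<open>ends\<close> is injective on edges and
  identifies them with those of the simple graph given by \<open>link\<close>; its colouring is
  pulled back along \<open>ends\<close>.\<close>

lemma colourable_connected:
  assumes ne: "verts G \<noteq> {}"
  shows "colourable conflict (edges G)"
proof -
  consider v where "v \<in> verts G" "degree G v \<le> 3"
    | e e' where "e \<in> edges G" "e' \<in> edges G" "e \<noteq> e'" "ends G e = ends G e'"
    | x y z where "link x y" "link y z" "link x z"
    | "\<And>v. v \<in> verts G \<Longrightarrow> \<not> degree G v \<le> 3" "inj_on (ends G) (edges G)"
      "\<And>x y z. link x y \<Longrightarrow> link y z \<Longrightarrow> \<not> link x z"
    unfolding inj_on_def by blast
  then show ?thesis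
  proof cases
    case 1
    then show ?thesis by (rule colourable_low_degree)
  next
    case 2
    then show ?thesis by (rule colourable_parallel)
  next
    case 3
    then obtain e e1 e2 where "e \<in> edges G" "ends G e = {x, y}" "e1 \<in> edges G" "ends G e1 = {x, z}"
      "e2 \<in> edges G" "ends G e2 = {y, z}" by (auto simp: link_def)
    then show ?thesis
      using link_neq[OF 3(1)] link_neq[OF 3(2)] link_neq[OF 3(3)] by (intro colourable_triangle)
  next
    case 4
    have ends_link: "{{x, y} |x y. link x y} = ends G ` edges G"
    proof (intro equalityI subsetI)
      fix d assume "d \<in> ends G ` edges G"
      then obtain e where e: "e \<in> edges G" "d = ends G e" by blast
      obtain x y where "ends G e = {x, y}" using ends_pair[OF e(1)] by blast
      then show "d \<in> {{x, y} |x y. link x y}" using e by (auto simp: link_def)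
    qed (auto simp: link_def)
    interpret Q: quartic_graph "verts G" link
    proof unfold_locales
      show "finite (verts G)" by (rule finite_verts)
      show "link x y \<Longrightarrow> link y x" for x y by (rule link_sym)
      show "link x y \<Longrightarrow> x \<in> verts G" for x y using link_verts by blast
      show "link x y \<Longrightarrow> link y z \<Longrightarrow> \<not> link x z" for x y z by (rule 4(3))
      show "x \<in> verts G \<Longrightarrow> y \<in> verts G \<Longrightarrow> link\<^sup>*\<^sup>* x y" for x y by (rule connected)
      show "card {y. link x y} = 4" if x: "x \<in> verts G" for x
      proof -
        have "card (star x) = 4" using 4(1)[OF x] degree_le[OF x] by (simp add: degree_def star_def)
        moreover have "card (ends G ` star x) = card (star x)"
          by (rule card_image) (use 4(2) in \<open>auto simp: inj_on_def star_def\<close>)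
        moreover have "ends G ` star x = (\<lambda>y. {x, y}) ` {y. link x y}"
        proof (intro equalityI subsetI)
          fix d assume "d \<in> ends G ` star x"
          then obtain e where e: "e \<in> edges G" "d = ends G e" "x \<in> ends G e" by (auto simp: star_def)
          obtain p q where "ends G e = {p, q}" using ends_pair[OF e(1)] by blast
          then obtain y where "ends G e = {x, y}" using e(3) by auto
          then show "d \<in> (\<lambda>y. {x, y}) ` {y. link x y}" using e by (auto simp: link_def)
        next
          fix d assume "d \<in> (\<lambda>y. {x, y}) ` {y. link x y}"
          then obtain y e where e: "d = {x, y}" "e \<in> edges G" "ends G e = {x, y}" by (auto simp: link_def)
          then show "d \<in> ends G ` star x" by (intro image_eqI[of _ _ e]) (auto simp: star_def)
        qed
        moreover have "card ((\<lambda>y. {x, y}) ` {y. link x y}) = card {y. link x y}"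
          by (rule card_image) (auto simp: inj_on_def doubleton_eq_iff)
        ultimately show ?thesis by simp
      qed
    qed
    obtain \<phi> where \<phi>: "proper_on Q.conf Q.E \<phi>" "\<phi> ` Q.E \<subseteq> {..<21}"
      using Q.colourable_quartic[OF ne] by (auto simp: colourable_def)
    have QE: "Q.E = ends G ` edges G" using ends_link by (simp add: Q.E_def)
    have "Q.conf (ends G e) (ends G f)" if "conflict e f" for e f
    proof -
      have "ends G e \<noteq> ends G f" using that 4(2) by (auto simp: conflict_def inj_on_def)
      then show ?thesis using that by (auto simp: Q.conf_def QE conflict_def)
    qed
    then have "proper_on conflict (edges G) (\<phi> \<circ> ends G)"
      using \<phi>(1) by (auto simp: proper_on_def QE)
    moreover have "(\<phi> \<circ> ends G) ` edges G \<subseteq> {..<21}" using \<phi>(2) by (auto simp: QE)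
    ultimately show ?thesis unfolding colourable_def by blast
  qed
qed

end

lemma (in finite_loopless_multigraph) colourable_components:
  assumes deg: "\<And>v. v \<in> verts G \<Longrightarrow> degree G v \<le> 4"
  shows "colourable conflict (edges G)"
proof -
  define part where "part x = {y. link\<^sup>*\<^sup>* x y}" for x
  define sub where "sub A = \<lparr>verts = A, edges = {e \<in> edges G. ends G e \<subseteq> A}, ends = ends G\<rparr>" for A
  have sym: "link\<^sup>*\<^sup>* y x" if "link\<^sup>*\<^sup>* x y" for x y
    using that by (induction rule: rtranclp_induct)
      (auto intro: link_sym converse_rtranclp_into_rtranclp)
  have part_eq: "part x = part y" if "link\<^sup>*\<^sup>* x y" for x y
    using that sym[OF that] by (auto simp: part_def intro: rtranclp_trans)
  have "\<exists>\<phi>. (\<forall>e\<in>edges G. \<forall>f\<in>edges G. ends G e \<subseteq> part x \<longrightarrow> ends G f \<subseteq> part x \<longrightarrow> conflict e f \<longrightarrow> \<phi> e \<noteq> \<phi> f) \<and>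
      (\<forall>e\<in>edges G. ends G e \<subseteq> part x \<longrightarrow> \<phi> e < (21::nat))" if x: "x \<in> verts G" for x
  proof -
    let ?H = "sub (part x)"
    have pV: "part x \<subseteq> verts G"
    proof
      fix y assume "y \<in> part x"
      then have "link\<^sup>*\<^sup>* x y" by (simp add: part_def)
      then show "y \<in> verts G" by (induction rule: rtranclp_induct) (use x link_verts in auto)
    qed
    interpret H: finite_loopless_multigraph ?H
      by unfold_locales
        (use finite_verts finite_edges card_ends finite_subset[OF pV] in \<open>auto simp: sub_def\<close>)
    have Hlink: "H.link y z" if yz: "link y z" "y \<in> part x" for y z
    proof -
      have "z \<in> part x" using yz by (auto simp: part_def)
      moreover obtain h where "h \<in> edges G" "ends G h = {y, z}" using yz(1) by (auto simp: link_def)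
      ultimately have "h \<in> edges ?H" "ends ?H h = {y, z}" using yz by (auto simp: sub_def)
      then show ?thesis unfolding H.link_def by blast
    qed
    have reach: "H.link\<^sup>*\<^sup>* x y" if "y \<in> part x" for y
    proof -
      have "link\<^sup>*\<^sup>* x y" using that by (simp add: part_def)
      then show ?thesis
      proof (induction rule: rtranclp_induct)
        case (step y z)
        then show ?case using Hlink[of y z] by (simp add: part_def rtranclp.rtrancl_into_rtrancl)
      qed simp
    qed
    have Hsym: "H.link\<^sup>*\<^sup>* z y" if "H.link\<^sup>*\<^sup>* y z" for y z
      using that by (induction rule: rtranclp_induct)
        (auto intro: H.link_sym converse_rtranclp_into_rtranclp)
    interpret H: quartic_multigraph ?H
    proof unfold_locales
      show "degree ?H v \<le> 4" if "v \<in> verts ?H" for v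
      proof -
        have "degree ?H v \<le> degree G v"
          unfolding degree_def by (rule card_mono) (auto simp: sub_def finite_edges)
        moreover have "v \<in> verts G" using that pV by (auto simp: sub_def)
        ultimately show ?thesis using deg[of v] by simp
      qed
      show "H.link\<^sup>*\<^sup>* y z" if "y \<in> verts ?H" "z \<in> verts ?H" for y z
      proof -
        have "y \<in> part x" "z \<in> part x" using that by (auto simp: sub_def)
        then show ?thesis by (intro rtranclp_trans[OF Hsym[OF reach] reach])
      qed
    qed
    have "verts ?H \<noteq> {}" by (auto simp: sub_def part_def)
    then obtain \<phi> where \<phi>: "proper_on H.conflict (edges ?H) \<phi>" "\<phi> ` edges ?H \<subseteq> {..<21}"
      using H.colourable_connected by (auto simp: colourable_def)
    have "H.conflict e f" if "conflict e f" "ends G e \<subseteq> part x" "ends G f \<subseteq> part x" for e f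
    proof -
      have *: "e \<in> edges ?H" "f \<in> edges ?H" "ends ?H e = ends G e" "ends ?H f = ends G f"
        using that by (auto simp: sub_def conflict_def)
      then show ?thesis using that Hlink unfolding conflict_def H.conflict_def by (metis subsetD)
    qed
    then show ?thesis using \<phi>
      by (intro exI[of _ \<phi>]) (auto simp: proper_on_def sub_def)
  qed
  then obtain \<Phi> where \<Phi>: "\<And>x e f. x \<in> verts G \<Longrightarrow> e \<in> edges G \<Longrightarrow> f \<in> edges G \<Longrightarrow>
      ends G e \<subseteq> part x \<Longrightarrow> ends G f \<subseteq> part x \<Longrightarrow> conflict e f \<Longrightarrow> \<Phi> x e \<noteq> \<Phi> x f"
    "\<And>x e. x \<in> verts G \<Longrightarrow> e \<in> edges G \<Longrightarrow> ends G e \<subseteq> part x \<Longrightarrow> \<Phi> x e < (21::nat)"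
    by metis
  \<comment> \<open>The colouring \<open>\<Phi> x\<close> depends on \<open>x\<close>, not only on
    its component, so a fixed representative makes all edges of one component use the same
    colouring.\<close>
  define root where "root P = (SOME x. x \<in> verts G \<and> part x = P)" for P
  define base where "base e = root (part (SOME x. x \<in> ends G e))" for e
  have base: "base e = root (part x) \<and> base e \<in> verts G \<and> part (base e) = part x \<and> ends G e \<subseteq> part x"
    if e: "e \<in> edges G" "x \<in> ends G e" for e x
  proof -
    let ?y = "SOME x. x \<in> ends G e"
    have y: "?y \<in> ends G e" using e(2) by (rule someI)
    have near: "link\<^sup>*\<^sup>* x z" if "z \<in> ends G e" for z
      using link_ends[OF e(1,2) that] by (cases "x = z") auto
    then have "part ?y = part x" using part_eq[OF near[OF y]] by simp
    moreover have "x \<in> verts G" using e ends_subset_verts by blast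
    then have "root (part x) \<in> verts G \<and> part (root (part x)) = part x"
      unfolding root_def by (intro someI[of "\<lambda>z. z \<in> verts G \<and> part z = part x" x]) simp
    ultimately show ?thesis using near by (auto simp: base_def part_def)
  qed
  have "proper_on conflict (edges G) (\<lambda>e. \<Phi> (base e) e)"
    unfolding proper_on_def
  proof (intro ballI impI)
    fix e f assume ef: "e \<in> edges G" "f \<in> edges G" "conflict e f"
    then obtain x y where xy: "x \<in> ends G e" "y \<in> ends G f" "x = y \<or> link x y" by (auto simp: conflict_def)
    then have "part x = part y" using part_eq[of x y] by auto
    then show "\<Phi> (base e) e \<noteq> \<Phi> (base f) f"
      using base[OF ef(1) xy(1)] base[OF ef(2) xy(2)] \<Phi>(1)[of "base e" e f] ef by auto
  qed
  moreover have "(\<lambda>e. \<Phi> (base e) e) ` edges G \<subseteq> {..<21}"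
  proof
    fix n assume "n \<in> (\<lambda>e. \<Phi> (base e) e) ` edges G"
    then obtain e where e: "e \<in> edges G" "n = \<Phi> (base e) e" by blast
    obtain x where x: "x \<in> ends G e" using ends_pair[OF e(1)] by blast
    have "base e \<in> verts G" "ends G e \<subseteq> part (base e)" using base[OF e(1) x] by metis+
    then show "n \<in> {..<21}" using \<Phi>(2)[OF _ e(1)] e(2) by simp
  qed
  ultimately show ?thesis unfolding colourable_def by blast
qed

theorem theorem1p2:
  fixes G :: "('v, 'e) multigraph"
  assumes "finite_loopless_multigraph G"
    and "max_degree G = 4"
  shows "strong_chromatic_index G \<le> 21"
proof -
  interpret finite_loopless_multigraph G by (rule assms(1))
  have "degree G v \<le> 4" if "v \<in> verts G" for v
    using that assms(2) finite_verts Max_ge[of "insert 0 (degree G ` verts G)" "degree G v"]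
    by (simp add: max_degree_def)
  then show ?thesis by (intro strong_chromatic_index_le colourable_components)
qed

end
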